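(* Let $0<\alpha<\omega_1$, let $\|\cdot\|_\alpha$ be the admissible norm derived from the $\alpha$-th Schreier family $\mathscr S_\alpha$, and let $\nu^\alpha$ be the associated exhaustive submeasure, i.e. the submeasure $\nu_0$ on $\mathcal B$ constructed from the norm $\|\cdot\|_\alpha$. Then $$\omega^\alpha\le{\rm rk}(\nu^\alpha)\le\omega^{\omega\cdot(\alpha+1)^\omega}$$ (ordinal arithmetic).
   Context: $\mathbb N=\{0,1,2,\dots\}$; $[\mathbb N]^{<\omega}$ is the set of finite subsets of $\mathbb N$; $\mathbb R^+$ is the set of nonnegative reals. Schreier families. Fix a sequence $(<_n)_{n\in\mathbb N}$ of tree orderings on $\omega_1$ (strict partial orders in which the predecessors of each element are well-ordered) such that: (1) if $n<m$ and $\xi<_n\eta$ then $\xi<_m\eta$; (2) each $(\omega_1,<_n)$ has finite height; (3) the usual order $<$ on $\omega_1$ is $\bigcup_n<_n$; and $0<_n\xi$ for all $0<\xi<\omega_1$ and all $n$. For $0<\alpha<\omega_1$, $\mathscr S_\alpha$ is the collection of all $F\in[\mathbb N]^{<\omega}$ such that, if $F=\{n_0<\dots<n_{k-1}\}$, there is a sequence of ordinals $(\alpha_i)_{i\le k}$ with $\alpha_0=\alpha$ and $\alpha_{i+1}<_{n_i}\alpha_i$ for all $i<k$. For $A\in[\mathbb N]^{<\omega}$, $\|A\|_\alpha$ is the least number of members of $\mathscr S_\alpha$ needed to cover $A$. The space. $T=\prod_n2^n$ is the set of functions $x$ on $\mathbb N$ with $x(n)\in\{0,\dots,2^n-1\}$.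 $\mathcal B_n$ is the algebra of subsets of $T$ depending only on coordinates $<n$, $\mathcal B=\bigcup_n\mathcal B_n$, and $\mathcal A_n$ is the set of atoms of $\mathcal B_n$. For a finite partial function $u$ with $u(k)<2^k$ on its domain, $N_u=\{x\in T:u\subseteq x\}$; $\mathcal A_m$ consists of the $N_u$ with ${\rm dom}(u)=\{0,\dots,m-1\}$. For $A=N_u\in\mathcal A_m$, $\pi_A:T\to A$ is given by $\pi_A(z)(i)=u(i)$ if $i<m$ and $\pi_A(z)(i)=z(i)$ otherwise. Submeasures. A submeasure on $\mathcal B$ is a function $\nu:\mathcal B\to[0,+\infty]$ that is monotone, subadditive ($\nu(x\cup y)\le\nu(x)+\nu(y)$) and has $\nu(\emptyset)=0$; it is exhaustive if $\nu(a_n)\to0$ for every pairwise disjoint sequence $(a_n)_n$. Thinness. For $\phi:\mathcal B\to[0,+\infty]$ and $m<n$, $X\in\mathcal B$ is $(m,n,\phi)$-thin if for every $A\in\mathcal A_m$ there is $H\in\mathcal B_n$ with $H\subseteq A\setminus X$ and $\phi(\pi_A^{-1}(H))>1$. For $I\subseteq\mathbb N$, $X$ is $(I,\phi)$-thin if it is $(m,n,\phi)$-thin for all $m<n$ in $I$. Construction from a norm $\|\cdot\|$ (here $\|\cdot\|=\|\cdot\|_\alpha$). For $\mathcal E\subseteq\mathcal B\times[\mathbb N]^{<\omega}\times\mathbb R^+$ and $X\in\mathcal B$ let $\phi_{\mathcal E}(X)=\inf\{\sum_{(Y,I,w)\in\mathcal F}w:\mathcal F\subseteq\mathcal E\text{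 finite},\ X\subseteq\bigcup_{(Y,I,w)\in\mathcal F}Y\}$, with $\phi_{\mathcal E}(\emptyset)=0$ and $\phi_{\mathcal E}(X)=+\infty$ if no such $\mathcal F$ exists. Let $a_k=\frac1{(k+5)^3}$ and $M_k=2^{2k+12}\cdot2^{(k+4)(k+5)^3}$. For $p\in\mathbb N$ define $\mathcal C_{k,p}$, $k\le p$, by downward induction on $k$: $\mathcal C_{p,p}=\emptyset$; $\nu_{k,p}=\phi_{\mathcal C_{k,p}}$; and for $k<p$, $\mathcal C_{k,p}=\mathcal C_{k+1,p}\cup\mathcal E_{k,p}$, where $\mathcal E_{k,p}$ is the set of triples $(E,I,w)$ with $E\in\mathcal B$, $I\subseteq\mathbb N$ finite nonempty, $\|I\|\le M_k$, $w\ge2^{-k}\big(\frac{M_k}{\|I\|}\big)^{a_k}$, and $E$ $(I,\nu_{k+1,p})$-thin. Fix a nonprincipal ultrafilter $\mathcal U$ on $\mathbb N$ and let $\nu_k(E)=\lim_{p\to\mathcal U}\nu_{k,p}(E)$ for $E\in\mathcal B$. The submeasure $\nu^\alpha$ is $\nu_0$ for the norm $\|\cdot\|_\alpha$; it is exhaustive. Exhaustivity rank. For an exhaustive submeasure $\nu$ on $\mathcal B$ and $\epsilon>0$, $\mathcal D_\epsilon(\nu)$ is the set of finite pairwise disjoint $F\subseteq\mathcal B$ with $\nu(a)\ge\epsilon$ for all $a\in F$; $(\mathcal D_\epsilon(\nu),\supset)$ is well-founded; ${\rm rk}_\epsilon(\nu,F)=\sup\{{\rm rk}_\epsilon(\nu,G)+1:G\in\mathcal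 D_\epsilon(\nu),G\supsetneq F\}$; ${\rm rk}_\epsilon(\nu)={\rm rk}_\epsilon(\nu,\emptyset)$; ${\rm rk}(\nu)=\sup_{\epsilon>0}{\rm rk}_\epsilon(\nu)$. *)

theory Defs
  imports "HOL-Analysis.Analysis" "HOL-Library.Countable_Set_Type"
begin

section \<open>Countable ordinals\<close>

text \<open>
  The elements of \<open>omega1\<close> are the ordinals below \<open>\<omega>\<^sub>1\<close>. All ordinals occurring below are countable
  (the rank trees live on the countable algebra of clopen sets, and countable ordinals are closed
  under sums, products, powers and countable suprema), so this one type carries the indices
  \<open>\<alpha>\<close>, the ranks, and the ordinal arithmetic.
\<close>

typedef omega1 = "Field (cardSuc natLeq)"
  using Field_cardSuc_not_empty[OF natLeq_Card_order] by blast

lemma Well_order_cardSuc_natLeq: "Well_order (cardSuc natLeq)"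
  using cardSuc_Card_order[OF natLeq_Card_order] card_order_on_well_order_on by blast

instantiation omega1 :: wellorder
begin

definition "x \<le> y \<longleftrightarrow> (Rep_omega1 x, Rep_omega1 y) \<in> cardSuc natLeq"
definition "x < y \<longleftrightarrow> x \<le> y \<and> x \<noteq> (y :: omega1)"

instance
proof
  let ?r = "cardSuc natLeq"
  have lin: "Linear_order ?r"
    using Well_order_cardSuc_natLeq by (auto simp: well_order_on_def)
  fix x y z :: omega1
  have anti: "x \<le> y \<Longrightarrow> y \<le> x \<Longrightarrow> x = y" for x y :: omega1
    using lin unfolding less_eq_omega1_def order_on_defs antisym_def
    by (metis Rep_omega1_inject)
  show "x < y \<longleftrightarrow> x \<le> y \<and> \<not> y \<le> x"
    unfolding less_omega1_def using anti lin
    by (metis Rep_omega1 less_eq_omega1_def order_on_defs(1,2,3) refl_onD)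
  show "x \<le> x"
    using lin Rep_omega1 unfolding less_eq_omega1_def order_on_defs refl_on_def by blast
  show "x \<le> y \<Longrightarrow> y \<le> z \<Longrightarrow> x \<le> z"
    using lin unfolding less_eq_omega1_def order_on_defs trans_def by blast
  show "x \<le> y \<Longrightarrow> y \<le> x \<Longrightarrow> x = y" by (fact anti)
  show "x \<le> y \<or> y \<le> x"
    using lin Rep_omega1 Linear_order_in_diff_Id
    unfolding less_eq_omega1_def order_on_defs total_on_def refl_on_def by metis
next
  fix P :: "omega1 \<Rightarrow> bool" and a
  assume step: "\<And>x. (\<And>y. y < x \<Longrightarrow> P y) \<Longrightarrow> P x"
  have wf: "wf (inv_image (cardSuc natLeq - Id) Rep_omega1)"
    using Well_order_cardSuc_natLeq by (intro wf_inv_image) (simp add: well_order_on_def)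
  show "P a"
  proof (induction a rule: wf_induct_rule[OF wf])
    case (1 x)
    show ?case
      by (rule step, rule 1) (auto simp: less_omega1_def less_eq_omega1_def Rep_omega1_inject)
  qed
qed

end

text \<open>
  As for \<^typ>\<open>nat\<close>, the supremum is the least upper bound, and is only meaningful on bounded sets;
  by \<open>bdd_above_countable_omega1\<close> below, every countable set is bounded.
\<close>

instantiation omega1 :: "{conditionally_complete_linorder, zero, one}"
begin

definition inf_omega1 :: "omega1 \<Rightarrow> omega1 \<Rightarrow> omega1" where "inf_omega1 = min"
definition sup_omega1 :: "omega1 \<Rightarrow> omega1 \<Rightarrow> omega1" where "sup_omega1 = max"
definition Inf_omega1 :: "omega1 set \<Rightarrow> omega1" where "Inf (X :: omega1 set) = (LEAST x. x \<in> X)"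
definition Sup_omega1 :: "omega1 set \<Rightarrow> omega1" where "Sup (X :: omega1 set) = (LEAST y. \<forall>x\<in>X. x \<le> y)"
definition zero_omega1 :: omega1 where "0 = (LEAST x :: omega1. True)"
definition one_omega1 :: omega1 where "1 = (LEAST x :: omega1. 0 < x)"

instance
proof
  fix x z :: omega1 and X :: "omega1 set"
  show "x \<in> X \<Longrightarrow> bdd_below X \<Longrightarrow> Inf X \<le> x"
    by (simp add: Inf_omega1_def Least_le)
  show "z \<le> Inf X" if "X \<noteq> {}" and lower: "\<And>x. x \<in> X \<Longrightarrow> z \<le> x"
  proof -
    from that(1) obtain y where "y \<in> X" by blast
    then have "Inf X \<in> X" unfolding Inf_omega1_def by (rule LeastI)
    then show ?thesis by (rule lower)
  qed
  show "x \<le> Sup X" if "x \<in> X" "bdd_above X"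
  proof -
    from that(2) obtain y where "\<forall>x\<in>X. x \<le> y" by (auto simp: bdd_above_def)
    then have "\<forall>x\<in>X. x \<le> Sup X" unfolding Sup_omega1_def by (rule LeastI)
    with that(1) show ?thesis by blast
  qed
  show "X \<noteq> {} \<Longrightarrow> (\<And>x. x \<in> X \<Longrightarrow> x \<le> z) \<Longrightarrow> Sup X \<le> z"
    by (simp add: Sup_omega1_def Least_le)
qed (simp_all add: inf_omega1_def sup_omega1_def)

end

lemma countable_lessThan_omega1: "countable {..<x :: omega1}"
proof -
  include cardinal_syntax
  have "|underS (cardSuc natLeq) (Rep_omega1 x)| <o cardSuc natLeq"
    by (intro card_of_underS cardSuc_Card_order natLeq_Card_order Rep_omega1)
  then have "|underS (cardSuc natLeq) (Rep_omega1 x)| \<le>o natLeq"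
    by (rule iffD1[OF cardSuc_ordLeq_ordLess[OF natLeq_Card_order card_of_Card_order]])
  then have "countable (underS (cardSuc natLeq) (Rep_omega1 x))"
    by (simp add: countable_card_le_natLeq)
  moreover have "Rep_omega1 ` {..<x} \<subseteq> underS (cardSuc natLeq) (Rep_omega1 x)"
    by (auto simp: underS_def less_omega1_def less_eq_omega1_def Rep_omega1_inject)
  ultimately have "countable (Rep_omega1 ` {..<x})"
    by (rule countable_subset[rotated])
  then show ?thesis
    by (rule countable_image_inj_on) (simp add: inj_on_def Rep_omega1_inject)
qed

lemma uncountable_UNIV_omega1: "uncountable (UNIV :: omega1 set)"
proof
  include cardinal_syntax
  assume "countable (UNIV :: omega1 set)"
  then have "countable (range Rep_omega1)" by simp
  then have "countable (Field (cardSuc natLeq))"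
    using type_definition.Rep_range[OF type_definition_omega1] by simp
  then have "|Field (cardSuc natLeq)| \<le>o natLeq"
    by (simp add: countable_card_le_natLeq)
  moreover have "cardSuc natLeq =o |Field (cardSuc natLeq)|"
    by (rule ordIso_symmetric[OF card_of_Field_ordIso[OF cardSuc_Card_order[OF natLeq_Card_order]]])
  ultimately have "cardSuc natLeq \<le>o natLeq" by (rule ordIso_ordLeq_trans[rotated])
  then show False
    by (rule not_ordLess_ordLeq[OF cardSuc_greater[OF natLeq_Card_order], THEN notE])
qed

lemma bdd_above_countable_omega1:
  assumes "countable (A :: omega1 set)"
  shows "bdd_above A"
proof (rule ccontr)
  assume "\<not> bdd_above A"
  then have "UNIV = (\<Union>a\<in>A. {..<a})"
    by (auto simp: bdd_above_def not_le)
  moreover have "countable (\<Union>a\<in>A. {..<a})"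
    by (rule countable_UN[OF assms countable_lessThan_omega1])
  ultimately show False using uncountable_UNIV_omega1 by simp
qed

definition osuc :: "omega1 \<Rightarrow> omega1" where
  "osuc x = (LEAST y. x < y)"

definition omega :: omega1 (\<open>\<omega>\<close>) where
  "\<omega> = (SUP n. (osuc ^^ n) 0)"

text \<open>
  Ordinal arithmetic by recursion on the right argument; these equations combine the usual
  zero, successor and limit clauses. Powers are only used with nonzero bases.
\<close>

instantiation omega1 :: "{plus, times}"
begin

function plus_omega1 :: "omega1 \<Rightarrow> omega1 \<Rightarrow> omega1" where
  "a + b = Sup (insert a ((\<lambda>c. osuc (a + c)) ` {..<b}))"
  by auto
termination by (relation "inv_image {(x, y). x < y} snd") (auto intro: wf)
declare plus_omega1.simps [simp del]

function times_omega1 :: "omega1 \<Rightarrow> omega1 \<Rightarrow> omega1" where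
  "(a :: omega1) * b = Sup ((\<lambda>c. a * c + a) ` {..<b})"
  by auto
termination by (relation "inv_image {(x, y). x < y} snd") (auto intro: wf)
declare times_omega1.simps [simp del]

instance ..

end

function opow :: "omega1 \<Rightarrow> omega1 \<Rightarrow> omega1" (infixr \<open>\<up>\<close> 80) where
  "a \<up> b = Sup (insert 1 ((\<lambda>c. (a \<up> c) * a) ` {..<b}))"
  by auto
termination by (relation "inv_image {(x, y). x < y} snd") (auto intro: wf)
declare opow.simps [simp del]



section \<open>Schreier families\<close>

definition tree_ordering :: "(omega1 \<Rightarrow> omega1 \<Rightarrow> bool) \<Rightarrow> bool" where
  "tree_ordering R \<longleftrightarrow> irreflp R \<and> transp R \<and>
     (\<forall>\<eta>. totalp_on {\<xi>. R \<xi> \<eta>} R \<and> wfp_on {\<xi>. R \<xi> \<eta>} R)"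

text \<open>
  The height of a node is the order type of its set of predecessors, and the height of the tree is
  the least ordinal above the heights of all nodes; it is finite iff the numbers of predecessors
  are finite and uniformly bounded.
\<close>

definition finite_height :: "(omega1 \<Rightarrow> omega1 \<Rightarrow> bool) \<Rightarrow> bool" where
  "finite_height R \<longleftrightarrow> (\<exists>h::nat. \<forall>\<eta>. finite {\<xi>. R \<xi> \<eta>} \<and> card {\<xi>. R \<xi> \<eta>} < h)"

definition schreier_orderings :: "(nat \<Rightarrow> omega1 \<Rightarrow> omega1 \<Rightarrow> bool) \<Rightarrow> bool" where
  "schreier_orderings lt \<longleftrightarrow>
     (\<forall>n. tree_ordering (lt n)) \<and>
     (\<forall>n m \<xi> \<eta>. n < m \<longrightarrow> lt n \<xi> \<eta> \<longrightarrow> lt m \<xi> \<eta>) \<and>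
     (\<forall>n. finite_height (lt n)) \<and>
     (\<forall>\<xi> \<eta>. \<xi> < \<eta> \<longleftrightarrow> (\<exists>n. lt n \<xi> \<eta>)) \<and>
     (\<forall>n \<xi>. 0 < \<xi> \<longrightarrow> lt n 0 \<xi>)"

definition schreier :: "(nat \<Rightarrow> omega1 \<Rightarrow> omega1 \<Rightarrow> bool) \<Rightarrow> omega1 \<Rightarrow> nat set set" where
  "schreier lt \<alpha> = {F. finite F \<and>
     (\<exists>a :: nat \<Rightarrow> omega1. a 0 = \<alpha> \<and>
       (\<forall>i < card F. lt (sorted_list_of_set F ! i) (a (Suc i)) (a i)))}"

definition schreier_norm ::
    "(nat \<Rightarrow> omega1 \<Rightarrow> omega1 \<Rightarrow> bool) \<Rightarrow> omega1 \<Rightarrow> nat set \<Rightarrow> nat" where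
  "schreier_norm lt \<alpha> A =
     (LEAST n. \<exists>S. S \<subseteq> schreier lt \<alpha> \<and> finite S \<and> card S = n \<and> A \<subseteq> \<Union>S)"


section \<open>The algebra\<close>

definition T_space :: "(nat \<Rightarrow> nat) set" where
  "T_space = {x. \<forall>n. x n < 2 ^ n}"

definition Balg_at :: "nat \<Rightarrow> (nat \<Rightarrow> nat) set set" where
  "Balg_at n = {X. X \<subseteq> T_space \<and> (\<forall>x\<in>X. \<forall>y\<in>T_space. (\<forall>i<n. x i = y i) \<longrightarrow> y \<in> X)}"

definition Balg :: "(nat \<Rightarrow> nat) set set" where
  "Balg = (\<Union>n. Balg_at n)"

definition cyl :: "(nat \<rightharpoonup> nat) \<Rightarrow> (nat \<Rightarrow> nat) set" where
  "cyl u = {x \<in> T_space. u \<subseteq>\<^sub>m (\<lambda>i. Some (x i))}"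

text \<open>
  The atoms of \<open>Balg_at m\<close> are the sets \<open>cyl u\<close> for \<open>u \<in> stems m\<close>; distinct stems give distinct atoms,
  so quantifying over the atoms is the same as quantifying over \<open>stems m\<close>.
\<close>

definition stems :: "nat \<Rightarrow> (nat \<rightharpoonup> nat) set" where
  "stems m = {u. dom u = {..<m} \<and> (\<forall>k<m. the (u k) < 2 ^ k)}"

definition proj :: "(nat \<rightharpoonup> nat) \<Rightarrow> (nat \<Rightarrow> nat) \<Rightarrow> (nat \<Rightarrow> nat)" where
  "proj u z = (\<lambda>i. case u i of Some a \<Rightarrow> a | None \<Rightarrow> z i)"


section \<open>Construction of the submeasure\<close>

definition thin_at ::
    "((nat \<Rightarrow> nat) set \<Rightarrow> ennreal) \<Rightarrow> nat \<Rightarrow> nat \<Rightarrow> (nat \<Rightarrow> nat) set \<Rightarrow> bool" where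
  "thin_at \<phi> m n X \<longleftrightarrow>
     (\<forall>u \<in> stems m. \<exists>H \<in> Balg_at n. H \<subseteq> cyl u - X \<and> \<phi> (T_space \<inter> proj u -` H) > 1)"

definition thin :: "((nat \<Rightarrow> nat) set \<Rightarrow> ennreal) \<Rightarrow> nat set \<Rightarrow> (nat \<Rightarrow> nat) set \<Rightarrow> bool" where
  "thin \<phi> I X \<longleftrightarrow> (\<forall>m\<in>I. \<forall>n\<in>I. m < n \<longrightarrow> thin_at \<phi> m n X)"

type_synonym weighted = "(nat \<Rightarrow> nat) set \<times> nat set \<times> real"

text \<open>The infimum is taken in \<^typ>\<open>ennreal\<close>, so it is \<open>\<infinity>\<close> if there is no admissible \<open>F\<close>.\<close>

definition phi :: "weighted set \<Rightarrow> (nat \<Rightarrow> nat) set \<Rightarrow> ennreal" where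
  "phi E X = (INF F \<in> {F. finite F \<and> F \<subseteq> E \<and> X \<subseteq> (\<Union>(Y, I, w)\<in>F. Y)}.
     \<Sum>(Y, I, w)\<in>F. ennreal w)"

definition a_coeff :: "nat \<Rightarrow> real" where
  "a_coeff k = 1 / real ((k + 5) ^ 3)"

definition M_coeff :: "nat \<Rightarrow> nat" where
  "M_coeff k = 2 ^ (2 * k + 12) * 2 ^ ((k + 4) * (k + 5) ^ 3)"

definition E_layer ::
    "(nat set \<Rightarrow> nat) \<Rightarrow> nat \<Rightarrow> ((nat \<Rightarrow> nat) set \<Rightarrow> ennreal) \<Rightarrow> weighted set" where
  "E_layer nrm k \<nu> = {(E, I, w). E \<in> Balg \<and> finite I \<and> I \<noteq> {} \<and> nrm I \<le> M_coeff k \<and>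
     w \<ge> 0 \<and> w \<ge> (1 / 2 ^ k) * (real (M_coeff k) / real (nrm I)) powr a_coeff k \<and>
     thin \<nu> I E}"

text \<open>Only the case \<open>k \<le> p\<close> is relevant; for \<open>k > p\<close> the value is the dummy \<open>{}\<close>.\<close>

function C_class :: "(nat set \<Rightarrow> nat) \<Rightarrow> nat \<Rightarrow> nat \<Rightarrow> weighted set" where
  "C_class nrm k p =
     (if k < p
      then C_class nrm (Suc k) p \<union> E_layer nrm k (phi (C_class nrm (Suc k) p))
      else {})"
  by auto
termination by (relation "Wellfounded.measure (\<lambda>(nrm, k, p). p - k)") auto

declare C_class.simps [simp del]

definition nu_fin :: "(nat set \<Rightarrow> nat) \<Rightarrow> nat \<Rightarrow> nat \<Rightarrow> (nat \<Rightarrow> nat) set \<Rightarrow> ennreal" where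
  "nu_fin nrm k p = phi (C_class nrm k p)"

definition nonprincipal_ultrafilter :: "nat filter \<Rightarrow> bool" where
  "nonprincipal_ultrafilter U \<longleftrightarrow> U \<noteq> bot \<and>
     (\<forall>P. eventually P U \<or> eventually (\<lambda>n. \<not> P n) U) \<and>
     (\<forall>n. eventually (\<lambda>m. m \<noteq> n) U)"

definition nu ::
    "nat filter \<Rightarrow> (nat set \<Rightarrow> nat) \<Rightarrow> nat \<Rightarrow> (nat \<Rightarrow> nat) set \<Rightarrow> ennreal" where
  "nu U nrm k E = Lim U (\<lambda>p. nu_fin nrm k p E)"

lemma tendsto_Lim_ultrafilter:
  fixes f :: "nat \<Rightarrow> ennreal"
  assumes "nonprincipal_ultrafilter U"
  shows "(f \<longlongrightarrow> Lim U f) U"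
proof -
  have ult: "U \<noteq> bot" "\<And>P. eventually P U \<or> eventually (\<lambda>n. \<not> P n) U"
    using assms by (auto simp: nonprincipal_ultrafilter_def)
  have "(f \<longlongrightarrow> Liminf U f) U"
  proof (rule order_tendstoI)
    fix y assume "y < Liminf U f"
    then show "eventually (\<lambda>x. y < f x) U" by (rule less_LiminfD)
  next
    fix y assume y: "Liminf U f < y"
    have "\<not> eventually (\<lambda>x. \<not> f x < y) U"
      using y Liminf_bounded[of y f U] by (auto simp: not_less)
    then show "eventually (\<lambda>x. f x < y) U" using ult(2) by blast
  qed
  with ult(1) show ?thesis by (simp add: tendsto_Lim)
qed

definition nu_schreier ::
    "nat filter \<Rightarrow> (nat \<Rightarrow> omega1 \<Rightarrow> omega1 \<Rightarrow> bool) \<Rightarrow> omega1 \<Rightarrow> (nat \<Rightarrow> nat) set \<Rightarrow> ennreal" where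
  "nu_schreier U lt \<alpha> = nu U (schreier_norm lt \<alpha>) 0"


section \<open>Exhaustivity rank\<close>

definition exhaustive :: "((nat \<Rightarrow> nat) set \<Rightarrow> ennreal) \<Rightarrow> bool" where
  "exhaustive \<nu> \<longleftrightarrow>
     (\<forall>a :: nat \<Rightarrow> _. range a \<subseteq> Balg \<and> disjoint_family a \<longrightarrow> (\<lambda>n. \<nu> (a n)) \<longlonglongrightarrow> 0)"

definition Dfam ::
    "real \<Rightarrow> ((nat \<Rightarrow> nat) set \<Rightarrow> ennreal) \<Rightarrow> (nat \<Rightarrow> nat) set set set" where
  "Dfam \<epsilon> \<nu> = {F. finite F \<and> F \<subseteq> Balg \<and> disjoint F \<and> (\<forall>a\<in>F. \<nu> a \<ge> ennreal \<epsilon>)}"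

definition Drel ::
    "real \<Rightarrow> ((nat \<Rightarrow> nat) set \<Rightarrow> ennreal) \<Rightarrow> ((nat \<Rightarrow> nat) set set \<times> (nat \<Rightarrow> nat) set set) set" where
  "Drel \<epsilon> \<nu> = {(G, F). F \<in> Dfam \<epsilon> \<nu> \<and> G \<in> Dfam \<epsilon> \<nu> \<and> F \<subset> G}"

text \<open>
  Well-founded recursion along \<open>Drel\<close>; the intended recursion equation is \<open>rank_at_eq\<close> below.
  The suprema are over countable sets, as \<open>Balg\<close> is countable.
\<close>

definition rank_at ::
    "real \<Rightarrow> ((nat \<Rightarrow> nat) set \<Rightarrow> ennreal) \<Rightarrow> (nat \<Rightarrow> nat) set set \<Rightarrow> omega1" where
  "rank_at \<epsilon> \<nu> = wfrec (Drel \<epsilon> \<nu>)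
     (\<lambda>r F. SUP G \<in> {G \<in> Dfam \<epsilon> \<nu>. F \<subset> G}. osuc (r G))"

definition rank_eps :: "real \<Rightarrow> ((nat \<Rightarrow> nat) set \<Rightarrow> ennreal) \<Rightarrow> omega1" where
  "rank_eps \<epsilon> \<nu> = rank_at \<epsilon> \<nu> {}"

text \<open>
  Since \<open>rank_eps \<epsilon> \<nu>\<close> increases as \<open>\<epsilon>\<close> decreases, this supremum is that of the countably many
  values at \<open>\<epsilon> = 1 / (n + 1)\<close>.
\<close>

definition exh_rank :: "((nat \<Rightarrow> nat) set \<Rightarrow> ennreal) \<Rightarrow> omega1" where
  "exh_rank \<nu> = (SUP \<epsilon> \<in> {0<..}. rank_eps \<epsilon> \<nu>)"

lemma wf_Drel:
  assumes "exhaustive \<nu>" "\<epsilon> > 0"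
  shows "wf (Drel \<epsilon> \<nu>)"
proof (rule ccontr)
  assume "\<not> wf (Drel \<epsilon> \<nu>)"
  then obtain F where F: "\<And>i. (F (Suc i), F i) \<in> Drel \<epsilon> \<nu>"
    unfolding wf_iff_no_infinite_down_chain by blast
  then have "\<forall>i. \<exists>a. a \<in> F (Suc i) - F i" by (auto simp: Drel_def)
  then obtain a where a: "\<And>i. a i \<in> F (Suc i)" "\<And>i. a i \<notin> F i" by (metis Diff_iff)
  have D: "F i \<in> Dfam \<epsilon> \<nu>" for i using F[of i] by (auto simp: Drel_def)
  have mono: "i \<le> j \<Longrightarrow> F i \<subseteq> F j" for i j
  proof (rule lift_Suc_mono_le[of F])
    show "F n \<subseteq> F (Suc n)" for n using F[of n] by (auto simp: Drel_def)
  qed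
  have disj: "a i \<inter> a j = {}" if "i < j" for i j
  proof -
    have "a i \<in> F j" using a(1)[of i] mono[of "Suc i" j] that by auto
    then have "a i \<noteq> a j" "a i \<in> F (Suc j)" using a(2)[of j] mono[of j "Suc j"] by auto
    then show ?thesis using D[of "Suc j"] a(1)[of j]
      by (auto simp: Dfam_def pairwise_def disjnt_def)
  qed
  have "disjoint_family a"
    unfolding disjoint_family_on_def by (metis disj inf_commute linorder_neqE_nat)
  moreover have "range a \<subseteq> Balg" using a(1) D by (auto simp: Dfam_def)
  ultimately have "(\<lambda>n. \<nu> (a n)) \<longlonglongrightarrow> 0" using assms(1) by (auto simp: exhaustive_def)
  then have "eventually (\<lambda>n. \<nu> (a n) < ennreal \<epsilon>) sequentially"
    by (rule order_tendstoD) (use assms(2) in simp)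
  then obtain n where "\<nu> (a n) < ennreal \<epsilon>" by (auto simp: eventually_sequentially)
  moreover have "\<nu> (a n) \<ge> ennreal \<epsilon>" using a(1)[of n] D[of "Suc n"] by (auto simp: Dfam_def)
  ultimately show False by (metis not_less)
qed

lemma rank_at_eq:
  assumes "exhaustive \<nu>" "\<epsilon> > 0" "F \<in> Dfam \<epsilon> \<nu>"
  shows "rank_at \<epsilon> \<nu> F = (SUP G \<in> {G \<in> Dfam \<epsilon> \<nu>. F \<subset> G}. osuc (rank_at \<epsilon> \<nu> G))"
proof -
  have "(\<lambda>G. osuc (cut (rank_at \<epsilon> \<nu>) (Drel \<epsilon> \<nu>) F G)) ` {G \<in> Dfam \<epsilon> \<nu>. F \<subset> G} =
        (\<lambda>G. osuc (rank_at \<epsilon> \<nu> G)) ` {G \<in> Dfam \<epsilon> \<nu>. F \<subset> G}"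
    using assms(3) by (intro image_cong) (auto simp: cut_def Drel_def)
  then show ?thesis
    using wfrec[OF wf_Drel[OF assms(1,2)],
        of "\<lambda>r F. SUP G \<in> {G \<in> Dfam \<epsilon> \<nu>. F \<subset> G}. osuc (r G)" F]
    by (simp add: rank_at_def)
qed

end

theory Submission
  imports Defs
begin

text \<open>
  Covers. Let \<open>D\<close> be a Schreier set. By downward induction on \<open>k\<close>, no cylinder over \<open>D\<close> has a cover
  from \<open>C_class nrm k p\<close> of weight less than \<open>c_low k \<ge> 8\<close>. The members of level \<open>k\<close> are few and have
  index sets of huge norm, so one can find pairwise separated windows, one for each of them, between
  consecutive elements of its index set and missing \<open>D\<close>. Every other member of the cover keeps a
  definite proportion of its norm in one window or in one gap between windows; choosing among 32
  systems of windows, the total weight concentrated on windows becomes so small that it cannot cover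
  the holes supplied by thinness. A point outside the cover is then built window by window and gap by
  gap.

  Lower bound. If \<open>\<beta>\<close> ends a descending sequence witnessing that \<open>D\<close> is a Schreier set, the rank below a
  cylinder over \<open>D\<close> is at least \<open>\<omega> \<up> \<beta>\<close>: a new coordinate \<open>n\<close> with \<open>lt n \<beta>' \<beta>\<close> splits the cylinder
  into \<open>2 ^ n\<close> disjoint ones, and \<open>n\<close> is arbitrarily large.

  Upper bound. Start from a family of sets of rank at least \<open>\<omega> \<up> (\<omega> * \<gamma>)\<close>. Finitely many factors \<open>\<omega>\<close>
  suffice to find a single hole in each atom of \<open>Balg_at m\<close>, belonging to some \<open>Balg_at n\<close>, that is
  almost disjoint from every member of a subfamily: finite colourings do not decrease ranks of the
  form \<open>\<omega> \<up> r\<close>, and a long sequence of counterexamples is refuted by cutting the index sets of a cover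
  of their union. Repeating this with \<open>n\<close> in place of \<open>m\<close> makes the members of the remaining family
  thin, up to a small error, along an index set \<open>I\<close>. As long as the norm of \<open>I\<close> is smaller than
  \<open>M_coeff k\<close>, descending sequences for the Schreier sets covering \<open>I\<close> provide ordinals
  \<open>\<gamma> < (\<alpha> + 1) \<up> \<omega>\<close> that decrease when \<open>I\<close> grows, so \<open>I\<close> reaches norm \<open>M_coeff k\<close>, and a member of
  the family gets submeasure at most about \<open>1 / 2 ^ k\<close>.
\<close>

section \<open>Ordinal arithmetic\<close>

lemma omega1_gt_ex: "\<exists>y::omega1. x < y"
proof (rule ccontr)
  assume "\<nexists>y. x < y"
  then have "UNIV = insert x {..<x}" by (auto simp: not_less order_le_less)
  then show False using uncountable_UNIV_omega1 countable_lessThan_omega1[of x]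
    by (metis countable_insert)
qed

lemma less_osuc: "x < osuc x"
  unfolding osuc_def by (rule LeastI_ex[OF omega1_gt_ex])

lemma osuc_le_iff: "osuc x \<le> y \<longleftrightarrow> x < y"
  using less_osuc[of x] by (auto simp: osuc_def intro: Least_le)

lemma less_osuc_iff: "x < osuc y \<longleftrightarrow> x \<le> y"
  using osuc_le_iff[of y x] by (auto simp: not_le[symmetric])

lemma osuc_le_osuc_iff [simp]: "osuc x \<le> osuc y \<longleftrightarrow> x \<le> y"
  by (metis less_osuc_iff osuc_le_iff)

lemma omega1_zero_le [simp]: "(0::omega1) \<le> x"
  unfolding zero_omega1_def by (simp add: Least_le)

lemma omega1_not_less_zero [simp]: "\<not> x < (0::omega1)"
  by (simp add: not_less)

lemma omega1_pos_iff: "0 < x \<longleftrightarrow> x \<noteq> (0::omega1)"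
  by (metis antisym_conv2 omega1_zero_le order_less_irrefl)

lemma lessThan_zero_omega1 [simp]: "{..<0::omega1} = {}"
  by auto

lemma one_omega1_eq: "(1::omega1) = osuc 0"
  by (simp add: one_omega1_def osuc_def)

lemma omega1_less_one_iff: "x < (1::omega1) \<longleftrightarrow> x = 0"
  by (metis one_omega1_eq less_osuc_iff omega1_zero_le order_antisym order_refl)

lemma omega1_Sup_upper: "countable A \<Longrightarrow> x \<in> A \<Longrightarrow> x \<le> Sup (A::omega1 set)"
  by (rule cSup_upper[OF _ bdd_above_countable_omega1])

lemma omega1_Sup_least: "(\<And>x. x \<in> A \<Longrightarrow> x \<le> z) \<Longrightarrow> Sup (A::omega1 set) \<le> z"
  unfolding Sup_omega1_def by (rule Least_le) blast

lemma omega1_less_SupD: "y < Sup (A::omega1 set) \<Longrightarrow> \<exists>x\<in>A. y < x"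
  by (meson leD leI omega1_Sup_least)

section \<open>Sums, products and powers\<close>

lemma plus_omega1_ge: "a \<le> a + (b::omega1)"
  by (subst plus_omega1.simps, rule omega1_Sup_upper) (auto intro: countable_lessThan_omega1)

lemma plus_omega1_strict_mono: "c < b \<Longrightarrow> a + c < a + (b::omega1)"
  by (subst (2) plus_omega1.simps, subst osuc_le_iff[symmetric], rule omega1_Sup_upper)
     (auto intro: countable_lessThan_omega1)

lemma plus_omega1_mono: "c \<le> b \<Longrightarrow> a + c \<le> a + (b::omega1)"
  by (metis plus_omega1_strict_mono order_le_less)

lemma less_plus_omega1D: "x < a + (b::omega1) \<Longrightarrow> x < a \<or> (\<exists>c<b. x \<le> a + c)"
  by (subst (asm) plus_omega1.simps, drule omega1_less_SupD) (auto simp: less_osuc_iff)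

lemma plus_omega1_zero [simp]: "a + (0::omega1) = a"
  by (subst plus_omega1.simps) simp

lemma plus_omega1_osuc: "a + osuc b = osuc (a + (b::omega1))"
proof (rule antisym)
  show "a + osuc b \<le> osuc (a + b)"
    by (subst plus_omega1.simps, rule omega1_Sup_least)
       (auto simp: less_osuc_iff plus_omega1_mono plus_omega1_ge intro: order.strict_implies_order)
  show "osuc (a + b) \<le> a + osuc b"
    by (simp add: osuc_le_iff plus_omega1_strict_mono less_osuc)
qed

lemma plus_omega1_one: "a + (1::omega1) = osuc a"
  by (simp add: one_omega1_eq plus_omega1_osuc)

lemma times_omega1_ge: "c < b \<Longrightarrow> a * c + a \<le> a * (b::omega1)"
  by (subst (2) times_omega1.simps, rule omega1_Sup_upper)
     (auto intro: countable_lessThan_omega1)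

lemma less_times_omega1D: "x < a * (b::omega1) \<Longrightarrow> \<exists>c<b. x < a * c + a"
  by (subst (asm) times_omega1.simps, drule omega1_less_SupD) auto

lemma times_omega1_mono: "c \<le> b \<Longrightarrow> a * c \<le> a * (b::omega1)"
  by (metis order_le_less order_trans plus_omega1_ge times_omega1_ge)

lemma times_omega1_osuc: "a * osuc b = a * b + (a::omega1)"
proof (rule antisym)
  show "a * osuc b \<le> a * b + a"
  proof (rule leI, rule notI)
    assume "a * b + a < a * osuc b"
    then obtain c where c: "c \<le> b" "a * b + a < a * c + a"
      using less_times_omega1D less_osuc_iff by metis
    show False
    proof (cases "c = b")
      case False
      then have "a * c + a \<le> a * b + a"
        using times_omega1_ge[of c b a] plus_omega1_ge[of "a*b" a] c(1) by (meson order_le_less order_trans)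
      then show False using c(2) by simp
    qed (use c(2) in simp)
  qed
qed (simp add: times_omega1_ge less_osuc)

lemma times_omega1_zero [simp]: "a * (0::omega1) = 0"
  by (subst times_omega1.simps) (simp add: Sup_omega1_def, simp add: zero_omega1_def)

lemma opow_ge: "c < b \<Longrightarrow> (a \<up> c) * a \<le> a \<up> b"
  by (subst (2) opow.simps, rule omega1_Sup_upper) (auto intro: countable_lessThan_omega1)

lemma one_le_opow: "1 \<le> a \<up> b"
  by (subst opow.simps, rule omega1_Sup_upper) (auto intro: countable_lessThan_omega1)

lemma less_opowD: "x < a \<up> b \<Longrightarrow> x < 1 \<or> (\<exists>c<b. x < (a \<up> c) * a)"
  by (subst (asm) opow.simps, drule omega1_less_SupD) auto

lemma opow_zero: "a \<up> 0 = 1"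
  by (subst opow.simps) simp

lemma times_omega1_ge_self: "1 \<le> b \<Longrightarrow> a \<le> a * (b::omega1)"
proof -
  assume "1 \<le> b"
  then have "a * 0 + a \<le> a * b" by (intro times_omega1_ge) (simp add: one_omega1_eq osuc_le_iff)
  \<comment> \<open>A least counterexample \<open>x\<close> is refuted: the induction hypothesis at
    \<open>0 + x\<close> contradicts strict monotonicity in the right summand.\<close>
  moreover have "a \<le> 0 + a" for a :: omega1
  proof (induction a rule: less_induct)
    case (less x)
    show ?case
    proof (rule leI, rule notI)
      assume "0 + x < x"
      then have "0 + x \<le> 0 + (0 + x)" "0 + (0 + x) < 0 + x"
        using less plus_omega1_strict_mono by blast+
      then show False by simp
    qed
  qed
  ultimately show ?thesis by (metis times_omega1_zero order_trans)
qed

lemma opow_mono: "1 \<le> a \<Longrightarrow> c \<le> b \<Longrightarrow> a \<up> c \<le> a \<up> b"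
  by (metis order_le_less order_trans times_omega1_ge_self opow_ge)

section \<open>Finite ordinals and the first limit\<close>

abbreviation osucs :: "nat \<Rightarrow> omega1 \<Rightarrow> omega1" where
  "osucs n \<equiv> osuc ^^ n"

lemma osucs_less_omega: "osucs n 0 < \<omega>"
proof -
  have "osucs (Suc n) 0 \<le> \<omega>"
    unfolding omega_def by (rule omega1_Sup_upper, simp, rule range_eqI[of _ _ "Suc n"], simp)
  then show ?thesis by (simp add: osuc_le_iff)
qed

lemma less_omegaD:
  assumes "x < \<omega>" shows "\<exists>n. x = osucs n 0"
proof -
  have "x \<le> osucs n 0 \<Longrightarrow> \<exists>n. x = osucs n 0" for n
  proof (induction n)
    case 0
    then show ?case by (metis funpow_0 omega1_zero_le order_antisym)
  next
    case (Suc n)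
    then show ?case by (metis funpow_simps_right(2) comp_apply funpow.simps(2) less_osuc_iff order_le_less)
  qed
  moreover have "\<exists>n. x < osucs n 0"
    using omega1_less_SupD[OF assms[unfolded omega_def]] by auto
  ultimately show ?thesis by (auto dest: less_imp_le)
qed

lemma one_le_omega: "1 \<le> \<omega>"
  using osucs_less_omega[of 1] by (simp add: one_omega1_eq)

lemma osucs_plus: "osucs n a = a + osucs n 0"
  by (induction n) (simp_all add: plus_omega1_osuc)

text \<open>This is why the exponent in the upper bound carries a factor \<open>\<omega>\<close>:
  each stage of that argument consumes finitely many successors, with no bound known in
  advance.\<close>

lemma osucs_times_omega_less:
  assumes "b < c" shows "osucs n (\<omega> * b) < \<omega> * c"
  by (metis assms order_less_le_trans osucs_less_omega osucs_plus plus_omega1_strict_mono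
      times_omega1_ge)

lemma osucs_le: "x \<le> osucs n x"
  by (induction n) (auto intro: less_imp_le less_osuc order_trans)

lemma opow_less_osuc: "\<omega> \<up> b < \<omega> \<up> osuc b"
proof -
  have "\<omega> \<up> b \<le> (\<omega> \<up> b) * 1" by (intro times_omega1_ge_self) simp
  also have "\<dots> = (\<omega> \<up> b) * 1 + 0" by simp
  also have "\<dots> < (\<omega> \<up> b) * 1 + (\<omega> \<up> b)"
    using one_le_opow[of \<omega> b] by (intro plus_omega1_strict_mono) (simp add: one_omega1_eq osuc_le_iff)
  also have "\<dots> \<le> (\<omega> \<up> b) * \<omega>"
    using osucs_less_omega[of 1] by (intro times_omega1_ge) (simp add: one_omega1_eq)
  also have "\<dots> \<le> \<omega> \<up> osuc b" by (intro opow_ge less_osuc)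
  finally show ?thesis .
qed

subsection \<open>Hessenberg sums\<close>

text \<open>The natural (Hessenberg) sum, as the least function strictly increasing in each
  argument. It governs the rank of a union, where a descent may alternate between the two parts in
  any order.\<close>

function hsum :: "omega1 \<Rightarrow> omega1 \<Rightarrow> omega1" where
  "hsum a b = Sup ((\<lambda>a'. osuc (hsum a' b)) ` {..<a} \<union> (\<lambda>b'. osuc (hsum a b')) ` {..<b})"
  by auto
termination
  by (relation "inv_image ({(x, y). x < y} <*lex*> {(x, y). x < y}) id") (auto intro: wf)
declare hsum.simps [simp del]

lemma hsum_less: "a' < a \<Longrightarrow> hsum a' b < hsum a b" "b' < b \<Longrightarrow> hsum a b' < hsum a b"
  by (subst (2) hsum.simps, subst osuc_le_iff[symmetric], rule omega1_Sup_upper;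
      auto intro: countable_lessThan_omega1)+

lemma hsum_mono: "a' \<le> a \<Longrightarrow> b' \<le> b \<Longrightarrow> hsum a' b' \<le> hsum a b"
  using hsum_less(1)[of a' a b'] hsum_less(2)[of b' b a]
  by (cases "a' = a"; cases "b' = b") (auto simp: order_le_less intro: order.strict_trans)

lemma hsum_le_iff:
  "hsum a b \<le> c \<longleftrightarrow> (\<forall>a'<a. hsum a' b < c) \<and> (\<forall>b'<b. hsum a b' < c)"
proof
  assume "hsum a b \<le> c"
  then show "(\<forall>a'<a. hsum a' b < c) \<and> (\<forall>b'<b. hsum a b' < c)"
    by (meson hsum_less order_less_le_trans)
next
  assume "(\<forall>a'<a. hsum a' b < c) \<and> (\<forall>b'<b. hsum a b' < c)"
  then show "hsum a b \<le> c"
    by (subst hsum.simps, intro omega1_Sup_least) (auto simp: osuc_le_iff)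
qed

definition hclosed :: "omega1 \<Rightarrow> bool" where
  "hclosed K \<longleftrightarrow> (\<forall>a<K. \<forall>b<K. hsum a b < K)"

lemma less_times_nat_omega1D:
  "x < K * osucs i 0 \<Longrightarrow> \<exists>i'<i. \<exists>c<K. x \<le> K * osucs i' 0 + c"
proof (induction i)
  case (Suc i)
  then have "x < K * osucs i 0 + K" by (simp add: times_omega1_osuc)
  then consider "x < K * osucs i 0" | c where "c < K" "x \<le> K * osucs i 0 + c"
    using less_plus_omega1D by blast
  then show ?case using Suc.IH by cases (meson less_Suc_eq)+
qed simp

lemma osucs_mono: "i \<le> j \<Longrightarrow> osucs i x \<le> osucs j x"
  by (rule lift_Suc_mono_le) (auto intro: less_imp_le less_osuc)

text \<open>Coefficients and remainders add separately. The induction is lexicographic in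
  \<open>i + j\<close>, \<open>a\<close>, \<open>b\<close>: a smaller argument has either a smaller
  remainder, or a smaller coefficient and an arbitrary new remainder.\<close>

lemma hsum_times_nat_le:
  assumes "hclosed K"
  shows "a < K \<Longrightarrow> b < K \<Longrightarrow>
    hsum (K * osucs i 0 + a) (K * osucs j 0 + b) \<le> K * osucs (i + j) 0 + hsum a b"
proof (induction "(i + j, a, b)" arbitrary: i j a b
    rule: wf_induct_rule[OF wf_lex_prod[OF wf_less_than wf_lex_prod[OF wf wf]]])
  case (1 i j a b)
  let ?k = "\<lambda>i. K * osucs i 0"
  \<comment> \<open>If the total coefficient drops, a whole summand \<open>K\<close> is gained,
    which by closedness exceeds the natural sum of any two new remainders.\<close>
  have small: "hsum x y < ?k (i + j)" if "i' + j' < i + j" "c < K" "d < K" "x \<le> ?k i' + c" "y \<le> ?k j' + d"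
    for i' j' c d x y
  proof -
    have "hsum x y \<le> hsum (?k i' + c) (?k j' + d)" using that by (intro hsum_mono)
    also have "\<dots> \<le> ?k (i' + j') + hsum c d"
      by (rule 1(1)) (use that in auto)
    also have "\<dots> < ?k (i' + j') + K"
      using assms that by (auto simp: hclosed_def intro: plus_omega1_strict_mono)
    also have "\<dots> = ?k (Suc (i' + j'))" by (simp add: times_omega1_osuc)
    also have "\<dots> \<le> ?k (i + j)" using that by (intro times_omega1_mono osucs_mono) simp
    finally show ?thesis .
  qed
  show ?case
  proof (subst hsum_le_iff, intro conjI allI impI)
    fix x assume "x < ?k i + a"
    then consider c where "c < a" "x \<le> ?k i + c" | i' c where "i' < i" "c < K" "x \<le> ?k i' + c"
      using less_plus_omega1D less_times_nat_omega1D by metis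
    then show "hsum x (?k j + b) < ?k (i + j) + hsum a b"
    proof cases
      case 1: 1
      have "hsum x (?k j + b) \<le> hsum (?k i + c) (?k j + b)" using 1 by (intro hsum_mono) auto
      also have "\<dots> \<le> ?k (i + j) + hsum c b"
        by (rule "1.hyps") (use 1 "1.prems" in auto)
      also have "\<dots> < ?k (i + j) + hsum a b"
        using 1 by (intro plus_omega1_strict_mono hsum_less)
      finally show ?thesis .
    next
      case 2
      then have "hsum x (?k j + b) < ?k (i + j)" using small "1.prems" by (metis add_less_mono1 order_refl)
      then show ?thesis using plus_omega1_ge order_less_le_trans by blast
    qed
  next
    fix x assume "x < ?k j + b"
    then consider c where "c < b" "x \<le> ?k j + c" | j' c where "j' < j" "c < K" "x \<le> ?k j' + c"
      using less_plus_omega1D less_times_nat_omega1D by metis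
    then show "hsum (?k i + a) x < ?k (i + j) + hsum a b"
    proof cases
      case 1: 1
      have "hsum (?k i + a) x \<le> hsum (?k i + a) (?k j + c)" using 1 by (intro hsum_mono) auto
      also have "\<dots> \<le> ?k (i + j) + hsum a c"
        by (rule "1.hyps") (use 1 "1.prems" in auto)
      also have "\<dots> < ?k (i + j) + hsum a b"
        using 1 by (intro plus_omega1_strict_mono hsum_less)
      finally show ?thesis .
    next
      case 2
      then have "hsum (?k i + a) x < ?k (i + j)" using small "1.prems"
        by (metis add_less_cancel_left order_refl)
      then show ?thesis using plus_omega1_ge order_less_le_trans by blast
    qed
  qed
qed

text \<open>For \<open>r > 0\<close>, two ordinals below \<open>\<omega> \<up> r\<close> lie below
  finite multiples of one \<open>\<omega> \<up> e\<close> with \<open>e < r\<close>. By induction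
  this power is closed, so their natural sum again lies below a finite multiple of it.\<close>

lemma hclosed_opow: "hclosed (\<omega> \<up> r)"
proof (induction r rule: less_induct)
  case (less r)
  have "hsum x y < \<omega> \<up> r" if xy: "x < \<omega> \<up> r" "y < \<omega> \<up> r" for x y
  proof (cases "r = 0")
    case True
    then have "x = 0" "y = 0" using xy by (auto simp: opow_zero omega1_less_one_iff)
    moreover have "hsum 0 0 \<le> 0" by (subst hsum_le_iff) auto
    ultimately show ?thesis using True
      by (metis opow_zero omega1_less_one_iff omega1_zero_le order_antisym)
  next
    case False
    then have r: "0 < r" by (simp add: omega1_pos_iff)
    have low: "\<exists>c<r. \<exists>n. x < (\<omega> \<up> c) * osucs n 0" if "x < \<omega> \<up> r" for x
    proof -
      have "\<exists>c<r. x < (\<omega> \<up> c) * \<omega>"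
        using less_opowD[OF that]
      proof (elim disjE)
        assume "x < 1"
        then have "x < (\<omega> \<up> 0) * \<omega>"
          by (metis one_le_omega one_le_opow order_less_le_trans order_trans times_omega1_ge_self)
        then show ?thesis using r by blast
      qed auto
      then obtain c z where c: "c < r" "z < \<omega>" "x < (\<omega> \<up> c) * z + (\<omega> \<up> c)"
        using less_times_omega1D by blast
      then obtain n where "z = osucs n 0" using less_omegaD by blast
      then have "x < (\<omega> \<up> c) * osucs (Suc n) 0" using c by (simp add: times_omega1_osuc)
      then show ?thesis using c(1) by blast
    qed
    obtain c n d m where cn: "c < r" "x < (\<omega> \<up> c) * osucs n 0" "d < r" "y < (\<omega> \<up> d) * osucs m 0"
      using low xy by metis
    define e where "e = max c d"
    have e: "e < r" "c \<le> e" "d \<le> e" using cn by (auto simp: e_def)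
    have up: "\<exists>n. x < (\<omega> \<up> e) * osucs n 0" if "x < (\<omega> \<up> c) * osucs n 0" "c \<le> e" for c n x
    proof (cases "c = e")
      case False
      then have "(\<omega> \<up> c) * \<omega> \<le> \<omega> \<up> e" using that by (intro opow_ge) auto
      then have "x < \<omega> \<up> e"
        using that(1) times_omega1_mono[OF less_imp_le[OF osucs_less_omega[of n]], of "\<omega> \<up> c"] by order
      then have "x < (\<omega> \<up> e) * osucs 1 0"
        using times_omega1_ge_self[of 1 "\<omega> \<up> e"] by (auto simp: one_omega1_eq)
      then show ?thesis by blast
    qed (use that in blast)
    obtain n m where nm: "x < (\<omega> \<up> e) * osucs n 0" "y < (\<omega> \<up> e) * osucs m 0"
      using up cn e by meson
    let ?K = "\<omega> \<up> e"
    obtain i a where a: "i < n" "a < ?K" "x \<le> ?K * osucs i 0 + a"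
      using less_times_nat_omega1D[OF nm(1)] by blast
    obtain j b where b: "j < m" "b < ?K" "y \<le> ?K * osucs j 0 + b"
      using less_times_nat_omega1D[OF nm(2)] by blast
    have K: "hclosed ?K" using less e by blast
    have "hsum x y \<le> ?K * osucs (i + j) 0 + hsum a b"
      using hsum_mono[OF a(3) b(3)] hsum_times_nat_le[OF K a(2) b(2), of i j] by order
    also have "\<dots> < ?K * osucs (i + j) 0 + ?K"
      using K a b by (auto simp: hclosed_def intro: plus_omega1_strict_mono)
    also have "\<dots> \<le> ?K * \<omega>" by (intro times_omega1_ge osucs_less_omega)
    also have "\<dots> \<le> \<omega> \<up> r" by (intro opow_ge e)
    finally show ?thesis .
  qed
  then show ?case by (auto simp: hclosed_def)
qed

subsection \<open>Ranks of families of disjoint sets\<close>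

text \<open>
  \<open>rank_ge b V\<close> says that the tree of finite disjoint families of members of \<open>V\<close> has rank at least \<open>b\<close>.
\<close>

definition perp :: "'a set set \<Rightarrow> 'a set \<Rightarrow> 'a set set" where
  "perp V E = {E' \<in> V. E' \<inter> E = {}}"

function rank_ge :: "omega1 \<Rightarrow> 'a set set \<Rightarrow> bool" where
  "rank_ge b V \<longleftrightarrow> (\<forall>c\<in>{..<b}. \<exists>E\<in>V. rank_ge c (perp V E))"
  by auto
termination by (relation "inv_image {(x, y). x < y} fst") (auto intro: wf)
declare rank_ge.simps [simp del]

lemma rank_geD: "rank_ge b V \<Longrightarrow> c < b \<Longrightarrow> \<exists>E\<in>V. rank_ge c (perp V E)"
  by (subst (asm) rank_ge.simps) auto

lemma rank_geI: "(\<And>c. c < b \<Longrightarrow> \<exists>E\<in>V. rank_ge c (perp V E)) \<Longrightarrow> rank_ge b V"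
  by (subst rank_ge.simps) auto

lemma rank_ge_mono: "rank_ge b V \<Longrightarrow> c \<le> b \<Longrightarrow> V \<subseteq> W \<Longrightarrow> rank_ge c W"
proof (induction c arbitrary: b V W rule: less_induct)
  case (less c)
  show ?case
  proof (rule rank_geI)
    fix d assume d: "d < c"
    then obtain E where E: "E \<in> V" "rank_ge d (perp V E)" using less.prems rank_geD by (meson order_less_le_trans)
    have "rank_ge d (perp W E)" by (rule less.IH[OF d E(2)]) (use less.prems in \<open>auto simp: perp_def\<close>)
    then show "\<exists>E\<in>W. rank_ge d (perp W E)" using E less.prems by blast
  qed
qed

text \<open>Suppose the alternatives fail at \<open>a' < a\<close> and \<open>b' < b\<close>. A
  first member supporting rank \<open>max (hsum a' b) (hsum a b')\<close> lies in one part; the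
  induction hypothesis then gives that part the forbidden rank or the other part its full
  rank.\<close>

lemma rank_ge_hsum:
  "rank_ge (hsum a b) (V \<union> W) \<Longrightarrow> rank_ge a V \<or> rank_ge b W"
proof (induction "(a, b)" arbitrary: a b V W
    rule: wf_induct_rule[OF wf_lex_prod[OF wf wf]])
  case (1 a b)
  show ?case
  proof (rule ccontr)
    assume neg: "\<not> (rank_ge a V \<or> rank_ge b W)"
    obtain a' where a': "a' < a" "\<And>E. E \<in> V \<Longrightarrow> \<not> rank_ge a' (perp V E)" using neg rank_geI by metis
    obtain b' where b': "b' < b" "\<And>E. E \<in> W \<Longrightarrow> \<not> rank_ge b' (perp W E)" using neg rank_geI by metis
    define c where "c = max (hsum a' b) (hsum a b')"
    have "c < hsum a b" unfolding c_def using a' b' hsum_less by auto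
    then obtain E where E: "E \<in> V \<union> W" "rank_ge c (perp (V \<union> W) E)" using "1.prems" rank_geD by blast
    have un: "perp (V \<union> W) E = perp V E \<union> perp W E" by (auto simp: perp_def)
    from E(1) show False
    proof
      assume "E \<in> V"
      have "rank_ge (hsum a' b) (perp V E \<union> perp W E)"
        by (rule rank_ge_mono[OF E(2)]) (auto simp: c_def un)
      then have "rank_ge a' (perp V E) \<or> rank_ge b (perp W E)" by (intro "1.hyps") (use a' in auto)
      moreover have "perp W E \<subseteq> W" by (auto simp: perp_def)
      ultimately show False using a'(2) \<open>E \<in> V\<close> neg rank_ge_mono by blast
    next
      assume "E \<in> W"
      have "rank_ge (hsum a b') (perp V E \<union> perp W E)"
        by (rule rank_ge_mono[OF E(2)]) (auto simp: c_def un)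
      then have "rank_ge a (perp V E) \<or> rank_ge b' (perp W E)" by (intro "1.hyps") (use b' in auto)
      moreover have "perp V E \<subseteq> V" by (auto simp: perp_def)
      ultimately show False using b'(2) \<open>E \<in> W\<close> neg rank_ge_mono by blast
    qed
  qed
qed

text \<open>If the parts have ranks at most \<open>a\<close> and \<open>b\<close>, both below
  \<open>\<omega> \<up> r\<close>, then for \<open>r > 0\<close> the natural sum of
  \<open>osuc a\<close> and \<open>osuc b\<close> is still at most \<open>\<omega> \<up> r\<close>.
  For \<open>r = 0\<close> the claim is that one part is nonempty.\<close>

lemma rank_ge_opow_Un:
  assumes "rank_ge (\<omega> \<up> r) (V \<union> W)"
  shows "rank_ge (\<omega> \<up> r) V \<or> rank_ge (\<omega> \<up> r) W"
proof (rule ccontr)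
  assume neg: "\<not> ?thesis"
  obtain a where a: "a < \<omega> \<up> r" "\<And>E. E \<in> V \<Longrightarrow> \<not> rank_ge a (perp V E)" using neg rank_geI by metis
  obtain b where b: "b < \<omega> \<up> r" "\<And>E. E \<in> W \<Longrightarrow> \<not> rank_ge b (perp W E)" using neg rank_geI by metis
  have na: "\<not> rank_ge (osuc a) V" "\<not> rank_ge (osuc b) W" using a b rank_geD less_osuc by metis+
  show False
  proof (cases "r = 0")
    case True
    then have "a = 0" "b = 0" using a b by (auto simp: opow_zero omega1_less_one_iff)
    have "rank_ge 0 X" for X :: "'a set set" by (rule rank_geI) auto
    then have "V = {}" "W = {}" using a(2) b(2) \<open>a = 0\<close> \<open>b = 0\<close> by auto
    moreover obtain E where "E \<in> V \<union> W" using rank_geD[OF assms a(1)] by blast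
    ultimately show False by simp
  next
    case False
    then have "(\<omega> \<up> 0) * \<omega> \<le> \<omega> \<up> r" by (intro opow_ge) (simp add: omega1_pos_iff)
    moreover have "osucs 2 0 \<le> (\<omega> \<up> 0) * osucs 2 0"
      by (simp add: opow_zero numeral_2_eq_2 times_omega1_osuc one_omega1_eq plus_omega1_osuc)
    moreover have "(\<omega> \<up> 0) * osucs 2 0 \<le> (\<omega> \<up> 0) * \<omega>"
      by (intro times_omega1_mono less_imp_le osucs_less_omega)
    ultimately have "osuc 0 < \<omega> \<up> r" by (simp add: numeral_2_eq_2 osuc_le_iff)
    then have "hsum a (osuc 0) < \<omega> \<up> r" "hsum b (osuc 0) < \<omega> \<up> r"
      using hclosed_opow[of r] a b by (auto simp: hclosed_def)
    moreover have "osuc x \<le> hsum x (osuc 0)" for x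
    proof -
      have "y \<le> hsum y 0" for y
        by (induction y rule: less_induct) (metis hsum_less(1) leI order_less_le_trans order_less_irrefl)
      then show ?thesis using hsum_less(2)[of 0 "osuc 0" x] less_osuc[of 0]
        by (meson order_le_less_trans osuc_le_iff)
    qed
    ultimately have "osuc a < \<omega> \<up> r" "osuc b < \<omega> \<up> r" by (meson order_le_less_trans)+
    then have "hsum (osuc a) (osuc b) \<le> \<omega> \<up> r"
      using hclosed_opow[of r] by (auto simp: hclosed_def intro: less_imp_le)
    then show False using rank_ge_hsum[of "osuc a" "osuc b" V W] na assms rank_ge_mono by blast
  qed
qed

text \<open>The finite colouring principle: pieces of too small a rank are discarded one at a
  time.\<close>

lemma rank_ge_opow_UN:
  assumes "finite Q" "rank_ge (\<omega> \<up> r) V" "V \<subseteq> W \<union> (\<Union>q\<in>Q. Z q)"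
    and "\<And>q. q \<in> Q \<Longrightarrow> \<not> rank_ge (\<omega> \<up> r) (Z q)"
  shows "rank_ge (\<omega> \<up> r) W"
  using assms
proof (induction Q arbitrary: W)
  case (insert q Q)
  have "rank_ge (\<omega> \<up> r) (W \<union> Z q)"
    by (rule insert.IH[OF insert.prems(1)]) (use insert.prems in blast)+
  then show ?case using rank_ge_opow_Un insert.prems(3) by blast
qed (auto intro: rank_ge_mono)

text \<open>The descent through \<open>b\<close> takes sets from \<open>W\<close>, all of which
  leave \<open>V\<close> untouched; the descent through \<open>a\<close> then takes place in
  \<open>V\<close>.\<close>

lemma rank_ge_plus:
  assumes "rank_ge a V" and "rank_ge b W" and "\<And>A B. A \<in> V \<Longrightarrow> B \<in> W \<Longrightarrow> A \<inter> B = {}"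
  shows "rank_ge (a + b) (V \<union> W)"
  using assms
proof (induction b arbitrary: W rule: less_induct)
  case (less b)
  show ?case
  proof (rule rank_geI)
    fix c assume "c < a + b"
    then consider "c < a" | d where "d < b" "c \<le> a + d" using less_plus_omega1D by blast
    then show "\<exists>E\<in>V \<union> W. rank_ge c (perp (V \<union> W) E)"
    proof cases
      case 1
      then obtain E where E: "E \<in> V" "rank_ge c (perp V E)" using less.prems(1) rank_geD by blast
      have "rank_ge c (perp (V \<union> W) E)" by (rule rank_ge_mono[OF E(2)]) (auto simp: perp_def)
      then show ?thesis using E(1) by blast
    next
      case 2
      then obtain E where E: "E \<in> W" "rank_ge d (perp W E)" using less.prems(2) rank_geD by blast
      have "rank_ge (a + d) (V \<union> perp W E)"
        by (rule less.IH) (use 2 E less.prems in \<open>auto simp: perp_def\<close>)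
      moreover have "V \<union> perp W E \<subseteq> perp (V \<union> W) E"
        using less.prems(3) E(1) by (auto simp: perp_def)
      ultimately have "rank_ge c (perp (V \<union> W) E)" using 2 rank_ge_mono by blast
      then show ?thesis using E(1) by blast
    qed
  qed
qed

section \<open>Schreier norms\<close>

text \<open>The combinatorics behind the covering estimates, free of ordinals. In
  \<open>S_spread\<close>, \<open>G\<close> arises from a subset of \<open>F\<close> by moving
  points to the right.\<close>

locale spread_norm =
  fixes S :: "nat set set" and nrm :: "nat set \<Rightarrow> nat"
  assumes nrm_eq_0_iff: "finite I \<Longrightarrow> nrm I = 0 \<longleftrightarrow> I = {}"
    and nrm_mono: "I \<subseteq> J \<Longrightarrow> finite J \<Longrightarrow> nrm I \<le> nrm J"
    and nrm_Un: "finite I \<Longrightarrow> finite J \<Longrightarrow> nrm (I \<union> J) \<le> nrm I + nrm J"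
    and nrm_singleton: "nrm {n} \<le> 1"
    and empty_S: "{} \<in> S"
    and S_subset: "F \<in> S \<Longrightarrow> G \<subseteq> F \<Longrightarrow> G \<in> S"
    and S_finite: "F \<in> S \<Longrightarrow> finite F"
    and S_spread: "F \<in> S \<Longrightarrow> finite G \<Longrightarrow> g ` G \<subseteq> F \<Longrightarrow> (\<And>x. x \<in> G \<Longrightarrow> g x \<le> x) \<Longrightarrow>
      strict_mono_on G g \<Longrightarrow> nrm G \<le> 1"
begin

lemma nrm_empty: "nrm {} = 0"
  using nrm_eq_0_iff[of "{}"] by simp

lemma nrm_insert: "finite I \<Longrightarrow> nrm (insert n I) \<le> Suc (nrm I)"
  using nrm_Un[of "{n}" I] nrm_singleton[of n] by simp

lemma nrm_split: "finite I \<Longrightarrow> I \<subseteq> A \<union> B \<Longrightarrow> nrm I \<le> nrm (I \<inter> A) + nrm (I \<inter> B)"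
  using nrm_Un[of "I \<inter> A" "I \<inter> B"] by (simp add: Int_Un_distrib[symmetric] Int_absorb2)

lemma nrm_UN:
  assumes "finite Q" "\<And>q. q \<in> Q \<Longrightarrow> finite (A q)"
  shows "nrm (\<Union>q\<in>Q. A q) \<le> (\<Sum>q\<in>Q. nrm (A q))"
  using assms
proof (induction Q)
  case (insert q Q)
  then have "nrm (A q \<union> (\<Union>q\<in>Q. A q)) \<le> nrm (A q) + nrm (\<Union>q\<in>Q. A q)" by (intro nrm_Un) auto
  then show ?case using insert by fastforce
qed (simp add: nrm_empty)

text \<open>Inserting a point raises the norm by at most one, so no value is skipped.\<close>

lemma subset_of_nrm:
  assumes "finite I" "M \<le> nrm I"
  shows "\<exists>J\<subseteq>I. nrm J = M"
  using assms
proof (induction I)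
  case (insert n I)
  show ?case
  proof (cases "M \<le> nrm I")
    case False
    then have "nrm (insert n I) = M" using insert nrm_insert[of I n] by simp
    then show ?thesis by blast
  qed (use insert in blast)
qed (auto simp: nrm_empty)

text \<open>
  If every two elements of \<open>J\<close> are separated by \<open>D\<close>, then the elements of \<open>J\<close> other than the least
  one form a spread of a subset of \<open>D\<close>.
\<close>

lemma nrm_le_2_if_interlaced:
  assumes "D \<in> S" "finite J"
    and sep: "\<And>x y. x \<in> J \<Longrightarrow> y \<in> J \<Longrightarrow> x < y \<Longrightarrow> {x..<y} \<inter> D \<noteq> {}"
  shows "nrm J \<le> 2"
proof (cases "J = {}")
  case False
  define G where "G = J - {Min J}"
  define g where "g y = Max (D \<inter> {..<y})" for y
  have finD: "finite D" using assms(1) by (rule S_finite)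
  have g: "g y \<in> D \<and> g y < y" if "y \<in> G" for y
  proof -
    have "Min J < y" using that Min_le[of J y] assms(2) by (auto simp: G_def le_less)
    then have "{Min J..<y} \<inter> D \<noteq> {}" using that False assms(2) by (intro sep) (auto simp: G_def)
    then have "g y \<in> D \<inter> {..<y}" unfolding g_def using finD by (intro Max_in) auto
    then show ?thesis by auto
  qed
  have "nrm G \<le> 1"
  proof (rule S_spread[OF assms(1)])
    show "strict_mono_on G g"
    proof (rule strict_mono_onI)
      fix x y assume xy: "x \<in> G" "y \<in> G" "x < y"
      then obtain d where d: "d \<in> D" "x \<le> d" "d < y" using sep[of x y] by (auto simp: G_def)
      then have "d \<le> g y" unfolding g_def using finD by (intro Max_ge) auto
      then show "g x < g y" using g[OF xy(1)] d by linarith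
    qed
  qed (use g assms(2) in \<open>auto simp: G_def intro: less_imp_le\<close>)
  then have "nrm (insert (Min J) G) \<le> 2" using nrm_insert[of G "Min J"] assms(2) by (simp add: G_def)
  moreover have "insert (Min J) G = J" using Min_in[OF assms(2) False] by (auto simp: G_def)
  ultimately show ?thesis by simp
qed (simp add: nrm_empty)

text \<open>Greedy choice of a free interval with the least possible right end \<open>y\<close>. The
  points of \<open>J\<close> below \<open>y\<close> are separated by \<open>D\<close>, so they have
  norm at most 2, and each interval costs only 2.\<close>

lemma free_intervals:
  assumes "D \<in> S" "finite J" "2 * t < nrm J"
  shows "\<exists>lo hi. (\<forall>i<t. lo i \<in> J \<and> hi i \<in> J \<and> lo i < hi i \<and> {lo i..<hi i} \<inter> D = {}) \<and>
    (\<forall>i<t. \<forall>i'<t. i < i' \<longrightarrow> hi i \<le> (lo i' :: nat))"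
  using assms(2,3)
proof (induction t arbitrary: J)
  case (Suc t)
  let ?P = "\<lambda>y. y \<in> J \<and> (\<exists>x\<in>J. x < y \<and> {x..<y} \<inter> D = {})"
  have ex: "\<exists>y. ?P y"
  proof (rule ccontr)
    assume "\<not> ?thesis"
    then have "nrm J \<le> 2" by (intro nrm_le_2_if_interlaced[OF assms(1) Suc.prems(1)]) blast
    then show False using Suc.prems(2) by simp
  qed
  define y where "y = (LEAST y. ?P y)"
  have y: "?P y" unfolding y_def by (rule LeastI_ex[OF ex])
  then obtain x where x: "x \<in> J" "x < y" "{x..<y} \<inter> D = {}" by blast
  have "nrm (J \<inter> {..<y}) \<le> 2"
  proof (rule nrm_le_2_if_interlaced[OF assms(1)])
    fix a b assume ab: "a \<in> J \<inter> {..<y}" "b \<in> J \<inter> {..<y}" "a < b"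
    show "{a..<b} \<inter> D \<noteq> {}"
    proof
      assume "{a..<b} \<inter> D = {}"
      then have "y \<le> b" unfolding y_def using ab by (intro Least_le) auto
      then show False using ab by simp
    qed
  qed (use Suc.prems in auto)
  moreover have "nrm J \<le> nrm (J \<inter> {..<y}) + nrm (J \<inter> {y..})"
    by (intro nrm_split) (use Suc.prems in auto)
  ultimately have "2 * t < nrm (J \<inter> {y..})" using Suc.prems by simp
  then obtain lo hi where lh: "\<forall>i<t. lo i \<in> J \<inter> {y..} \<and> hi i \<in> J \<inter> {y..} \<and> lo i < hi i \<and> {lo i..<hi i} \<inter> D = {}"
    "\<forall>i<t. \<forall>i'<t. i < i' \<longrightarrow> hi i \<le> lo i'"
    using Suc.IH[of "J \<inter> {y..}"] Suc.prems by blast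
  show ?case
    by (rule exI[of _ "case_nat x lo"], rule exI[of _ "case_nat y hi"])
       (use lh x y in \<open>auto split: nat.split simp: less_Suc_eq_0_disj\<close>)
qed simp

text \<open>Greedy choice from the left: cut at the first \<open>n\<close> up to which some
  \<open>I q\<close> has norm \<open>t\<close>. By then every other index set has lost norm at most
  \<open>t\<close>, which the factor \<open>card Q\<close> pays for.\<close>

lemma separated_subsets:
  fixes t :: nat
  assumes "finite Q" "\<And>q. q \<in> Q \<Longrightarrow> finite (I q)" "\<And>q. q \<in> Q \<Longrightarrow> card Q * t \<le> nrm (I q)" "0 < t"
  shows "\<exists>qs J. distinct qs \<and> set qs = Q \<and>
    (\<forall>j<length qs. J j \<subseteq> I (qs ! j) \<and> t \<le> nrm (J j)) \<and>
    (\<forall>j<length qs. \<forall>j'<length qs. j < j' \<longrightarrow> (\<forall>x\<in>J j. \<forall>y\<in>J j'. x < y))"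
  using assms(1-3)
proof (induction "card Q" arbitrary: Q I)
  case 0
  then show ?case by (intro exI[of _ "[]"]) auto
next
  case (Suc s)
  let ?P = "\<lambda>n. \<exists>q\<in>Q. t \<le> nrm (I q \<inter> {..n})"
  have ex: "\<exists>n. ?P n"
  proof -
    obtain q where q: "q \<in> Q" using Suc.hyps(2) by (metis card.empty ex_in_conv nat.distinct(1))
    then have "finite (I q)" using Suc.prems by blast
    then have "I q \<inter> {..Max (I q)} = I q" by auto
    moreover have "t \<le> nrm (I q)" using Suc.prems(3)[OF q] Suc.hyps(2)[symmetric] by simp
    ultimately show ?thesis using q by metis
  qed
  define n where "n = (LEAST n. ?P n)"
  have n: "?P n" unfolding n_def by (rule LeastI_ex[OF ex])
  then obtain q0 where q0: "q0 \<in> Q" "t \<le> nrm (I q0 \<inter> {..n})" by blast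
  \<comment> \<open>Just before \<open>n\<close> the norm is still below \<open>t\<close>, and one
    point adds at most one.\<close>
  have le: "nrm (I q \<inter> {..n}) \<le> t" if q: "q \<in> Q" for q
  proof (cases n)
    case 0
    have "nrm (I q \<inter> {..n}) \<le> nrm {0}" using 0 by (intro nrm_mono) auto
    then show ?thesis using nrm_singleton[of 0] assms(4) by linarith
  next
    case (Suc n')
    then have "\<not> ?P n'" using not_less_Least[of n' ?P] by (simp add: n_def)
    then have "nrm (I q \<inter> {..n'}) < t" using q by auto
    moreover have "nrm (I q \<inter> {..n}) \<le> nrm (insert n (I q \<inter> {..n'}))"
      by (intro nrm_mono) (auto simp: Suc le_Suc_eq)
    ultimately show ?thesis using nrm_insert[of "I q \<inter> {..n'}" n] by simp
  qed
  have card: "s = card (Q - {q0})" using Suc q0 by simp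
  have large: "card (Q - {q0}) * t \<le> nrm (I q \<inter> {n<..})" if "q \<in> Q - {q0}" for q
  proof -
    have "I q \<subseteq> {..n} \<union> {n<..}" by auto
    then have "nrm (I q) \<le> nrm (I q \<inter> {..n}) + nrm (I q \<inter> {n<..})"
      using Suc.prems that by (intro nrm_split) auto
    then show ?thesis using le[of q] that Suc.prems(3)[of q] card Suc.hyps(2)[symmetric] by simp
  qed
  have "\<exists>qs J. distinct qs \<and> set qs = Q - {q0} \<and>
    (\<forall>j<length qs. J j \<subseteq> I (qs ! j) \<inter> {n<..} \<and> t \<le> nrm (J j)) \<and>
    (\<forall>j<length qs. \<forall>j'<length qs. j < j' \<longrightarrow> (\<forall>x\<in>J j. \<forall>y\<in>J j'. x < y))"
    by (rule Suc.hyps(1)[OF card]) (use Suc.prems(1,2) large in auto)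
  then obtain qs J where qs: "distinct qs" "set qs = Q - {q0}"
    "\<And>j. j < length qs \<Longrightarrow> J j \<subseteq> I (qs ! j) \<inter> {n<..} \<and> t \<le> nrm (J j)"
    "\<And>j j'. j < length qs \<Longrightarrow> j' < length qs \<Longrightarrow> j < j' \<Longrightarrow> (\<forall>x\<in>J j. \<forall>y\<in>J j'. x < y)"
    by (elim exE conjE) metis
  show ?case
  proof (intro exI[of _ "q0 # qs"] exI[of _ "case_nat (I q0 \<inter> {..n}) J"] conjI allI impI)
    fix j j' assume jj: "j < length (q0 # qs)" "j' < length (q0 # qs)" "j < j'"
    then obtain i' where i': "j' = Suc i'" "i' < length qs" by (cases j') auto
    have J': "J i' \<subseteq> {n<..}" using qs(3)[OF i'(2)] by blast
    show "\<forall>x\<in>case_nat (I q0 \<inter> {..n}) J j. \<forall>y\<in>case_nat (I q0 \<inter> {..n}) J j'. x < y"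
    proof (cases j)
      case 0
      then show ?thesis using J' i'(1) by fastforce
    next
      case (Suc i)
      then show ?thesis using qs(4)[of i i'] i' jj by simp
    qed
  qed (use qs q0 in \<open>auto split: nat.split simp: nth_Cons\<close>)
qed

end

text \<open>Indexing the ordinals by the elements of \<open>F\<close> and comparing all pairs makes
  heredity and spreading immediate. Transitivity and the growth of \<open>lt n\<close> with
  \<open>n\<close> lead from neighbours to all pairs.\<close>

lemma schreier_iff:
  assumes "schreier_orderings lt"
  shows "F \<in> schreier lt \<alpha> \<longleftrightarrow> finite F \<and>
    (\<exists>b. (\<forall>n\<in>F. lt n (b n) \<alpha>) \<and> (\<forall>m\<in>F. \<forall>n\<in>F. m < n \<longrightarrow> lt n (b n) (b m)))"
    (is "_ \<longleftrightarrow> _ \<and> ?R")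
proof (cases "finite F")
  case fin: True
  have trans: "lt n x z" if "lt n x y" "lt n y z" for n x y z
    using assms that by (meson schreier_orderings_def tree_ordering_def transpE)
  have mono: "lt n x y" if "lt m x y" "m \<le> n" for n m x y
    using assms that unfolding schreier_orderings_def by (metis order_le_less)
  define xs where "xs = sorted_list_of_set F"
  have xs: "sorted xs" "distinct xs" "set xs = F" "length xs = card F"
    using fin by (auto simp: xs_def)
  have xs_less: "xs ! i < xs ! j \<longleftrightarrow> i < j" if "i < card F" "j < card F" for i j
    using sorted_wrt_nth_less[of "(<)" xs] xs that strict_sorted_iff
    by (metis linorder_neqE_nat not_less_iff_gr_or_eq)
  show ?thesis
  proof
    assume "F \<in> schreier lt \<alpha>"
    then obtain a where a: "a 0 = \<alpha>" "\<And>i. i < card F \<Longrightarrow> lt (xs ! i) (a (Suc i)) (a i)"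
      by (auto simp: schreier_def xs_def)
    have step: "lt (xs ! j) (a (Suc j)) (a i)" if "i \<le> j" "j < card F" for i j
      using that
    proof (induction j rule: dec_induct)
      case (step j)
      have "xs ! j \<le> xs ! Suc j" using xs_less[of j "Suc j"] step by simp
      then have "lt (xs ! Suc j) (a (Suc j)) (a i)" using step mono by simp
      then show ?case using trans a(2)[OF step(4)] by blast
    qed (use a in auto)
    define idx where "idx n = (THE i. i < card F \<and> xs ! i = n)" for n
    have idx: "idx (xs ! i) = i" if "i < card F" for i
      unfolding idx_def by (rule the_equality) (use that xs nth_eq_iff_index_eq[OF xs(2)] in auto)
    have "?R"
    proof (intro exI[of _ "\<lambda>n. a (Suc (idx n))"] conjI ballI impI)
      fix n assume "n \<in> F"
      then obtain j where j: "j < card F" "n = xs ! j" using xs by (metis in_set_conv_nth)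
      then show "lt n (a (Suc (idx n))) \<alpha>" using step[of 0 j] idx a by simp
    next
      fix m n assume "m \<in> F" "n \<in> F" "m < n"
      then obtain i j where ij: "i < card F" "m = xs ! i" "j < card F" "n = xs ! j"
        using xs by (metis in_set_conv_nth)
      then have "i < j" using xs_less \<open>m < n\<close> by simp
      then show "lt n (a (Suc (idx n))) (a (Suc (idx m)))" using step[of "Suc i" j] idx ij by simp
    qed
    then show "finite F \<and> ?R" using fin by blast
  next
    assume "finite F \<and> ?R"
    then obtain b where b: "\<And>n. n \<in> F \<Longrightarrow> lt n (b n) \<alpha>"
      "\<And>m n. m \<in> F \<Longrightarrow> n \<in> F \<Longrightarrow> m < n \<Longrightarrow> lt n (b n) (b m)" by blast
    \<comment> \<open>The sequence is shifted by one because its term 0 is \<alpha>.\<close>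
    have "lt (xs ! i) (case_nat \<alpha> (\<lambda>i. b (xs ! i)) (Suc i)) (case_nat \<alpha> (\<lambda>i. b (xs ! i)) i)"
      if "i < card F" for i
    proof (cases i)
      case (Suc i')
      have "xs ! i' \<in> F" "xs ! i \<in> F" using xs(3,4) that Suc by auto
      then show ?thesis using b(2) xs_less[of i' i] that Suc by simp
    qed (use b(1) xs(3,4) that in auto)
    then show "F \<in> schreier lt \<alpha>"
      using fin unfolding schreier_def xs_def
      by (intro CollectI conjI exI[of _ "case_nat \<alpha> (\<lambda>i. b (sorted_list_of_set F ! i))"]) auto
  qed
qed (simp add: schreier_def)

lemma schreier_norm_le:
  "X \<subseteq> schreier lt \<alpha> \<Longrightarrow> finite X \<Longrightarrow> A \<subseteq> \<Union>X \<Longrightarrow> schreier_norm lt \<alpha> A \<le> card X"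
  unfolding schreier_norm_def by (rule Least_le) blast

context
  fixes lt :: "nat \<Rightarrow> omega1 \<Rightarrow> omega1 \<Rightarrow> bool" and \<alpha> :: omega1
  assumes lt: "schreier_orderings lt" and \<alpha>: "0 < \<alpha>"
begin

lemma schreier_singleton: "{n} \<in> schreier lt \<alpha>"
proof -
  have "lt n 0 \<alpha>" using lt \<alpha> unfolding schreier_orderings_def by blast
  then show ?thesis unfolding schreier_iff[OF lt] by (auto intro!: exI[of _ "\<lambda>_. 0"])
qed

lemma schreier_norm_ex:
  assumes "finite A"
  obtains X where "X \<subseteq> schreier lt \<alpha>" "finite X" "card X = schreier_norm lt \<alpha> A" "A \<subseteq> \<Union>X"
proof -
  have "\<exists>X. X \<subseteq> schreier lt \<alpha> \<and> finite X \<and> card X = card ((\<lambda>n. {n}) ` A) \<and> A \<subseteq> \<Union>X"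
    using assms schreier_singleton by (intro exI[of _ "(\<lambda>n. {n}) ` A"]) auto
  then have "\<exists>n X. X \<subseteq> schreier lt \<alpha> \<and> finite X \<and> card X = n \<and> A \<subseteq> \<Union>X" by blast
  from LeastI_ex[OF this] show thesis using that unfolding schreier_norm_def by blast
qed

lemma spread_norm_schreier: "spread_norm (schreier lt \<alpha>) (schreier_norm lt \<alpha>)"
proof
  fix I J :: "nat set"
  show "schreier_norm lt \<alpha> I = 0 \<longleftrightarrow> I = {}" if fin: "finite I"
  proof
    assume 0: "schreier_norm lt \<alpha> I = 0"
    obtain X where "finite X" "card X = 0" "I \<subseteq> \<Union>X"
      by (rule schreier_norm_ex[OF fin]) (use 0 in auto)
    then show "I = {}" by auto
  qed (use schreier_norm_le[of "{}" lt \<alpha> I] in auto)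
  show "schreier_norm lt \<alpha> I \<le> schreier_norm lt \<alpha> J" if "I \<subseteq> J" "finite J"
    by (rule schreier_norm_ex[OF that(2)]) (metis that(1) order_trans schreier_norm_le)
  show "schreier_norm lt \<alpha> (I \<union> J) \<le> schreier_norm lt \<alpha> I + schreier_norm lt \<alpha> J"
    if fin: "finite I" "finite J"
  proof -
    obtain X where X: "X \<subseteq> schreier lt \<alpha>" "finite X" "card X = schreier_norm lt \<alpha> I" "I \<subseteq> \<Union>X"
      by (rule schreier_norm_ex[OF fin(1)])
    obtain Y where Y: "Y \<subseteq> schreier lt \<alpha>" "finite Y" "card Y = schreier_norm lt \<alpha> J" "J \<subseteq> \<Union>Y"
      by (rule schreier_norm_ex[OF fin(2)])
    have "schreier_norm lt \<alpha> (I \<union> J) \<le> card (X \<union> Y)"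
      by (rule schreier_norm_le) (use X Y in auto)
    then show ?thesis using card_Un_le[of X Y] X Y by simp
  qed
next
  fix n show "schreier_norm lt \<alpha> {n} \<le> 1"
    using schreier_norm_le[of "{{n}}" lt \<alpha> "{n}"] schreier_singleton by simp
next
  show "{} \<in> schreier lt \<alpha>" by (simp add: schreier_iff[OF lt])
next
  fix F G assume "F \<in> schreier lt \<alpha>" "G \<subseteq> F"
  then show "G \<in> schreier lt \<alpha>" unfolding schreier_iff[OF lt] by (meson finite_subset subsetD)
next
  fix F assume "F \<in> schreier lt \<alpha>" then show "finite F" by (simp add: schreier_def)
next
  fix F G :: "nat set" and g
  assume F: "F \<in> schreier lt \<alpha>" and G: "finite G" "g ` G \<subseteq> F" "\<And>x. x \<in> G \<Longrightarrow> g x \<le> x" "strict_mono_on G g"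
  obtain b where b: "\<And>n. n \<in> F \<Longrightarrow> lt n (b n) \<alpha>"
      "\<And>m n. m \<in> F \<Longrightarrow> n \<in> F \<Longrightarrow> m < n \<Longrightarrow> lt n (b n) (b m)"
    using F unfolding schreier_iff[OF lt] by blast
  have mono: "lt n x y" if "lt m x y" "m \<le> n" for n m x y
    using lt that unfolding schreier_orderings_def by (metis order_le_less)
  \<comment> \<open>The witness of \<open>F\<close> is read along \<open>g\<close>; since
    \<open>g n \<le> n\<close>, a relation at index \<open>g n\<close> persists at index
    \<open>n\<close>.\<close>
  have "G \<in> schreier lt \<alpha>" unfolding schreier_iff[OF lt]
  proof (intro conjI exI[of _ "\<lambda>n. b (g n)"] ballI impI)
    fix n assume n: "n \<in> G"
    show "lt n (b (g n)) \<alpha>" by (rule mono[OF b(1)]) (use n G in auto)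
  next
    fix m n assume mn: "m \<in> G" "n \<in> G" "m < n"
    show "lt n (b (g n)) (b (g m))"
      by (rule mono[OF b(2)]) (use mn G in \<open>auto intro: strict_mono_onD\<close>)
  qed (rule G(1))
  then show "schreier_norm lt \<alpha> G \<le> 1" using schreier_norm_le[of "{G}" lt \<alpha> G] by simp
qed

end

subsection \<open>Ordinal witnesses for sets of bounded norm\<close>

text \<open>
  A decreasing list \<open>xs\<close> is processed from its end, each element being assigned to one of \<open>L\<close>
  descending sequences; the members of \<open>wits lt \<alpha> L xs\<close> record the current ends of these sequences.
\<close>

fun wits :: "(nat \<Rightarrow> omega1 \<Rightarrow> omega1 \<Rightarrow> bool) \<Rightarrow> omega1 \<Rightarrow> nat \<Rightarrow> nat list \<Rightarrow> (nat \<Rightarrow> omega1) set" where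
  "wits lt \<alpha> L [] = {\<lambda>_. \<alpha>}"
| "wits lt \<alpha> L (n # xs) = (\<Union>v\<in>wits lt \<alpha> L xs. \<Union>l<L. (\<lambda>b. v(l := b)) ` {b. lt n b (v l)})"

text \<open>The ordinal with base-\<open>A\<close> digits \<open>v i\<close>, higher indices being
  more significant. Lowering a digit lowers it, so several descending sequences are measured by one
  ordinal.\<close>

primrec lexrank :: "omega1 \<Rightarrow> nat \<Rightarrow> (nat \<Rightarrow> omega1) \<Rightarrow> omega1" where
  "lexrank A 0 v = 0"
| "lexrank A (Suc i) v = (A \<up> osucs i 0) * v i + lexrank A i v"

lemma lexrank_less:
  assumes "\<And>i. v i < A"
  shows "lexrank A i v < A \<up> osucs i 0"
proof (induction i)
  case (Suc i)
  have "lexrank A (Suc i) v < (A \<up> osucs i 0) * v i + (A \<up> osucs i 0)"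
    using Suc by (auto intro: plus_omega1_strict_mono)
  also have "\<dots> \<le> (A \<up> osucs i 0) * A" by (intro times_omega1_ge assms)
  also have "\<dots> \<le> A \<up> osucs (Suc i) 0" by (intro opow_ge) (simp add: less_osuc)
  finally show ?case .
qed (simp add: opow_zero one_omega1_eq less_osuc)

lemma lexrank_decreasing:
  assumes "\<And>i. v i < A" "l < L" "b < v l"
  shows "lexrank A L (v(l := b)) < lexrank A L v"
  using assms(2)
proof (induction L)
  case (Suc i)
  show ?case
  proof (cases "l = i")
    case True
    have "lexrank A i (v(l := b)) < A \<up> osucs i 0"
      using assms by (intro lexrank_less) (auto intro: order.strict_trans)
    then have "lexrank A (Suc i) (v(l := b)) < (A \<up> osucs i 0) * b + (A \<up> osucs i 0)"
      using True by (auto intro: plus_omega1_strict_mono)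
    also have "\<dots> \<le> (A \<up> osucs i 0) * v i" using True assms by (intro times_omega1_ge) simp
    also have "\<dots> \<le> lexrank A (Suc i) v" by (simp add: plus_omega1_ge)
    finally show ?thesis .
  qed (use Suc in \<open>auto intro: plus_omega1_strict_mono\<close>)
qed simp

context
  fixes lt :: "nat \<Rightarrow> omega1 \<Rightarrow> omega1 \<Rightarrow> bool" and \<alpha> :: omega1
  assumes lt: "schreier_orderings lt"
begin

lemma lt_imp_less: "lt n x y \<Longrightarrow> x < y"
  using lt unfolding schreier_orderings_def by blast

text \<open>Finite height leaves finitely many \<open>b\<close> below a given ordinal in
  \<open>lt n\<close>. The upper bound can therefore take the largest \<open>lexrank\<close> over
  all witnesses.\<close>

lemma finite_wits: "finite (wits lt \<alpha> L xs)"
proof (induction xs)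
  case (Cons n xs)
  have "finite {b. lt n b x}" for x
    using lt unfolding schreier_orderings_def finite_height_def by blast
  then show ?case using Cons by auto
qed simp

lemma wits_le: "v \<in> wits lt \<alpha> L xs \<Longrightarrow> v i \<le> \<alpha>"
  by (induction xs arbitrary: v) (fastforce dest: lt_imp_less)+

lemma wits_decreasing:
  assumes "v \<in> wits lt \<alpha> L (n # xs)"
  shows "\<exists>w\<in>wits lt \<alpha> L xs. lexrank (osuc \<alpha>) L v < lexrank (osuc \<alpha>) L w"
proof -
  obtain w l b where w: "w \<in> wits lt \<alpha> L xs" "l < L" "lt n b (w l)" "v = w(l := b)"
    using assms by auto
  have "lexrank (osuc \<alpha>) L v < lexrank (osuc \<alpha>) L w" unfolding w(4)
    by (intro lexrank_decreasing w lt_imp_less[OF w(3)]) (simp add: less_osuc_iff wits_le[OF w(1)])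
  then show ?thesis using w(1) by blast
qed

text \<open>Each \<open>F l\<close> has its own descending witness \<open>b l\<close>, and an
  element \<open>n\<close> of \<open>F l\<close> extends sequence \<open>l\<close> by
  \<open>b l n\<close>. The previous end is \<alpha> or belongs to a smaller element of
  \<open>F l\<close>, because the decreasing list is processed from its end.\<close>

lemma wits_nonempty:
  assumes "sorted_wrt (>) xs" "set xs \<subseteq> (\<Union>l<L. F l)" "\<And>l. l < L \<Longrightarrow> F l \<in> schreier lt \<alpha>"
  shows "wits lt \<alpha> L xs \<noteq> {}"
proof -
  have "\<forall>l<L. \<exists>b. (\<forall>n\<in>F l. lt n (b n) \<alpha>) \<and> (\<forall>m\<in>F l. \<forall>n\<in>F l. m < n \<longrightarrow> lt n (b n) (b m))"
    using assms(3) unfolding schreier_iff[OF lt] by blast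
  then obtain b where b: "\<And>l n. l < L \<Longrightarrow> n \<in> F l \<Longrightarrow> lt n (b l n) \<alpha>"
    "\<And>l m n. l < L \<Longrightarrow> m \<in> F l \<Longrightarrow> n \<in> F l \<Longrightarrow> m < n \<Longrightarrow> lt n (b l n) (b l m)" by metis
  have "\<exists>v\<in>wits lt \<alpha> L xs. \<forall>l<L. v l = \<alpha> \<or> (\<exists>y\<in>F l \<inter> set xs. v l = b l y)"
    using assms(1,2)
  proof (induction xs)
    case (Cons n xs)
    then obtain v where v: "v \<in> wits lt \<alpha> L xs" "\<And>l. l < L \<Longrightarrow> v l = \<alpha> \<or> (\<exists>y\<in>F l \<inter> set xs. v l = b l y)"
      by auto
    obtain l where l: "l < L" "n \<in> F l" using Cons.prems by auto
    have "lt n (b l n) (v l)" using v(2)[OF l(1)] b l Cons.prems(1) by auto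
    then have "v(l := b l n) \<in> wits lt \<alpha> L (n # xs)" using v(1) l(1) by auto
    moreover have "\<forall>l'<L. (v(l := b l n)) l' = \<alpha> \<or> (\<exists>y\<in>F l' \<inter> set (n # xs). (v(l := b l n)) l' = b l' y)"
      using v(2) l by auto
    ultimately show ?case by blast
  qed simp
  then show ?thesis by blast
qed

end

lemma wits_nonempty_norm:
  assumes lt: "schreier_orderings lt" and "0 < \<alpha>"
    and "sorted_wrt (>) xs" "schreier_norm lt \<alpha> (set xs) \<le> L"
  shows "wits lt \<alpha> L xs \<noteq> {}"
proof -
  obtain X where X: "X \<subseteq> schreier lt \<alpha>" "finite X" "card X = schreier_norm lt \<alpha> (set xs)" "set xs \<subseteq> \<Union>X"
    by (rule schreier_norm_ex[OF assms(1,2), of "set xs"]) auto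
  obtain ys where ys: "set ys = X" "length ys = card X"
    using X(2) by (metis finite_distinct_list distinct_card)
  \<comment> \<open>The cover may have fewer than \<open>L\<close> members; empty sets fill the
    remaining places.\<close>
  show ?thesis
  proof (rule wits_nonempty[OF lt assms(3), of "\<lambda>l. if l < length ys then ys ! l else {}"])
    have "\<Union>X \<subseteq> (\<Union>l<L. if l < length ys then ys ! l else {})"
    proof
      fix n assume "n \<in> \<Union>X"
      then obtain l where "l < length ys" "n \<in> ys ! l" using ys by (metis UnionE in_set_conv_nth)
      then show "n \<in> (\<Union>l<L. if l < length ys then ys ! l else {})"
        using ys X(3) assms(4) by (intro UN_I[of l]) auto
    qed
    then show "set xs \<subseteq> (\<Union>l<L. if l < length ys then ys ! l else {})" using X by blast
    show "(if l < length ys then ys ! l else {}) \<in> schreier lt \<alpha>" for l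
    proof (cases "l < length ys")
      case True
      then have "ys ! l \<in> X" using ys(1) by auto
      then show ?thesis using True X(1) by auto
    qed (simp add: schreier_iff[OF lt])
  qed
qed

section \<open>Cylinders and thin sets\<close>

definition glue :: "nat \<Rightarrow> (nat \<Rightarrow> nat) \<Rightarrow> (nat \<Rightarrow> nat) \<Rightarrow> nat \<Rightarrow> nat" where
  "glue d y z = (\<lambda>i. if i < d then y i else z i)"

text \<open>Atoms are named by points \<open>y\<close>, so that extending an atom becomes gluing two
  points; many points name the same atom.\<close>

definition stem :: "(nat \<Rightarrow> nat) \<Rightarrow> nat \<Rightarrow> (nat \<rightharpoonup> nat)" where
  "stem y m = (\<lambda>i. if i < m then Some (y i) else None)"

text \<open>The preimage of \<open>X\<close> under the projection of \<open>T_space\<close> onto the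
  atom of level \<open>d\<close> through \<open>y\<close>.\<close>

definition pull :: "nat \<Rightarrow> (nat \<Rightarrow> nat) \<Rightarrow> (nat \<Rightarrow> nat) set \<Rightarrow> (nat \<Rightarrow> nat) set" where
  "pull d y X = {z \<in> T_space. glue d y z \<in> X}"

text \<open>For \<open>X \<subseteq> T_space\<close>, the least member of \<open>Balg_at n\<close>
  containing \<open>X\<close>.\<close>

definition saturate :: "nat \<Rightarrow> (nat \<Rightarrow> nat) set \<Rightarrow> (nat \<Rightarrow> nat) set" where
  "saturate n X = {z \<in> T_space. \<exists>x\<in>X. \<forall>i<n. x i = z i}"

lemma zero_in_T_space: "(\<lambda>_. 0) \<in> T_space"
  by (simp add: T_space_def)

lemma glue_in_T_space: "y \<in> T_space \<Longrightarrow> z \<in> T_space \<Longrightarrow> glue d y z \<in> T_space"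
  by (simp add: T_space_def glue_def)

lemma proj_stem: "proj (stem y m) z = glue m y z"
  by (auto simp: proj_def stem_def glue_def)

lemma cyl_stem: "cyl (stem y m) = {x \<in> T_space. \<forall>i<m. x i = y i}"
  by (auto simp: cyl_def stem_def map_le_def dom_def)

lemma stems_eq: "stems m = (\<lambda>y. stem y m) ` T_space"
proof (intro equalityI subsetI)
  have "dom (stem y m) = {..<m}" for y by (auto simp: stem_def split: if_splits)
  then show "u \<in> stems m" if "u \<in> (\<lambda>y. stem y m) ` T_space" for u
    using that by (auto simp: stems_def stem_def T_space_def)
next
  fix u assume u: "u \<in> stems m"
  then have "u = stem (\<lambda>i. if i < m then the (u i) else 0) m"
    by (auto simp: stems_def stem_def fun_eq_iff domIff set_eq_iff)
  moreover have "(\<lambda>i. if i < m then the (u i) else 0) \<in> T_space"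
    using u by (auto simp: stems_def T_space_def)
  ultimately show "u \<in> (\<lambda>y. stem y m) ` T_space" by blast
qed

lemma thin_at_iff:
  "thin_at \<phi> m n X \<longleftrightarrow> (\<forall>y\<in>T_space. \<exists>H\<in>Balg_at n.
     (\<forall>x\<in>H. x \<notin> X \<and> (\<forall>i<m. x i = y i)) \<and> 1 < \<phi> (pull m y H))"
proof -
  have "T_space \<inter> proj (stem y m) -` H = pull m y H" for y H
    by (auto simp: pull_def proj_stem)
  moreover have "H \<subseteq> cyl (stem y m) - X \<longleftrightarrow> (\<forall>x\<in>H. x \<notin> X \<and> (\<forall>i<m. x i = y i))"
    if "H \<in> Balg_at n" for H y
    using that by (auto simp: cyl_stem Balg_at_def)
  ultimately show ?thesis
    unfolding thin_at_def stems_eq ball_simps by (intro ball_cong bex_cong refl) simp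
qed

lemma Balg_at_mono: "m \<le> n \<Longrightarrow> Balg_at m \<subseteq> Balg_at n"
  by (fastforce simp: Balg_at_def)

lemma Balg_at_subset: "X \<in> Balg_at n \<Longrightarrow> X \<subseteq> T_space"
  by (simp add: Balg_at_def)

lemma Balg_atD: "X \<in> Balg_at n \<Longrightarrow> x \<in> X \<Longrightarrow> y \<in> T_space \<Longrightarrow> (\<And>i. i < n \<Longrightarrow> x i = y i) \<Longrightarrow> y \<in> X"
  by (auto simp: Balg_at_def)

lemma Balg_at_Int: "X \<in> Balg_at n \<Longrightarrow> Y \<in> Balg_at n \<Longrightarrow> X \<inter> Y \<in> Balg_at n"
  by (auto simp: Balg_at_def)

lemma Balg_at_Diff: "X \<in> Balg_at n \<Longrightarrow> Y \<in> Balg_at n \<Longrightarrow> X - Y \<in> Balg_at n"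
  by (auto simp: Balg_at_def)

lemma Balg_at_Union: "A \<subseteq> Balg_at n \<Longrightarrow> \<Union>A \<in> Balg_at n"
  by (force simp: Balg_at_def)

lemma Balg_at_Un: "X \<in> Balg_at n \<Longrightarrow> Y \<in> Balg_at n \<Longrightarrow> X \<union> Y \<in> Balg_at n"
  by (auto simp: Balg_at_def)

lemma T_space_in_Balg_at: "T_space \<in> Balg_at n"
  by (auto simp: Balg_at_def)

lemma saturate_in_Balg_at: "saturate n X \<in> Balg_at n"
proof -
  have "y \<in> saturate n X" if xy: "x \<in> saturate n X" "y \<in> T_space" "\<forall>i<n. x i = y i" for x y
  proof -
    obtain x' where x': "x' \<in> X" "\<forall>i<n. x' i = x i" using xy(1) unfolding saturate_def by blast
    then have "\<forall>i<n. x' i = y i" using xy(3) by simp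
    then show ?thesis using xy(2) x'(1) unfolding saturate_def by blast
  qed
  then show ?thesis by (auto simp: Balg_at_def) (simp add: saturate_def)
qed

lemma pull_in_Balg_at: "X \<in> Balg_at n \<Longrightarrow> y \<in> T_space \<Longrightarrow> pull d y X \<in> Balg_at n"
proof -
  assume X: "X \<in> Balg_at n" and y: "y \<in> T_space"
  have "z' \<in> pull d y X" if z: "z \<in> pull d y X" "z' \<in> T_space" "\<forall>i<n. z i = z' i" for z z'
  proof -
    have "glue d y z \<in> X" using z(1) by (simp add: pull_def)
    then have "glue d y z' \<in> X"
      by (rule Balg_atD[OF X]) (use z(2,3) y in \<open>auto intro: glue_in_T_space, simp add: glue_def\<close>)
    then show ?thesis using z(2) by (simp add: pull_def)
  qed
  then show ?thesis by (auto simp: Balg_at_def) (simp add: pull_def)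
qed

lemma cylinder_in_Balg_at: "{x \<in> T_space. \<forall>i<m. x i = y i} \<in> Balg_at m"
  by (auto simp: Balg_at_def)

lemma Balg_at_Balg: "X \<in> Balg_at n \<Longrightarrow> X \<in> Balg"
  by (auto simp: Balg_def)

text \<open>A member is determined by the restrictions of its points to the first \<open>n\<close>
  coordinates, of which there are finitely many.\<close>

lemma finite_Balg_at: "finite (Balg_at n)"
proof -
  let ?r = "\<lambda>X. (\<lambda>x. restrict x {..<n}) ` X"
  have "?r ` Balg_at n \<subseteq> Pow (PiE {..<n} (\<lambda>i. {..<2 ^ i}))"
    by (force simp: Balg_at_def T_space_def)
  then have "finite (?r ` Balg_at n)"
    by (rule finite_subset) (intro finite_Pow_iff[THEN iffD2] finite_PiE; simp)
  moreover have "inj_on ?r (Balg_at n)"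
  proof (rule inj_onI)
    have "X \<subseteq> Y" if "?r X = ?r Y" "X \<in> Balg_at n" "Y \<in> Balg_at n" for X Y
    proof
      fix x assume x: "x \<in> X"
      then have "restrict x {..<n} \<in> ?r Y" using that(1) by blast
      then obtain y where y: "y \<in> Y" "restrict x {..<n} = restrict y {..<n}" by auto
      show "x \<in> Y"
      proof (rule Balg_atD[OF that(3) y(1)])
        show "x \<in> T_space" using x Balg_at_subset that(2) by blast
        show "y i = x i" if "i < n" for i using fun_cong[OF y(2), of i] that by simp
      qed
    qed
    then show "X = Y" if "X \<in> Balg_at n" "Y \<in> Balg_at n" "?r X = ?r Y" for X Y
      using that by (intro subset_antisym) simp_all
  qed
  ultimately show ?thesis by (rule finite_imageD)
qed

section \<open>Weighted covers\<close>

lemma phi_alt: "phi E X = (INF F \<in> {F. finite F \<and> F \<subseteq> E \<and> X \<subseteq> (\<Union>t\<in>F. fst t)}. \<Sum>t\<in>F. ennreal (snd (snd t)))"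
  unfolding phi_def
  by (intro INF_cong) (auto simp: case_prod_beta)

text \<open>The cover is indexed because transferring different triples may produce equal ones;
  merging repetitions only lowers the sum.\<close>

lemma phi_le_sum:
  assumes "finite G" "\<And>g. g \<in> G \<Longrightarrow> (Y g, I g, w g) \<in> E" "\<And>g. g \<in> G \<Longrightarrow> 0 \<le> w g"
    and "X \<subseteq> (\<Union>g\<in>G. Y g)"
  shows "phi E X \<le> ennreal (\<Sum>g\<in>G. w g)"
proof -
  let ?f = "\<lambda>g. (Y g, I g, w g)"
  have "phi E X \<le> (\<Sum>t\<in>?f ` G. ennreal (snd (snd t)))"
    unfolding phi_alt by (rule INF_lower) (use assms in auto)
  also have "\<dots> \<le> (\<Sum>g\<in>G. ennreal (snd (snd (?f g))))"
    using sum_image_le[OF assms(1), of "\<lambda>t. ennreal (snd (snd t))" ?f] by (simp add: o_def)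
  also have "\<dots> = ennreal (\<Sum>g\<in>G. w g)" using assms(3) by simp
  finally show ?thesis .
qed

lemma phi_lessD:
  assumes "phi E X < ennreal r" "\<And>Y I w. (Y, I, w) \<in> E \<Longrightarrow> 0 \<le> w"
  obtains F where "finite F" "F \<subseteq> E" "X \<subseteq> (\<Union>t\<in>F. fst t)" "(\<Sum>t\<in>F. snd (snd t)) < r"
proof -
  obtain F where F: "finite F" "F \<subseteq> E" "X \<subseteq> (\<Union>t\<in>F. fst t)"
    "(\<Sum>t\<in>F. ennreal (snd (snd t))) < ennreal r"
    using assms(1) unfolding phi_alt INF_less_iff by blast
  have nonneg: "0 \<le> snd (snd t)" if "t \<in> F" for t
    using assms(2)[of "fst t" "fst (snd t)" "snd (snd t)"] F(2) that by auto
  then have "(\<Sum>t\<in>F. ennreal (snd (snd t))) = ennreal (\<Sum>t\<in>F. snd (snd t))"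
    by (rule sum_ennreal)
  then have "(\<Sum>t\<in>F. snd (snd t)) < r"
    using F(4) ennreal_less_iff[OF sum_nonneg, of F "\<lambda>t. snd (snd t)"] nonneg by simp
  then show thesis using F that by blast
qed

lemma phi_mono: "X \<subseteq> Y \<Longrightarrow> phi E X \<le> phi E Y"
  unfolding phi_alt by (rule INF_superset_mono) auto

lemma phi_antimono: "E \<subseteq> E' \<Longrightarrow> phi E' X \<le> phi E X"
  unfolding phi_alt by (rule INF_superset_mono) auto

lemma phi_empty: "phi E {} = 0"
  using phi_le_sum[of "{}" undefined undefined undefined E "{}"] by simp

lemma phi_Un: "phi E (X \<union> Y) \<le> phi E X + phi E Y"
proof (rule ennreal_le_epsilon)
  fix e :: real assume fin: "phi E X + phi E Y < top" and e: "0 < e"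
  have ex: "\<exists>F. finite F \<and> F \<subseteq> E \<and> Z \<subseteq> (\<Union>t\<in>F. fst t) \<and>
      (\<Sum>t\<in>F. ennreal (snd (snd t))) < phi E Z + ennreal (e / 2)" if "phi E Z < top" for Z
  proof -
    have "phi E Z < phi E Z + ennreal (e / 2)" using that e
      by (metis ennreal_add_left_cancel_less add.right_neutral ennreal_less_zero_iff half_gt_zero
          infinity_ennreal_def less_irrefl)
    then show ?thesis unfolding phi_alt[of E Z] INF_less_iff by blast
  qed
  have "phi E X < top" "phi E Y < top" using fin by (auto simp: ennreal_add_less_top)
  then obtain F G where FG: "finite F" "F \<subseteq> E" "X \<subseteq> (\<Union>t\<in>F. fst t)"
      "(\<Sum>t\<in>F. ennreal (snd (snd t))) < phi E X + ennreal (e / 2)"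
      "finite G" "G \<subseteq> E" "Y \<subseteq> (\<Union>t\<in>G. fst t)"
      "(\<Sum>t\<in>G. ennreal (snd (snd t))) < phi E Y + ennreal (e / 2)"
    using ex by metis
  have "phi E (X \<union> Y) \<le> (\<Sum>t\<in>F \<union> G. ennreal (snd (snd t)))"
    unfolding phi_alt by (rule INF_lower) (use FG in auto)
  also have "\<dots> \<le> (\<Sum>t\<in>F. ennreal (snd (snd t))) + (\<Sum>t\<in>G. ennreal (snd (snd t)))"
    using sum.union_inter[OF FG(1,5), of "\<lambda>t. ennreal (snd (snd t))", symmetric] by simp
  also have "\<dots> \<le> (phi E X + ennreal (e / 2)) + (phi E Y + ennreal (e / 2))"
    using FG by (intro add_mono less_imp_le)
  also have "\<dots> = phi E X + phi E Y + ennreal e"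
  proof -
    have "ennreal e = ennreal (e / 2) + ennreal (e / 2)" using e by (subst ennreal_plus[symmetric]) auto
    then show ?thesis by (simp add: ac_simps)
  qed
  finally show "phi E (X \<union> Y) \<le> phi E X + phi E Y + ennreal e" .
qed

section \<open>The main estimate\<close>

lemma a_coeff_pos: "0 < a_coeff k"
  by (simp add: a_coeff_def)

lemma a_coeff_antimono: "k \<le> j \<Longrightarrow> a_coeff j \<le> a_coeff k"
  unfolding a_coeff_def by (intro divide_left_mono) (auto simp: power_mono)

lemma E_layer_nonneg: "(X, I, w) \<in> E_layer nrm k \<nu> \<Longrightarrow> 0 \<le> w"
  by (simp add: E_layer_def)

lemma C_class_iff:
  "t \<in> C_class nrm k p \<longleftrightarrow> (\<exists>j\<ge>k. j < p \<and> t \<in> E_layer nrm j (phi (C_class nrm (Suc j) p)))"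
proof (induction "p - k" arbitrary: k)
  case 0
  then have "\<not> k < p" by simp
  then have "C_class nrm k p = {}" by (subst C_class.simps) simp
  then show ?case using \<open>\<not> k < p\<close> by auto
next
  case (Suc d)
  then have "k < p" by simp
  then have "t \<in> C_class nrm k p \<longleftrightarrow> t \<in> C_class nrm (Suc k) p \<or> t \<in> E_layer nrm k (phi (C_class nrm (Suc k) p))"
    by (subst C_class.simps) simp
  also have "t \<in> C_class nrm (Suc k) p \<longleftrightarrow>
      (\<exists>j\<ge>Suc k. j < p \<and> t \<in> E_layer nrm j (phi (C_class nrm (Suc j) p)))"
    using Suc.hyps(2) by (intro Suc.hyps(1)) simp
  also have "(\<dots> \<or> t \<in> E_layer nrm k (phi (C_class nrm (Suc k) p))) \<longleftrightarrow>
      (\<exists>j\<ge>k. j < p \<and> t \<in> E_layer nrm j (phi (C_class nrm (Suc j) p)))"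
    using \<open>k < p\<close> by (metis Suc_leD le_eq_less_or_eq less_eq_Suc_le)
  finally show ?case .
qed

lemma C_class_antimono: "k \<le> j \<Longrightarrow> C_class nrm j p \<subseteq> C_class nrm k p"
  by (auto simp: C_class_iff) (meson order_trans)

lemma C_class_nonneg: "(X, I, w) \<in> C_class nrm k p \<Longrightarrow> 0 \<le> w"
  by (auto simp: C_class_iff dest: E_layer_nonneg)

text \<open>
  The factor by which \<open>c_low\<close> grows from \<open>k\<close> to \<open>k + 1\<close> absorbs the loss incurred when the index sets are
  cut down to a proportion \<open>1 / 2 ^ (k + 6)\<close> of their norm.
\<close>

definition c_low :: "nat \<Rightarrow> real" where
  "c_low k = 16 * 2 powr (- 1 / (real k + 1))"

lemma c_low_less: "c_low k < 16"
proof -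
  have "(2::real) powr (- 1 / (real k + 1)) < 2 powr 0"
    by (subst powr_less_cancel_iff) auto
  then show ?thesis by (simp add: c_low_def)
qed

lemma c_low_ge: "8 \<le> c_low k"
proof -
  have "(2::real) powr - 1 \<le> 2 powr (- 1 / (real k + 1))"
    by (intro powr_mono) (auto simp: field_simps)
  then show ?thesis by (simp add: c_low_def powr_minus)
qed

text \<open>The increments \<open>1 / (k + 6) ^ 2\<close> of the exponent are dominated by
  telescoping differences of \<open>1 / (k + 1)\<close>, so the constants can grow forever and stay
  below 16.\<close>

lemma c_low_Suc: "c_low k * 2 powr (1 / (real k + 6) ^ 2) \<le> c_low (Suc k)"
proof -
  have "(real k + 1) * (real k + 2) \<le> (real k + 6) ^ 2"
    unfolding power2_eq_square by (intro mult_mono) auto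
  then have "1 / (real k + 6) ^ 2 \<le> 1 / ((real k + 1) * (real k + 2))"
    by (intro divide_left_mono) auto
  also have "\<dots> = 1 / (real k + 1) - 1 / (real k + 2)" by (simp add: field_simps)
  finally have "- 1 / (real k + 1) + 1 / (real k + 6) ^ 2 \<le> - 1 / (real (Suc k) + 1)"
    by (simp add: add.commute)
  then have "(2::real) powr (- 1 / (real k + 1) + 1 / (real k + 6) ^ 2) \<le> 2 powr (- 1 / (real (Suc k) + 1))"
    by (intro powr_mono) auto
  then show ?thesis by (simp add: c_low_def powr_add[symmetric])
qed

text \<open>Since \<open>a_coeff (Suc k)\<close> is \<open>1 / (k + 6) ^ 3\<close>, the exponent
  \<open>k + 6\<close> becomes the summable \<open>1 / (k + 6) ^ 2\<close>.\<close>

lemma powr_a_coeff: "real (2 ^ (k + 6)) powr a_coeff (Suc k) = 2 powr (1 / (real k + 6) ^ 2)"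
proof -
  have "real (2 ^ (k + 6)) powr a_coeff (Suc k) = (2 powr real (k + 6)) powr a_coeff (Suc k)"
    by (subst powr_realpow) simp_all
  also have "\<dots> = 2 powr (real (k + 6) * a_coeff (Suc k))" by (rule powr_powr)
  also have "real (k + 6) * a_coeff (Suc k) = 1 / (real k + 6) ^ 2"
    by (simp add: a_coeff_def power3_eq_cube power2_eq_square add.commute)
  finally show ?thesis .
qed

context spread_norm
begin

lemma nrm_pos: "finite I \<Longrightarrow> I \<noteq> {} \<Longrightarrow> 0 < nrm I"
  using nrm_eq_0_iff[of I] by simp

lemma E_layer_ge:
  assumes "(X, I, w) \<in> E_layer nrm k \<nu>"
  shows "1 / 2 ^ k \<le> w"
proof -
  have I: "finite I" "I \<noteq> {}" "nrm I \<le> M_coeff k"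
      "(1 / 2 ^ k) * (real (M_coeff k) / real (nrm I)) powr a_coeff k \<le> w"
    using assms unfolding E_layer_def by blast+
  have "1 \<le> real (M_coeff k) / real (nrm I)"
    by (subst le_divide_eq_1_pos) (use I nrm_pos[of I] in simp_all)
  then have "1 \<le> (real (M_coeff k) / real (nrm I)) powr a_coeff k"
    by (intro ge_one_powr_ge_zero less_imp_le[OF a_coeff_pos])
  then have "(1 / 2 ^ k) * 1 \<le> (1 / 2 ^ k) * (real (M_coeff k) / real (nrm I)) powr a_coeff k"
    by (intro mult_left_mono) auto
  then show ?thesis using I(4) by (metis mult.right_neutral order_trans)
qed

text \<open>With norm at most \<open>2 ^ (2 * k + 12)\<close>, the ratio of \<open>M_coeff k\<close>
  to it would be at least \<open>2 ^ ((k + 4) * (k + 5) ^ 3)\<close>. Raised to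
  \<open>a_coeff k\<close> this is \<open>2 ^ (k + 4)\<close>, and the weight would reach
  16.\<close>

lemma E_layer_nrm:
  assumes "(X, I, w) \<in> E_layer nrm k \<nu>" "w < 16"
  shows "2 ^ (2 * k + 12) < nrm I"
proof (rule ccontr)
  assume "\<not> ?thesis"
  then have "nrm I \<le> 2 ^ (2 * k + 12)" by simp
  then have le: "real (nrm I) \<le> real (2 ^ (2 * k + 12))" by (simp only: of_nat_le_iff)
  have I: "finite I" "I \<noteq> {}" "(1 / 2 ^ k) * (real (M_coeff k) / real (nrm I)) powr a_coeff k \<le> w"
    using assms(1) unfolding E_layer_def by blast+
  then have pos: "0 < nrm I" using nrm_pos by blast
  have "2 ^ ((k + 4) * (k + 5) ^ 3) = real (M_coeff k) / real (2 ^ (2 * k + 12))"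
    unfolding M_coeff_def of_nat_mult
    by (subst nonzero_mult_div_cancel_left) (simp_all only: of_nat_power of_nat_numeral power_not_zero zero_neq_numeral not_False_eq_True)
  also have "\<dots> \<le> real (M_coeff k) / real (nrm I)" using le pos by (intro divide_left_mono) auto
  finally have "(2 ^ ((k + 4) * (k + 5) ^ 3)) powr a_coeff k \<le> (real (M_coeff k) / real (nrm I)) powr a_coeff k"
    by (intro powr_mono2 less_imp_le[OF a_coeff_pos]) auto
  moreover have "(2 ^ ((k + 4) * (k + 5) ^ 3)) powr a_coeff k = (2 ^ (k + 4) :: real)"
  proof -
    have "(2 ^ ((k + 4) * (k + 5) ^ 3)) powr a_coeff k = (2 powr real ((k + 4) * (k + 5) ^ 3)) powr a_coeff k"
      by (simp only: powr_realpow zero_less_numeral)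
    also have "\<dots> = 2 powr (real ((k + 4) * (k + 5) ^ 3) * a_coeff k)" by (rule powr_powr)
    also have "real ((k + 4) * (k + 5) ^ 3) * a_coeff k = real (k + 4)"
    proof -
      have "real ((k + 5) ^ 3) \<noteq> 0" by simp
      then show ?thesis unfolding a_coeff_def of_nat_mult times_divide_eq_right mult_1_right
        by (rule nonzero_mult_div_cancel_right)
    qed
    finally show ?thesis by (simp only: powr_realpow zero_less_numeral)
  qed
  ultimately have "(1 / 2 ^ k) * 2 ^ (k + 4) \<le> (1 / 2 ^ k) * (real (M_coeff k) / real (nrm I)) powr a_coeff k"
    by (intro mult_left_mono) auto
  also note I(3)
  finally show False using assms(2) by (simp add: power_add)
qed

text \<open>
  Restricting \<open>I\<close> to an interval \<open>[d, d']\<close> in which it keeps a definite proportion of its norm costs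
  only a factor in the weight; in exchange the set becomes measurable with respect to the
  coordinates below \<open>d'\<close> and independent of those below \<open>d\<close>.
\<close>

lemma C_class_transfer:
  assumes t: "(X, I, w) \<in> C_class nrm k p" and y: "y \<in> T_space" and "1 \<le> c"
    and J: "J \<subseteq> I" "J \<subseteq> {d..d'}" "nrm I \<le> c * nrm J"
  shows "(pull d y (saturate d' X), J, w * real c powr a_coeff k) \<in> C_class nrm k p"
proof -
  obtain j where j: "k \<le> j" "j < p" "(X, I, w) \<in> E_layer nrm j (phi (C_class nrm (Suc j) p))"
    using t by (auto simp: C_class_iff)
  let ?\<phi> = "phi (C_class nrm (Suc j) p)"
  have I: "X \<in> Balg" "finite I" "I \<noteq> {}" "nrm I \<le> M_coeff j" "0 \<le> w" "thin ?\<phi> I X"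
      "(1 / 2 ^ j) * (real (M_coeff j) / real (nrm I)) powr a_coeff j \<le> w"
    using j(3) by (auto simp: E_layer_def)
  have XT: "X \<subseteq> T_space" using I(1) by (auto simp: Balg_def Balg_at_def)
  have pos: "0 < nrm J" "0 < nrm I" using I J(3) nrm_pos[of I] by (auto intro: gr0I)
  have finJ: "finite J" "J \<noteq> {}" using I J pos nrm_empty finite_subset by fastforce+
  have "thin ?\<phi> J (pull d y (saturate d' X))"
    unfolding thin_def thin_at_iff
  proof (intro ballI impI)
    fix m n u assume mn: "m \<in> J" "n \<in> J" "m < n" and u: "u \<in> T_space"
    have dm: "d \<le> m" "n \<le> d'" using mn J(2) by auto
    \<comment> \<open>A hole for \<open>X\<close> over the atom of \<open>glue d y u\<close>, pulled
      back and confined to the atom of \<open>u\<close>, is a hole for the new set.\<close>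
    have "thin_at ?\<phi> m n X" using I(6) mn J(1) by (auto simp: thin_def)
    from this[unfolded thin_at_iff, THEN bspec, OF glue_in_T_space[OF y u]]
    obtain H where H: "H \<in> Balg_at n" "\<And>x. x \<in> H \<Longrightarrow> x \<notin> X \<and> (\<forall>i<m. x i = glue d y u i)"
        "1 < ?\<phi> (pull m (glue d y u) H)" by blast
    let ?H = "{x \<in> pull d y H. \<forall>i<m. x i = u i}"
    have eq: "?H = pull d y H \<inter> {x \<in> T_space. \<forall>i<m. x i = u i}" by (auto simp: pull_def)
    have "{x \<in> T_space. \<forall>i<m. x i = u i} \<in> Balg_at n"
      using cylinder_in_Balg_at[of m u] Balg_at_mono[of m n] mn by auto
    then have B: "?H \<in> Balg_at n" unfolding eq by (intro Balg_at_Int pull_in_Balg_at H(1) y)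
    \<comment> \<open>Enlarging \<open>X\<close> to \<open>saturate d' X\<close> is harmless because
      \<open>H\<close> depends only on coordinates below \<open>n \<le> d'\<close>.\<close>
    have disj: "x \<notin> pull d y (saturate d' X)" if x: "x \<in> ?H" for x
    proof
      assume "x \<in> pull d y (saturate d' X)"
      then obtain x' where x': "x' \<in> X" "\<forall>i<d'. x' i = glue d y x i" by (auto simp: pull_def saturate_def)
      have "glue d y x \<in> H" using x by (auto simp: pull_def)
      then have "x' \<in> H" by (rule Balg_atD[OF H(1)]) (use x' XT dm in auto)
      then show False using H(2) x'(1) by blast
    qed
    have "pull m u ?H = pull m (glue d y u) H"
    proof -
      have "glue d y (glue m u z) = glue m (glue d y u) z" for z using dm by (auto simp: glue_def)
      moreover have "glue m u z \<in> T_space" if "z \<in> T_space" for z using glue_in_T_space u that by blast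
      ultimately show ?thesis by (auto simp: pull_def) (simp add: glue_def)
    qed
    then show "\<exists>H\<in>Balg_at n. (\<forall>x\<in>H. x \<notin> pull d y (saturate d' X) \<and> (\<forall>i<m. x i = u i)) \<and> 1 < ?\<phi> (pull m u H)"
      using B disj H(3) by (intro bexI[of _ ?H]) auto
  qed
  moreover have "pull d y (saturate d' X) \<in> Balg"
    by (rule Balg_at_Balg[OF pull_in_Balg_at[OF saturate_in_Balg_at y]])
  moreover have "nrm J \<le> M_coeff j" using nrm_mono[OF J(1) I(2)] I(4) by simp
  moreover have "(1 / 2 ^ j) * (real (M_coeff j) / real (nrm J)) powr a_coeff j \<le> w * real c powr a_coeff k"
  proof -
    have "real (nrm I) \<le> real c * real (nrm J)" using J(3) of_nat_le_iff[of "nrm I" "c * nrm J"] by simp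
    then have "real (M_coeff j) / real (nrm J) \<le> real (M_coeff j) / real (nrm I) * real c"
    proof -
      have "real (M_coeff j) / real (nrm J) = real (M_coeff j) * real c / (real c * real (nrm J))"
        using \<open>1 \<le> c\<close> by simp
      also have "\<dots> \<le> real (M_coeff j) * real c / real (nrm I)"
        using \<open>real (nrm I) \<le> real c * real (nrm J)\<close> pos \<open>1 \<le> c\<close> by (intro divide_left_mono) auto
      finally show ?thesis by simp
    qed
    then have "(real (M_coeff j) / real (nrm J)) powr a_coeff j \<le> (real (M_coeff j) / real (nrm I) * real c) powr a_coeff j"
      by (intro powr_mono2 less_imp_le[OF a_coeff_pos]) auto
    also have "\<dots> = (real (M_coeff j) / real (nrm I)) powr a_coeff j * real c powr a_coeff j"
      by (rule powr_mult)
    finally have "(1 / 2 ^ j) * (real (M_coeff j) / real (nrm J)) powr a_coeff j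
        \<le> (1 / 2 ^ j) * ((real (M_coeff j) / real (nrm I)) powr a_coeff j * real c powr a_coeff j)"
      by (intro mult_left_mono) auto
    also have "\<dots> = ((1 / 2 ^ j) * (real (M_coeff j) / real (nrm I)) powr a_coeff j) * real c powr a_coeff j"
      by (simp only: mult.assoc)
    also have "\<dots> \<le> w * real c powr a_coeff k"
      using I(5,7) \<open>1 \<le> c\<close> by (intro mult_mono powr_mono a_coeff_antimono j) auto
    finally show ?thesis .
  qed
  ultimately have "(pull d y (saturate d' X), J, w * real c powr a_coeff k) \<in> E_layer nrm j ?\<phi>"
    using finJ I(5) unfolding E_layer_def mem_Collect_eq prod.case
    by (intro conjI mult_nonneg_nonneg powr_ge_zero)
  then show ?thesis using j by (auto simp: C_class_iff)
qed

lemma phi_transfer: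
  assumes "finite G" and t: "\<And>g. g \<in> G \<Longrightarrow> (Y g, I g, w g) \<in> C_class nrm k p"
    and "y \<in> T_space" "1 \<le> c" "\<And>g. g \<in> G \<Longrightarrow> nrm (I g) \<le> c * nrm (I g \<inter> {d..d'})"
  shows "phi (C_class nrm k p) (\<Union>g\<in>G. pull d y (saturate d' (Y g)))
    \<le> ennreal ((\<Sum>g\<in>G. w g) * real c powr a_coeff k)"
proof -
  have "phi (C_class nrm k p) (\<Union>g\<in>G. pull d y (saturate d' (Y g)))
      \<le> ennreal (\<Sum>g\<in>G. w g * real c powr a_coeff k)"
    by (rule phi_le_sum[where I = "\<lambda>g. I g \<inter> {d..d'}"])
       (use assms C_class_nonneg[OF t] in \<open>auto intro!: C_class_transfer[OF t assms(3,4)]\<close>)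
  then show ?thesis by (simp add: sum_distrib_right)
qed

text \<open>Only coordinates below \<open>d\<close> count, so avoidance survives every later change
  of the point.\<close>

definition avoids :: "nat \<Rightarrow> (nat \<Rightarrow> nat) \<Rightarrow> weighted set \<Rightarrow> bool" where
  "avoids d y F \<longleftrightarrow> (\<forall>t\<in>F. \<forall>x\<in>fst t. \<not> (\<forall>i<d. x i = y i))"

lemma avoids_mono: "avoids d y F \<Longrightarrow> d \<le> d' \<Longrightarrow> (\<And>i. i < d \<Longrightarrow> y' i = y i) \<Longrightarrow> avoids d' y' F"
  unfolding avoids_def by (metis (full_types) order_less_le_trans)

lemma avoids_Un: "avoids d y (F \<union> G) \<longleftrightarrow> avoids d y F \<and> avoids d y G"
  by (auto simp: avoids_def)

text \<open>If the pulled back and saturated members of \<open>F\<close> are cheaper than the pulled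
  back target, they do not cover it, and an uncovered point gives the extension.\<close>

lemma extend_avoiding:
  assumes "finite F" "F \<subseteq> C_class nrm k p" "y \<in> T_space" "1 \<le> c"
    and "\<And>t. t \<in> F \<Longrightarrow> nrm (fst (snd t)) \<le> c * nrm (fst (snd t) \<inter> {d..d'})"
    and "ennreal ((\<Sum>t\<in>F. snd (snd t)) * real c powr a_coeff k) < phi (C_class nrm k p) (pull d y Z)"
  shows "\<exists>z\<in>T_space. glue d y z \<in> Z \<and> avoids d' (glue d y z) F"
proof -
  have "(fst t, fst (snd t), snd (snd t)) \<in> C_class nrm k p" if "t \<in> F" for t using assms(2) that by auto
  then have "phi (C_class nrm k p) (\<Union>t\<in>F. pull d y (saturate d' (fst t)))
      \<le> ennreal ((\<Sum>t\<in>F. snd (snd t)) * real c powr a_coeff k)"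
    by (rule phi_transfer[OF assms(1) _ assms(3-5)])
  then have "\<not> pull d y Z \<subseteq> (\<Union>t\<in>F. pull d y (saturate d' (fst t)))"
    using assms(6) phi_mono by (meson leD order_trans)
  then obtain z where z: "z \<in> pull d y Z" "z \<notin> (\<Union>t\<in>F. pull d y (saturate d' (fst t)))" by blast
  then have "avoids d' (glue d y z) F"
    using glue_in_T_space[OF assms(3), of z d] by (auto simp: avoids_def pull_def saturate_def)
  then show ?thesis using z(1) by (auto simp: pull_def)
qed

text \<open>The claim is stated for every member of \<open>S\<close> because the induction
  hypothesis at \<open>Suc k\<close> is applied to tails of \<open>D\<close>.\<close>

lemma C_low_less_phi:
  assumes "D \<in> S" "u \<in> T_space"
  shows "ennreal (c_low k) \<le> phi (C_class nrm k p) {x \<in> T_space. \<forall>i\<in>D. x i = u i}"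
  using assms
proof (induction "p - k" arbitrary: k D u)
  case 0
  let ?Z = "{x \<in> T_space. \<forall>i\<in>D. x i = u i}"
  have C: "C_class nrm k p = {}" using 0 by (auto simp: C_class_iff)
  show ?case
  proof (rule leI, rule notI)
    assume "phi (C_class nrm k p) ?Z < ennreal (c_low k)"
    then obtain F where "F \<subseteq> C_class nrm k p" "?Z \<subseteq> (\<Union>t\<in>F. fst t)"
      by (rule phi_lessD) (auto simp: C)
    moreover have "u \<in> ?Z" using 0 by simp
    ultimately show False by (auto simp: C)
  qed
next
  case (Suc d)
  note D = Suc.prems(1) and u = Suc.prems(2)
  have k: "k < p" "d = p - Suc k" using Suc.hyps(2) by auto
  note IH = Suc.hyps(1)[OF k(2)]
  let ?Z = "{x \<in> T_space. \<forall>i\<in>D. x i = u i}"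
  let ?C = "C_class nrm (Suc k) p"
  let ?\<phi> = "phi ?C"
  show ?case
  proof (rule leI, rule notI)
    assume "phi (C_class nrm k p) ?Z < ennreal (c_low k)"
    then obtain F where F: "finite F" "F \<subseteq> C_class nrm k p" "?Z \<subseteq> (\<Union>t\<in>F. fst t)"
        "(\<Sum>t\<in>F. snd (snd t)) < c_low k"
      by (rule phi_lessD) (auto dest: C_class_nonneg)
    define tI :: "weighted \<Rightarrow> nat set" where "tI t = fst (snd t)" for t
    define tw :: "weighted \<Rightarrow> real" where "tw t = snd (snd t)" for t
    have w0: "0 \<le> tw t" if "t \<in> F" for t
      using C_class_nonneg[of "fst t" "tI t" "tw t" nrm k p] F(2) that by (auto simp: tI_def tw_def)
    have wF: "(\<Sum>t\<in>F. tw t) < c_low k" using F(4) by (simp add: tw_def)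
    have sumle: "(\<Sum>t\<in>G. tw t) \<le> (\<Sum>t\<in>F. tw t)" if "G \<subseteq> F" for G
      by (rule sum_mono2[OF F(1) that]) (use w0 in auto)
    have w16: "tw t < 16" if "t \<in> F" for t
    proof -
      have "tw t \<le> (\<Sum>t\<in>F. tw t)" using sumle[of "{t}"] that by simp
      then show ?thesis using wF c_low_less[of k] by linarith
    qed
    have finI: "finite (tI t)" "tI t \<noteq> {}" if t: "t \<in> F" for t
    proof -
      obtain j \<nu> where "t \<in> E_layer nrm j \<nu>" using F(2) t C_class_iff by blast
      then show "finite (tI t)" "tI t \<noteq> {}" by (auto simp: E_layer_def tI_def)
    qed
    \<comment> \<open>Members of level \<open>k\<close> will be avoided through their thinness,
      those in \<open>F1\<close> through the induction hypothesis or by their small weight.\<close>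
    define Q where "Q = F - ?C"
    define F1 where "F1 = F \<inter> ?C"
    have Q: "t \<in> E_layer nrm k ?\<phi>" if "t \<in> Q" for t
      using that F(2) C_class.simps[of nrm k p] k(1) by (auto simp: Q_def)
    have Q': "(fst t, tI t, tw t) \<in> E_layer nrm k ?\<phi>" if "t \<in> Q" for t
      using Q[OF that] by (simp add: tI_def tw_def)
    have finQ: "finite Q" "finite F1" using F(1) by (auto simp: Q_def F1_def)
    have QF: "Q \<subseteq> F" "F1 \<subseteq> F" "F1 \<subseteq> ?C" "F = Q \<union> F1" by (auto simp: Q_def F1_def)
    \<comment> \<open>Each member of level \<open>k\<close> weighs at least
      \<open>1 / 2 ^ k\<close>, and the total is below 16.\<close>
    have card: "card Q \<le> 2 ^ (k + 4)"
    proof -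
      have "real (card Q) * (1 / 2 ^ k) \<le> (\<Sum>t\<in>Q. tw t)"
        by (rule sum_bounded_below) (rule E_layer_ge[OF Q'])
      also have "\<dots> \<le> 16" using sumle[OF QF(1)] wF c_low_less[of k] by linarith
      finally have "real (card Q) \<le> real (2 ^ (k + 4))" by (simp add: field_simps power_add)
      then show ?thesis by (simp only: of_nat_le_iff)
    qed
    \<comment> \<open>Norm 65 exceeds \<open>2 * 32\<close>, so \<open>free_intervals\<close> finds
      32 free intervals in each piece \<open>J j\<close>.\<close>
    have large: "card Q * 65 \<le> nrm (tI t)" if "t \<in> Q" for t
    proof -
      have exps: "k + 4 + (k + 8) = 2 * k + 12" by simp
      have "card Q * 65 \<le> 2 ^ (k + 4) * 65" using card by simp
      also have "\<dots> \<le> 2 ^ (k + 4) * 2 ^ (k + 8)"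
      proof (rule mult_left_mono)
        have "(2::nat) ^ 8 \<le> 2 ^ (k + 8)" by (rule power_increasing) auto
        then show "65 \<le> (2::nat) ^ (k + 8)" by simp
      qed simp
      also have "\<dots> = 2 ^ (2 * k + 12)"
        by (simp only: power_add[symmetric] exps)
      also have "\<dots> \<le> nrm (tI t)"
        using E_layer_nrm[OF Q'[OF that]] w16[of t] that QF(1) by auto
      finally show ?thesis .
    qed
    have "\<exists>qs J. distinct qs \<and> set qs = Q \<and> (\<forall>j<length qs. J j \<subseteq> tI (qs ! j) \<and> 65 \<le> nrm (J j)) \<and>
        (\<forall>j<length qs. \<forall>j'<length qs. j < j' \<longrightarrow> (\<forall>x\<in>J j. \<forall>y\<in>J j'. x < y))"
      by (rule separated_subsets) (use finQ finI large QF(1) in auto)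
    then obtain qs J where qs: "distinct qs" "set qs = Q"
      and J: "\<And>j. j < length qs \<Longrightarrow> J j \<subseteq> tI (qs ! j) \<and> 65 \<le> nrm (J j)"
      and Jsep0: "\<forall>j<length qs. \<forall>j'<length qs. j < j' \<longrightarrow> (\<forall>x\<in>J j. \<forall>y\<in>J j'. x < y)"
      by blast
    have Jsep: "x < y" if "j < j'" "j' < length qs" "x \<in> J j" "y \<in> J j'" for j j' x y
      using Jsep0 that order.strict_trans by blast
    define s where "s = length qs"
    have s: "s = card Q" unfolding s_def using qs distinct_card by force
    have qsQ: "qs ! j \<in> Q" if "j < s" for j using that qs(2) by (auto simp: s_def)
    define P where "P j lo hi \<longleftrightarrow>
        (\<forall>i<32. lo i \<in> J j \<and> hi i \<in> J j \<and> lo i < hi i \<and> {lo i..<hi i} \<inter> D = {}) \<and>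
        (\<forall>i<32. \<forall>i'<32. i < i' \<longrightarrow> hi i \<le> lo i')" for j and lo hi :: "nat \<Rightarrow> nat"
    have "\<exists>lo hi. P j lo hi" if j: "j < s" for j
      unfolding P_def
    proof (rule free_intervals[OF D])
      have "finite (tI (qs ! j))" using qsQ[OF j] QF(1) by (intro finI) auto
      then show "finite (J j)" using J[of j] j by (auto simp: s_def intro: finite_subset)
      show "2 * 32 < nrm (J j)" using J[of j] j by (simp add: s_def)
    qed
    then obtain lo hi where lohi0: "\<And>j. j < s \<Longrightarrow> P j (lo j) (hi j)" by metis
    have lohi: "lo j i \<in> J j \<and> hi j i \<in> J j \<and> lo j i < hi j i \<and> {lo j i..<hi j i} \<inter> D = {}"
      if "j < s" "i < 32" for j i using lohi0[OF that(1)] that(2) unfolding P_def by blast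
    have lohi2: "hi j i \<le> lo j i'" if "j < s" "i' < 32" "i < i'" for j i i'
      using lohi0[OF that(1)] that(2,3) unfolding P_def by auto
    \<comment> \<open>The \<open>i\<close>-th system of windows: one free interval in each
      piece.\<close>
    define U where "U i = (\<Union>j<s. {lo j i..<hi j i})" for i
    have Udisj: "U i \<inter> U i' = {}" if ii: "i < 32" "i' < 32" "i \<noteq> i'" for i i'
    proof -
      have "{lo j i..<hi j i} \<inter> {lo j' i'..<hi j' i'} = {}" if jj: "j < s" "j' < s" for j j'
      proof (cases "j = j'")
        case True
        then show ?thesis using lohi2[of j i' i] lohi2[of j i i'] ii jj
          by (cases "i < i'") auto
      next
        case False
        then show ?thesis
          using Jsep[of j j' "hi j i" "lo j' i'"] Jsep[of j' j "hi j' i'" "lo j i"]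
            lohi[of j i] lohi[of j' i'] ii jj
          by (cases "j < j'") (auto simp: s_def)
      qed
      then show ?thesis unfolding U_def by blast
    qed
    \<comment> \<open>Members keeping less than half of their norm outside the \<open>i\<close>-th
      system. By subadditivity no member can do so for two disjoint systems.\<close>
    define bad where "bad i = {t \<in> F1. 2 * nrm (tI t - U i) < nrm (tI t)}" for i
    have badF1: "bad i \<subseteq> F1" for i by (auto simp: bad_def)
    have finI1: "finite (tI t)" if "t \<in> F1" for t using finI(1) QF(2) that by blast
    have bad_disj: "bad i \<inter> bad i' = {}" if ii: "i < 32" "i' < 32" "i \<noteq> i'" for i i'
    proof -
      have False if t: "t \<in> bad i" "t \<in> bad i'" for t
      proof -
        have fin: "finite (tI t)" using t badF1 finI1 by blast
        have "nrm (tI t) \<le> nrm (tI t - U i' \<union> (tI t - U i))"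
          using Udisj[OF ii] fin by (intro nrm_mono) auto
        also have "\<dots> \<le> nrm (tI t - U i') + nrm (tI t - U i)" using fin by (intro nrm_Un) auto
        finally show False using t by (simp add: bad_def)
      qed
      then show ?thesis by blast
    qed
    \<comment> \<open>The 32 disjoint classes share a weight below 16.\<close>
    have "\<exists>i<32. (\<Sum>t\<in>bad i. tw t) \<le> 1 / 2"
    proof (rule ccontr)
      assume "\<not> ?thesis"
      then have "(\<Sum>i<32::nat. 1 / 2) \<le> (\<Sum>i<32. \<Sum>t\<in>bad i. tw t)"
        by (intro sum_mono) (auto simp: not_le intro: less_imp_le)
      also have "\<dots> = (\<Sum>t\<in>(\<Union>i<32. bad i). tw t)"
        by (rule sum.UNION_disjoint[symmetric]) (use finQ bad_disj in \<open>auto simp: bad_def\<close>)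
      also have "\<dots> \<le> (\<Sum>t\<in>F. tw t)" by (rule sumle) (use QF in \<open>auto simp: bad_def\<close>)
      finally show False using wF c_low_less[of k] by simp
    qed
    then obtain i where i: "i < 32" "(\<Sum>t\<in>bad i. tw t) \<le> 1 / 2" by blast
    let ?lo = "\<lambda>j. lo j i" and ?hi = "\<lambda>j. hi j i"
    have "finite (\<Union>t\<in>F. tI t)" using F(1) finI by blast
    then obtain N where "(\<Union>t\<in>F. tI t) \<subseteq> {..<N}" using finite_nat_iff_bounded by blast
    then have N: "tI t \<subseteq> {..<N}" if "t \<in> F" for t using that by blast
    \<comment> \<open>Gap \<open>j\<close> runs from \<open>e j\<close> to \<open>m j\<close>,
      window \<open>j\<close> from \<open>lo j i\<close> to \<open>hi j i\<close>; the last gap ends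
      at \<open>N\<close>, beyond all index sets.\<close>
    define e where "e j = (if j = 0 then 0 else ?hi (j - 1))" for j
    define m where "m j = (if j < s then ?lo j else N)" for j
    have e_lo: "e j \<le> ?lo j" if "j < s" for j
      using Jsep[of "j - 1" j "?hi (j - 1)" "?lo j"] lohi[of "j - 1" i] lohi[of j i] that i
      by (auto simp: e_def s_def)
    have lo_hi: "?lo j < ?hi j" if "j < s" for j using lohi[of j i] that i by blast
    \<comment> \<open>At least twice the number \<open>s + 1\<close> of gaps, so each member of
      \<open>F1\<close> keeps a proportion \<open>1 / c\<close> of its norm in one gap or
      window.\<close>
    define c :: nat where "c = 2 ^ (k + 6)"
    have c1: "1 \<le> c" by (simp add: c_def)
    have c: "real c powr a_coeff (Suc k) = 2 powr (1 / (real k + 6) ^ 2)"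
      unfolding c_def by (rule powr_a_coeff)
    have c2: "real c powr a_coeff (Suc k) \<le> 2"
    proof -
      have "(1::real) \<le> (real k + 6) ^ 2" by (rule one_le_power) auto
      then have "1 / (real k + 6) ^ 2 \<le> 1" by simp
      then have "2 powr (1 / (real k + 6) ^ 2) \<le> 2 powr (1::real)" by (intro powr_mono) auto
      then show ?thesis unfolding c by simp
    qed
    have sc: "2 * (s + 1) \<le> c"
    proof -
      have "s + 1 \<le> 2 ^ (k + 4) + 2 ^ (k + 4)" using card by (intro add_mono) (simp_all add: s)
      then have "2 * (s + 1) \<le> 2 * (2 ^ (k + 4) + 2 ^ (k + 4))" by (rule mult_le_mono2)
      also have "\<dots> = c" by (simp add: c_def power_add)
      finally show ?thesis .
    qed
    define gap where "gap j = {t \<in> F1. nrm (tI t) \<le> c * nrm (tI t \<inter> {e j..<m j})}" for j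
    define win where "win j = {t \<in> bad i. nrm (tI t) \<le> c * nrm (tI t \<inter> {?lo j..<?hi j})}" for j
    \<comment> \<open>Otherwise the windows account for at most half of the norm, since
      \<open>2 * s \<le> c\<close>, and the outside for less than half.\<close>
    have cover1: "t \<in> (\<Union>j<s. win j)" if t: "t \<in> bad i" for t
    proof (rule ccontr)
      assume neg: "\<not> ?thesis"
      have tF: "t \<in> F" "finite (tI t)" using t QF(2) badF1 finI1 by blast+
      have small: "c * nrm (tI t \<inter> {?lo j..<?hi j}) \<le> nrm (tI t)" if "j < s" for j
        using neg t that by (force simp: win_def)
      have "nrm (tI t) \<le> nrm (tI t - U i \<union> (\<Union>j<s. tI t \<inter> {?lo j..<?hi j}))"
        using tF by (intro nrm_mono) (auto simp: U_def)
      also have "\<dots> \<le> nrm (tI t - U i) + nrm (\<Union>j<s. tI t \<inter> {?lo j..<?hi j})"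
        using tF by (intro nrm_Un) auto
      also have "nrm (\<Union>j<s. tI t \<inter> {?lo j..<?hi j}) \<le> (\<Sum>j<s. nrm (tI t \<inter> {?lo j..<?hi j}))"
        using tF by (intro nrm_UN) auto
      finally have "nrm (tI t) \<le> nrm (tI t - U i) + (\<Sum>j<s. nrm (tI t \<inter> {?lo j..<?hi j}))"
        by simp
      then have "c * nrm (tI t) \<le> c * (nrm (tI t - U i) + (\<Sum>j<s. nrm (tI t \<inter> {?lo j..<?hi j})))"
        by (rule mult_le_mono2)
      also have "\<dots> = c * nrm (tI t - U i) + (\<Sum>j<s. c * nrm (tI t \<inter> {?lo j..<?hi j}))"
        by (simp only: distrib_left sum_distrib_left)
      also have "(\<Sum>j<s. c * nrm (tI t \<inter> {?lo j..<?hi j})) \<le> s * nrm (tI t)"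
        using sum_bounded_above[of "{..<s}" "\<lambda>j. c * nrm (tI t \<inter> {?lo j..<?hi j})" "nrm (tI t)"] small by simp
      finally have 1: "2 * (c * nrm (tI t)) \<le> c * (2 * nrm (tI t - U i)) + 2 * s * nrm (tI t)" by simp
      have "c * (2 * nrm (tI t - U i)) + c \<le> c * nrm (tI t)"
        using t mult_le_mono2[of "Suc (2 * nrm (tI t - U i))" "nrm (tI t)" c] by (simp add: bad_def)
      moreover have "2 * s * nrm (tI t) \<le> c * nrm (tI t)" using sc by (intro mult_le_mono1) simp
      ultimately show False using 1 c1 by linarith
    qed
    have in_gap: "\<exists>j\<le>s. e j \<le> x \<and> x < m j" if x: "x < N" "x \<notin> U i" for x
    proof -
      define j where "j = (LEAST j. j \<le> s \<and> x < m j)"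
      have "\<exists>j. j \<le> s \<and> x < m j" using x(1) by (intro exI[of _ s]) (simp add: m_def)
      then have j: "j \<le> s" "x < m j" unfolding j_def by (metis (mono_tags, lifting) LeastI_ex)+
      have "e j \<le> x"
      proof (cases j)
        case (Suc j')
        then have "\<not> (j' \<le> s \<and> x < m j')" using not_less_Least[of j' "\<lambda>j. j \<le> s \<and> x < m j"] by (simp add: j_def)
        then have "?lo j' \<le> x" using j Suc by (simp add: m_def)
        then have "?hi j' \<le> x" using x(2) j Suc by (auto simp: U_def not_less)
        then show ?thesis by (simp add: e_def Suc)
      qed (simp add: e_def)
      then show ?thesis using j by blast
    qed
    have cover2: "t \<in> (\<Union>j\<le>s. gap j)" if t: "t \<in> F1" "t \<notin> bad i" for t
    proof (rule ccontr)
      assume neg: "\<not> ?thesis"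
      have tF: "t \<in> F" "finite (tI t)" "tI t \<noteq> {}" using t QF(2) finI by blast+
      \<comment> \<open>Strictness is recorded by subtracting 1, so that all \<open>s + 1\<close>
        gaps together stay strictly below half of the norm.\<close>
      have small: "c * nrm (tI t \<inter> {e j..<m j}) \<le> nrm (tI t) - 1" if "j \<le> s" for j
        using neg t that by (force simp: gap_def)
      have "tI t - U i \<subseteq> (\<Union>j\<le>s. tI t \<inter> {e j..<m j})"
      proof
        fix x assume x: "x \<in> tI t - U i"
        then have "x < N" using N[OF tF(1)] by blast
        then obtain j where "j \<le> s" "e j \<le> x" "x < m j" using in_gap[of x] x by blast
        then show "x \<in> (\<Union>j\<le>s. tI t \<inter> {e j..<m j})" using x by auto
      qed
      then have "nrm (tI t - U i) \<le> nrm (\<Union>j\<le>s. tI t \<inter> {e j..<m j})"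
        using tF(2) by (intro nrm_mono) auto
      also have "\<dots> \<le> (\<Sum>j\<le>s. nrm (tI t \<inter> {e j..<m j}))"
        using tF by (intro nrm_UN) auto
      finally have "c * nrm (tI t - U i) \<le> c * (\<Sum>j\<le>s. nrm (tI t \<inter> {e j..<m j}))"
        by (rule mult_le_mono2)
      also have "\<dots> = (\<Sum>j\<le>s. c * nrm (tI t \<inter> {e j..<m j}))" by (rule sum_distrib_left)
      also have "\<dots> \<le> (s + 1) * (nrm (tI t) - 1)"
        using sum_bounded_above[of "{..s}" "\<lambda>j. c * nrm (tI t \<inter> {e j..<m j})" "nrm (tI t) - 1"] small by simp
      finally have "2 * (c * nrm (tI t - U i)) \<le> 2 * (s + 1) * (nrm (tI t) - 1)" by simp
      also have "\<dots> \<le> c * (nrm (tI t) - 1)" using sc by (intro mult_le_mono1)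
      finally have "c * (2 * nrm (tI t - U i)) \<le> c * (nrm (tI t) - 1)" by simp
      then have "2 * nrm (tI t - U i) \<le> nrm (tI t) - 1" using c1 by simp
      then show False using t nrm_pos[OF tF(2,3)] by (simp add: bad_def)
    qed
    \<comment> \<open>Across a gap, coordinates in \<open>D\<close> must follow \<open>u\<close>.
      The induction hypothesis for the tail of \<open>D\<close> beats the weight of the gap members,
      since \<open>c_low\<close> grows by at least the factor lost in the transfer.\<close>
    have gap_step: "\<exists>y'\<in>T_space. (\<forall>i<e j. y' i = y i) \<and> (\<forall>i\<in>D. e j \<le> i \<longrightarrow> y' i = u i) \<and> avoids (m j) y' (gap j)"
      if y: "y \<in> T_space" for y j
    proof -
      let ?Z = "{x \<in> T_space. \<forall>i\<in>D. e j \<le> i \<longrightarrow> x i = u i}"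
      have "\<exists>z\<in>T_space. glue (e j) y z \<in> ?Z \<and> avoids (m j) (glue (e j) y z) (gap j)"
      proof (rule extend_avoiding[OF _ _ y c1])
        show "finite (gap j)" "gap j \<subseteq> ?C" using finQ QF by (auto simp: gap_def)
        show "nrm (fst (snd t)) \<le> c * nrm (fst (snd t) \<inter> {e j..m j})" if t: "t \<in> gap j" for t
        proof -
          have "nrm (tI t \<inter> {e j..<m j}) \<le> nrm (tI t \<inter> {e j..m j})"
            using t finI1[of t] by (intro nrm_mono) (auto simp: gap_def)
          then have "c * nrm (tI t \<inter> {e j..<m j}) \<le> c * nrm (tI t \<inter> {e j..m j})" by (rule mult_le_mono2)
          moreover have "nrm (tI t) \<le> c * nrm (tI t \<inter> {e j..<m j})" using t by (simp add: gap_def)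
          ultimately show ?thesis unfolding tI_def by linarith
        qed
        have "(\<Sum>t\<in>gap j. tw t) \<le> (\<Sum>t\<in>F. tw t)" using QF by (intro sumle) (auto simp: gap_def)
        then have "(\<Sum>t\<in>gap j. tw t) < c_low k" using wF by simp
        then have "(\<Sum>t\<in>gap j. tw t) * real c powr a_coeff (Suc k) < c_low k * real c powr a_coeff (Suc k)"
          using c1 by (intro mult_strict_right_mono) auto
        also have "\<dots> \<le> c_low (Suc k)" unfolding c by (rule c_low_Suc)
        finally have less: "(\<Sum>t\<in>gap j. tw t) * real c powr a_coeff (Suc k) < c_low (Suc k)" .
        have "ennreal ((\<Sum>t\<in>gap j. tw t) * real c powr a_coeff (Suc k)) < ennreal (c_low (Suc k))"
          using c_low_ge[of "Suc k"] less by (intro ennreal_lessI) auto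
        also have "\<dots> \<le> ?\<phi> {x \<in> T_space. \<forall>i\<in>D \<inter> {e j..}. x i = u i}"
          by (rule IH) (use D S_subset u in auto)
        also have "{x \<in> T_space. \<forall>i\<in>D \<inter> {e j..}. x i = u i} = pull (e j) y ?Z"
          using y by (auto simp: pull_def glue_in_T_space) (auto simp: glue_def)
        finally show "ennreal ((\<Sum>t\<in>gap j. snd (snd t)) * real c powr a_coeff (Suc k)) < ?\<phi> (pull (e j) y ?Z)"
          by (simp add: tw_def)
      qed
      then obtain z where z: "z \<in> T_space" "glue (e j) y z \<in> ?Z" "avoids (m j) (glue (e j) y z) (gap j)" by blast
      have "\<forall>i<e j. glue (e j) y z i = y i" by (simp add: glue_def)
      then show ?thesis using z by blast
    qed
    \<comment> \<open>A window misses \<open>D\<close>, so the point may move into a hole supplied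
      by the thinness of \<open>qs ! j\<close>. The hole has value above 1, while the window members
      weigh at most 1/2 and at most double in the transfer.\<close>
    have win_step: "\<exists>y'\<in>T_space. (\<forall>i<?lo j. y' i = y i) \<and> avoids (?hi j) y' (insert (qs ! j) (win j))"
      if y: "y \<in> T_space" and j: "j < s" for y j
    proof -
      let ?q = "qs ! j"
      have q: "thin ?\<phi> (tI ?q) (fst ?q)" "fst ?q \<in> Balg"
        using Q'[OF qsQ[OF j]] by (auto simp: E_layer_def)
      have "?lo j \<in> tI ?q" "?hi j \<in> tI ?q" using lohi[OF j i(1)] J[of j] j by (auto simp: s_def)
      then have "thin_at ?\<phi> (?lo j) (?hi j) (fst ?q)" using q(1) lo_hi[OF j] by (simp add: thin_def)
      then obtain H where H: "H \<in> Balg_at (?hi j)" "\<And>x. x \<in> H \<Longrightarrow> x \<notin> fst ?q" "1 < ?\<phi> (pull (?lo j) y H)"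
        unfolding thin_at_iff using y by blast
      have "\<exists>z\<in>T_space. glue (?lo j) y z \<in> H \<and> avoids (?hi j) (glue (?lo j) y z) (win j)"
      proof (rule extend_avoiding[OF _ _ y c1])
        show "finite (win j)" "win j \<subseteq> ?C" using finQ QF by (auto simp: win_def bad_def)
        show "nrm (fst (snd t)) \<le> c * nrm (fst (snd t) \<inter> {?lo j..?hi j})" if t: "t \<in> win j" for t
        proof -
          have "nrm (tI t \<inter> {?lo j..<?hi j}) \<le> nrm (tI t \<inter> {?lo j..?hi j})"
            using t finI1[of t] by (intro nrm_mono) (auto simp: win_def bad_def)
          then have "c * nrm (tI t \<inter> {?lo j..<?hi j}) \<le> c * nrm (tI t \<inter> {?lo j..?hi j})" by (rule mult_le_mono2)
          moreover have "nrm (tI t) \<le> c * nrm (tI t \<inter> {?lo j..<?hi j})" using t by (simp add: win_def)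
          ultimately show ?thesis unfolding tI_def by linarith
        qed
        have "(\<Sum>t\<in>win j. tw t) \<le> (\<Sum>t\<in>bad i. tw t)"
          by (rule sum_mono2) (use finQ QF w0 in \<open>auto simp: win_def bad_def\<close>)
        then have "(\<Sum>t\<in>win j. tw t) \<le> 1 / 2" using i by simp
        then have "(\<Sum>t\<in>win j. tw t) * real c powr a_coeff (Suc k) \<le> 1 / 2 * 2"
          using c2 by (intro mult_mono) auto
        then have "ennreal ((\<Sum>t\<in>win j. tw t) * real c powr a_coeff (Suc k)) \<le> 1"
          using ennreal_leI by fastforce
        then show "ennreal ((\<Sum>t\<in>win j. snd (snd t)) * real c powr a_coeff (Suc k)) < ?\<phi> (pull (?lo j) y H)"
          using H(3) unfolding tw_def by (rule order_le_less_trans)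
      qed
      then obtain z where z: "z \<in> T_space" "glue (?lo j) y z \<in> H" "avoids (?hi j) (glue (?lo j) y z) (win j)" by blast
      have "avoids (?hi j) (glue (?lo j) y z) {?q}"
        unfolding avoids_def
      proof (intro ballI notI)
        fix t x assume t: "t \<in> {?q}" "x \<in> fst t" and ag: "\<forall>i<?hi j. x i = glue (?lo j) y z i"
        have "x \<in> T_space" using t q(2) Balg_at_subset by (auto simp: Balg_def)
        then have "x \<in> H" by (intro Balg_atD[OF H(1) z(2)]) (use ag in auto)
        then show False using H(2) t by blast
      qed
      then have "avoids (?hi j) (glue (?lo j) y z) ({?q} \<union> win j)" using z(3) by (simp only: avoids_Un)
      then have "avoids (?hi j) (glue (?lo j) y z) (insert ?q (win j))" by simp
      moreover have "\<forall>i<?lo j. glue (?lo j) y z i = y i" by (simp add: glue_def)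
      moreover have "glue (?lo j) y z \<in> T_space" by (rule glue_in_T_space[OF y z(1)])
      ultimately show ?thesis by blast
    qed
    \<comment> \<open>Everything to be avoided before gap \<open>j\<close> begins.\<close>
    define hist where "hist j = (\<Union>j'<j. insert (qs ! j') (gap j' \<union> win j'))" for j
    have chain: "\<exists>y\<in>T_space. (\<forall>i\<in>D. i < e j \<longrightarrow> y i = u i) \<and> avoids (e j) y (hist j)" if "j \<le> s" for j
      using that
    proof (induction j)
      case 0
      then show ?case using u by (auto simp: hist_def avoids_def)
    next
      case (Suc j)
      then obtain y where y: "y \<in> T_space" "\<forall>i\<in>D. i < e j \<longrightarrow> y i = u i" "avoids (e j) y (hist j)" by auto
      obtain y1 where y1: "y1 \<in> T_space" "\<forall>i<e j. y1 i = y i" "\<forall>i\<in>D. e j \<le> i \<longrightarrow> y1 i = u i"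
        "avoids (m j) y1 (gap j)" using gap_step[OF y(1), of j] by blast
      have j: "j < s" using Suc.prems by simp
      obtain y2 where y2: "y2 \<in> T_space" "\<forall>i<?lo j. y2 i = y1 i" "avoids (?hi j) y2 (insert (qs ! j) (win j))"
        using win_step[OF y1(1) j] by blast
      have eq: "e (Suc j) = ?hi j" "m j = ?lo j" using j by (auto simp: e_def m_def)
      have "avoids (?hi j) y2 (hist j)"
        by (rule avoids_mono[OF y(3)]) (use e_lo[OF j] lo_hi[OF j] y1 y2 in auto)
      moreover have "avoids (?hi j) y2 (gap j)"
        by (rule avoids_mono[OF y1(4)]) (use lo_hi[OF j] y2 eq in auto)
      ultimately have "avoids (?hi j) y2 (hist j \<union> gap j \<union> insert (qs ! j) (win j))"
        using y2(3) by (simp only: avoids_Un)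
      moreover have "hist (Suc j) = hist j \<union> gap j \<union> insert (qs ! j) (win j)"
        by (auto simp: hist_def lessThan_Suc)
      moreover have "y2 x = u x" if x: "x \<in> D" "x < ?hi j" for x
      proof -
        have "{?lo j..<?hi j} \<inter> D = {}" using lohi[OF j i(1)] by blast
        then have "x \<notin> {?lo j..<?hi j}" using x(1) by blast
        then have "x < ?lo j" using x(2) by simp
        then have "y2 x = y1 x" using y2 by blast
        then show ?thesis using y1 y(2) x(1) by (cases "x < e j") auto
      qed
      ultimately show ?case using y2(1) by (auto simp: eq)
    qed
    obtain y where y: "y \<in> T_space" "\<forall>i\<in>D. i < e s \<longrightarrow> y i = u i" "avoids (e s) y (hist s)"
      using chain by blast
    obtain y1 where y1: "y1 \<in> T_space" "\<forall>i<e s. y1 i = y i" "\<forall>i\<in>D. e s \<le> i \<longrightarrow> y1 i = u i"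
        "avoids (m s) y1 (gap s)" using gap_step[OF y(1), of s] by blast
    define N' where "N' = max N (e s)"
    have "avoids N' y1 (hist s)" by (rule avoids_mono[OF y(3)]) (use y1 in \<open>auto simp: N'_def\<close>)
    moreover have "avoids N' y1 (gap s)" by (rule avoids_mono[OF y1(4)]) (auto simp: N'_def m_def)
    ultimately have av: "avoids N' y1 (hist s \<union> gap s)" by (simp only: avoids_Un)
    have "y1 x = u x" if "x \<in> D" for x using y1 y(2) that by (cases "x < e s") auto
    then have "y1 \<in> ?Z" using y1(1) by simp
    then obtain t where t: "t \<in> F" "y1 \<in> fst t" using F(3) by blast
    have "t \<in> hist s \<union> gap s"
    proof (cases "t \<in> Q")
      case True
      then obtain j where "j < s" "t = qs ! j" using qs(2) by (metis in_set_conv_nth s_def)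
      then show ?thesis by (auto simp: hist_def)
    next
      case False
      then have F1: "t \<in> F1" using t QF by blast
      show ?thesis
      proof (cases "t \<in> bad i")
        case True
        then show ?thesis using cover1[of t] by (auto simp: hist_def)
      next
        case False
        then obtain j where "j \<le> s" "t \<in> gap j" using cover2[OF F1] by blast
        then show ?thesis by (cases "j = s") (auto simp: hist_def)
      qed
    qed
    then show False using av t(2) unfolding avoids_def by blast
  qed
qed

end

section \<open>Holes\<close>

text \<open>The crude bound \<open>a_coeff k \<le> 1 / 7\<close> suffices, as
  \<open>4 \<le> (5 / 4) ^ 7\<close>.\<close>

lemma powr_a_coeff_le:
  assumes "c \<le> 4"
  shows "real c powr a_coeff k \<le> 5 / 4"
proof -
  have a: "a_coeff k \<le> 1 / 7"
    using a_coeff_antimono[of 0 k] by (simp add: a_coeff_def)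
  have "real c powr a_coeff k \<le> 4 powr a_coeff k"
    using assms by (intro powr_mono2 less_imp_le[OF a_coeff_pos]) auto
  also have "\<dots> \<le> 4 powr (1 / 7)" using a by (intro powr_mono) auto
  also have "\<dots> \<le> ((5 / 4) ^ 7) powr (1 / 7)" by (intro powr_mono2) (auto simp: power_divide)
  also have "((5 / 4 :: real) ^ 7) powr (1 / 7) = 5 / 4"
  proof -
    have "(5 / 4 :: real) ^ 7 = (5 / 4) powr real 7" by (rule powr_realpow[symmetric]) simp
    then show ?thesis by (simp only: powr_powr) simp
  qed
  finally show ?thesis .
qed

context spread_norm
begin

lemma eight_le_phi: "8 \<le> phi (C_class nrm k p) T_space"
proof -
  have "ennreal 8 \<le> ennreal (c_low k)" using c_low_ge by (rule ennreal_leI)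
  also have "\<dots> \<le> phi (C_class nrm k p) {x \<in> T_space. \<forall>i\<in>{}. x i = 0}"
    by (rule C_low_less_phi[OF empty_S zero_in_T_space])
  finally show ?thesis by simp
qed

text \<open>A cheap cover of the union is sorted by where its index sets have their norm. Sets with
  norm before \<open>cut i\<close> are cut out of the hole; sets with norm after
  \<open>cut (Suc i)\<close> are evaded by changing late coordinates, which \<open>E i\<close> does
  not see. Only the sets concentrated in between remain, and for some \<open>i\<close> these are
  light.\<close>

lemma phi_hole:
  fixes cut :: "nat \<Rightarrow> nat" and N :: nat
  assumes y: "y \<in> T_space" and "0 < N" and cut: "mono cut"
    and E: "\<And>i. i < N \<Longrightarrow> E i \<in> Balg_at (cut (Suc i))"
    and small: "phi (C_class nrm k p) (pull (cut 0) y (\<Union>i<N. E i)) < 2"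
  shows "\<exists>i<N. \<exists>H\<in>Balg_at (cut i). (\<forall>x\<in>H. \<forall>j<cut 0. x j = y j) \<and>
    2 \<le> phi (C_class nrm k p) (pull (cut 0) y H) \<and> phi (C_class nrm k p) (E i \<inter> H) \<le> ennreal (4 / N)"
proof -
  let ?C = "C_class nrm k p"
  let ?X = "pull (cut 0) y (\<Union>i<N. E i)"
  define m where "m = cut 0"
  have "phi ?C ?X < ennreal 2" using small by simp
  then obtain F where F: "finite F" "F \<subseteq> ?C" "?X \<subseteq> (\<Union>t\<in>F. fst t)" "(\<Sum>t\<in>F. snd (snd t)) < 2"
    by (rule phi_lessD) (auto dest: C_class_nonneg)
  define tI :: "weighted \<Rightarrow> nat set" where "tI t = fst (snd t)" for t
  define tw :: "weighted \<Rightarrow> real" where "tw t = snd (snd t)" for t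
  have tC: "(fst t, tI t, tw t) \<in> ?C" if "t \<in> F" for t using F(2) that by (auto simp: tI_def tw_def)
  have w0: "0 \<le> tw t" if "t \<in> F" for t by (rule C_class_nonneg[OF tC[OF that]])
  have finI: "finite (tI t)" if t: "t \<in> F" for t
  proof -
    obtain j \<nu> where "t \<in> E_layer nrm j \<nu>" using F(2) t C_class_iff by blast
    then show "finite (tI t)" by (auto simp: E_layer_def tI_def)
  qed
  \<comment> \<open>Members with half of their norm up to \<open>m\<close> are avoided by fixing an
    initial segment \<open>y'\<close>; the others can then be made independent of the coordinates
    below \<open>m\<close>.\<close>
  define V where "V = {t \<in> F. nrm (tI t) \<le> 2 * nrm (tI t \<inter> {0..m})}"
  have "\<exists>z\<in>T_space. glue 0 y z \<in> T_space \<and> avoids m (glue 0 y z) V"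
  proof (rule extend_avoiding[OF _ _ y, of _ k p 2])
    show "finite V" "V \<subseteq> ?C" using F by (auto simp: V_def)
    show "nrm (fst (snd t)) \<le> 2 * nrm (fst (snd t) \<inter> {0..m})" if "t \<in> V" for t
      using that by (simp add: V_def tI_def)
    have "(\<Sum>t\<in>V. tw t) \<le> (\<Sum>t\<in>F. tw t)" by (rule sum_mono2) (use F w0 in \<open>auto simp: V_def\<close>)
    then have "(\<Sum>t\<in>V. tw t) \<le> 2" using F(4) by (simp add: tw_def)
    then have "(\<Sum>t\<in>V. tw t) * real 2 powr a_coeff k \<le> 2 * (5 / 4)"
      by (intro mult_mono powr_a_coeff_le) auto
    then have "ennreal ((\<Sum>t\<in>V. tw t) * real 2 powr a_coeff k) < ennreal 8"
      by (intro ennreal_lessI) auto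
    also have "\<dots> \<le> phi ?C T_space" using eight_le_phi by simp
    also have "T_space = pull 0 y T_space" by (auto simp: pull_def glue_def)
    finally show "ennreal ((\<Sum>t\<in>V. snd (snd t)) * real 2 powr a_coeff k) < phi ?C (pull 0 y T_space)"
      by (simp add: tw_def)
  qed simp
  then obtain y' where y': "y' \<in> T_space" "avoids m y' V" by blast
  have "finite (\<Union>t\<in>F. tI t)" using F(1) finI by blast
  then obtain L where L0: "(\<Union>t\<in>F. tI t) \<subseteq> {..<L}" using finite_nat_iff_bounded by blast
  have L: "tI t \<subseteq> {0..L}" if "t \<in> F" for t using L0 that by fastforce
  define G where "G = F - V"
  have GF: "G \<subseteq> F" "finite G" using F(1) by (auto simp: G_def)
  define Y where "Y t = pull m y' (saturate L (fst t))" for t :: weighted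
  define J where "J t = tI t \<inter> {m..L}" for t
  define v where "v t = tw t * real 2 powr a_coeff k" for t
  have finJ: "finite (J t)" for t by (simp add: J_def)
  have JL: "J t \<subseteq> {0..L}" for t by (auto simp: J_def)
  have YC: "(Y t, J t, v t) \<in> ?C" if t: "t \<in> G" for t
    unfolding Y_def J_def v_def
  proof (rule C_class_transfer[OF tC y'(1)])
    have tF: "t \<in> F" using t GF by blast
    have "nrm (tI t) \<le> nrm (tI t \<inter> {0..m}) + nrm (tI t \<inter> {m..L})"
      by (rule nrm_split) (use finI[OF tF] L[OF tF] in auto)
    moreover have "2 * nrm (tI t \<inter> {0..m}) < nrm (tI t)" using t tF by (auto simp: G_def V_def)
    ultimately show "nrm (tI t) \<le> 2 * nrm (tI t \<inter> {m..L})" by simp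
  qed (use t GF in auto)
  have v0: "0 \<le> v t" if "t \<in> G" for t by (rule C_class_nonneg[OF YC[OF that]])
  have vG: "(\<Sum>t\<in>G. v t) \<le> 5 / 2"
  proof -
    have "(\<Sum>t\<in>G. tw t) \<le> (\<Sum>t\<in>F. tw t)" by (rule sum_mono2) (use F GF w0 in auto)
    then have "(\<Sum>t\<in>G. tw t) \<le> 2" using F(4) by (simp add: tw_def)
    then have "(\<Sum>t\<in>G. tw t) * real 2 powr a_coeff k \<le> 2 * (5 / 4)"
      by (intro mult_mono powr_a_coeff_le) auto
    then show ?thesis by (simp add: v_def sum_distrib_right)
  qed
  have Yinv: "x' \<in> Y t" if "x \<in> Y t" "x' \<in> T_space" "\<forall>i\<ge>m. x' i = x i" for x x' t
  proof -
    have "glue m y' x' = glue m y' x" using that(3) by (auto simp: glue_def)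
    then show ?thesis using that(1,2) by (simp add: Y_def pull_def)
  qed
  have XY: "\<exists>t\<in>G. z \<in> Y t" if z: "z \<in> ?X" for z
  proof -
    have zT: "z \<in> T_space" using z by (simp add: pull_def)
    have gT: "glue m y' z \<in> T_space" using y'(1) zT by (rule glue_in_T_space)
    have "glue (cut 0) y (glue m y' z) = glue (cut 0) y z" by (auto simp: glue_def m_def)
    then have "glue m y' z \<in> ?X" using z gT by (simp add: pull_def)
    then obtain t where t: "t \<in> F" "glue m y' z \<in> fst t" using F(3) by blast
    have "t \<notin> V" using y'(2) t(2) unfolding avoids_def by (metis glue_def)
    moreover have "glue m y' z \<in> saturate L (fst t)" using t(2) gT by (auto simp: saturate_def)
    ultimately show ?thesis using t(1) zT by (auto simp: G_def Y_def pull_def)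
  qed
  \<comment> \<open>A common member of two classes \<open>mid i\<close> would have less than a third
    of its norm on either side of some cut.\<close>
  define low where "low i = {t \<in> G. nrm (J t) \<le> 3 * nrm (J t \<inter> {0..cut i})}" for i
  define high where "high i = {t \<in> G. nrm (J t) \<le> 3 * nrm (J t \<inter> {cut (Suc i)..L})}" for i
  define mid where "mid i = G - low i - high i" for i
  have part: "nrm (J t) \<le> nrm (J t \<inter> {0..a}) + nrm (J t \<inter> {a..L})" for t a
    by (rule nrm_split[OF finJ]) (use JL[of t] in auto)
  have mid_disj: "mid i \<inter> mid i' = {}" if "i < i'" for i i'
  proof -
    have False if t: "t \<in> mid i" "t \<in> mid i'" for t
    proof -
      have "cut (Suc i) \<le> cut i'" using \<open>i < i'\<close> cut by (simp add: monoD)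
      then have "nrm (J t \<inter> {cut i'..L}) \<le> nrm (J t \<inter> {cut (Suc i)..L})"
        using finJ by (intro nrm_mono) auto
      moreover have "3 * nrm (J t \<inter> {cut (Suc i)..L}) < nrm (J t)"
        using t(1) by (auto simp: mid_def high_def)
      moreover have "3 * nrm (J t \<inter> {0..cut i'}) < nrm (J t)" using t(2) by (auto simp: mid_def low_def)
      ultimately show False using part[of t "cut i'"] by simp
    qed
    then show ?thesis by blast
  qed
  \<comment> \<open>Otherwise the total weight would be at least 3, but it is at most 5/2.\<close>
  have "\<exists>i<N. (\<Sum>t\<in>mid i. v t) \<le> 3 / N"
  proof (rule ccontr)
    assume "\<not> ?thesis"
    then have "(\<Sum>i<N. 3 / N) \<le> (\<Sum>i<N. \<Sum>t\<in>mid i. v t)"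
      by (intro sum_mono) (auto simp: not_le intro: less_imp_le)
    also have "\<dots> = (\<Sum>t\<in>(\<Union>i<N. mid i). v t)"
    proof (rule sum.UNION_disjoint[symmetric])
      show "\<forall>i\<in>{..<N}. \<forall>j\<in>{..<N}. i \<noteq> j \<longrightarrow> mid i \<inter> mid j = {}"
        using mid_disj by (metis inf_commute linorder_neqE_nat)
    qed (use GF in \<open>auto simp: mid_def\<close>)
    also have "\<dots> \<le> (\<Sum>t\<in>G. v t)" by (rule sum_mono2) (use GF v0 in \<open>auto simp: mid_def\<close>)
    finally show False using vG \<open>0 < N\<close> by simp
  qed
  then obtain i where i: "i < N" "(\<Sum>t\<in>mid i. v t) \<le> 3 / N" by blast
  have sub: "(\<Sum>t\<in>A. v t) * real 3 powr a_coeff k \<le> 4" if "A \<subseteq> G" for A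
  proof -
    have "(\<Sum>t\<in>A. v t) \<le> (\<Sum>t\<in>G. v t)" by (rule sum_mono2) (use GF v0 that in auto)
    then have "(\<Sum>t\<in>A. v t) \<le> 5 / 2" using vG by simp
    then have "(\<Sum>t\<in>A. v t) * real 3 powr a_coeff k \<le> (5 / 2) * (5 / 4)"
      by (intro mult_mono powr_a_coeff_le) auto
    then show ?thesis by simp
  qed
  have pull0: "pull 0 y A = A" if "A \<subseteq> T_space" for A using that by (auto simp: pull_def glue_def)
  have satT: "saturate n A \<subseteq> T_space" for n A by (auto simp: saturate_def)
  \<comment> \<open>\<open>C\<close> absorbs the early members and costs at most 4; \<open>D\<close>
    absorbs the middle ones and costs at most \<open>4 / N\<close>.\<close>
  define C where "C = (\<Union>t\<in>low i. saturate (cut i) (Y t))"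
  define D where "D = (\<Union>t\<in>mid i. saturate (cut (Suc i)) (Y t))"
  have "C = (\<Union>t\<in>low i. pull 0 y (saturate (cut i) (Y t)))" by (simp add: C_def pull0 satT)
  then have "phi ?C C \<le> ennreal ((\<Sum>t\<in>low i. v t) * real 3 powr a_coeff k)"
    using phi_transfer[OF _ _ y, where G = "low i" and Y = Y and I = J and w = v and c = 3 and d = 0] GF YC
    by (auto simp: low_def)
  also have "\<dots> \<le> ennreal 4" by (intro ennreal_leI sub) (auto simp: low_def)
  finally have phiC: "phi ?C C \<le> 4" by simp
  have "D = (\<Union>t\<in>mid i. pull 0 y (saturate (cut (Suc i)) (Y t)))" by (simp add: D_def pull0 satT)
  moreover have "nrm (J t) \<le> 3 * nrm (J t \<inter> {0..cut (Suc i)})" if "t \<in> mid i" for t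
  proof -
    have "3 * nrm (J t \<inter> {cut (Suc i)..L}) < nrm (J t)" using that by (auto simp: mid_def high_def)
    then show ?thesis using part[of t "cut (Suc i)"] by simp
  qed
  ultimately have "phi ?C D \<le> ennreal ((\<Sum>t\<in>mid i. v t) * real 3 powr a_coeff k)"
    using phi_transfer[OF _ _ y, where G = "mid i" and Y = Y and I = J and w = v and c = 3 and d = 0] GF YC
    by (auto simp: mid_def)
  also have "\<dots> \<le> ennreal (4 / N)"
  proof (rule ennreal_leI)
    have "(\<Sum>t\<in>mid i. v t) * real 3 powr a_coeff k \<le> (3 / N) * (5 / 4)"
      using i(2) by (intro mult_mono powr_a_coeff_le) auto
    also have "\<dots> \<le> 4 / N" using \<open>0 < N\<close> by (simp add: field_simps)
    finally show "(\<Sum>t\<in>mid i. v t) * real 3 powr a_coeff k \<le> 4 / N" .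
  qed
  finally have phiD: "phi ?C D \<le> ennreal (4 / N)" .
  define H where "H = {x \<in> T_space. \<forall>j<m. x j = y j} - C"
  have "cut 0 \<le> cut i" using cut by (simp add: monoD)
  then have HB: "H \<in> Balg_at (cut i)" unfolding H_def C_def
    using cylinder_in_Balg_at[of m y] Balg_at_mono[of m "cut i"] saturate_in_Balg_at
    by (intro Balg_at_Diff Balg_at_Union) (auto simp: m_def)
  \<comment> \<open>\<open>C\<close> does not depend on coordinates below \<open>m\<close>, so the
    pullback of \<open>H\<close> to \<open>T_space\<close> is the full complement of
    \<open>C\<close>.\<close>
  have Cinv: "z' \<in> C" if z: "z \<in> C" "z' \<in> T_space" "\<forall>i\<ge>m. z' i = z i" for z z'
  proof -
    obtain t x where t: "t \<in> low i" "x \<in> Y t" "\<forall>j<cut i. x j = z j" using z(1) by (auto simp: C_def saturate_def)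
    have xT: "x \<in> T_space" using t(2) by (simp add: Y_def pull_def)
    have "glue m z' x \<in> Y t"
      by (rule Yinv[OF t(2) glue_in_T_space[OF z(2) xT]]) (simp add: glue_def)
    moreover have "\<forall>j<cut i. glue m z' x j = z' j" using t(3) z(3) by (simp add: glue_def)
    ultimately show ?thesis using t(1) z(2) unfolding C_def saturate_def by blast
  qed
  have "pull m y H = T_space - C"
  proof -
    have "glue m y z \<in> C \<longleftrightarrow> z \<in> C" if "z \<in> T_space" for z
      using Cinv[of "glue m y z" z] Cinv[of z "glue m y z"] that glue_in_T_space[OF y that]
      by (auto simp: glue_def)
    then show ?thesis using glue_in_T_space[OF y] by (auto simp: pull_def H_def) (auto simp: glue_def)
  qed
  moreover have "2 \<le> phi ?C (T_space - C)"
  proof (rule leI, rule notI)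
    assume less: "phi ?C (T_space - C) < 2"
    have "8 \<le> phi ?C T_space" by (rule eight_le_phi)
    also have "\<dots> \<le> phi ?C (C \<union> (T_space - C))" by (rule phi_mono) auto
    also have "\<dots> \<le> phi ?C C + phi ?C (T_space - C)" by (rule phi_Un)
    also have "\<dots> \<le> 4 + 2" using phiC less by (intro add_mono) auto
    finally have "(8::ennreal) \<le> 6" by simp
    then show False by simp
  qed
  ultimately have hole: "2 \<le> phi ?C (pull (cut 0) y H)" by (simp add: m_def)
  \<comment> \<open>A point of \<open>E i \<inter> H\<close> outside \<open>D\<close> could be
    altered from \<open>cut (Suc i)\<close> on so as to evade the late members. It would stay in
    \<open>E i\<close>, with no member of the cover left to contain it.\<close>
  have "E i \<inter> H \<subseteq> D"
  proof
    fix x assume x: "x \<in> E i \<inter> H"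
    have xT: "x \<in> T_space" using x by (auto simp: H_def)
    let ?d = "cut (Suc i)"
    have ci: "cut i \<le> ?d" "m \<le> ?d" using cut by (auto simp: monoD m_def)
    show "x \<in> D"
    proof (rule ccontr)
      assume xD: "x \<notin> D"
      have "phi ?C (\<Union>t\<in>high i. pull ?d x (saturate L (Y t))) \<le> ennreal ((\<Sum>t\<in>high i. v t) * real 3 powr a_coeff k)"
        using phi_transfer[OF _ _ xT, where G = "high i" and Y = Y and I = J and w = v and c = 3 and d = ?d] GF YC
        by (auto simp: high_def)
      also have "\<dots> \<le> ennreal 4" by (intro ennreal_leI sub) (auto simp: high_def)
      also have "\<dots> < ennreal 8" by (intro ennreal_lessI) auto
      also have "\<dots> \<le> phi ?C T_space" using eight_le_phi by simp
      finally have "\<not> T_space \<subseteq> (\<Union>t\<in>high i. pull ?d x (saturate L (Y t)))"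
        using phi_mono by (meson leD)
      then obtain z where z: "z \<in> T_space" "z \<notin> (\<Union>t\<in>high i. pull ?d x (saturate L (Y t)))" by blast
      define w where "w = glue ?d x z"
      have wT: "w \<in> T_space" unfolding w_def by (rule glue_in_T_space[OF xT z(1)])
      have wx: "w j = x j" if "j < ?d" for j using that by (simp add: w_def glue_def)
      have "w \<in> E i" by (rule Balg_atD[OF E[OF i(1)], of x]) (use x wT wx in auto)
      moreover have "glue (cut 0) y w = w"
      proof
        fix j show "glue (cut 0) y w j = w j"
          using x wx[of j] ci(2) by (cases "j < m") (auto simp: glue_def H_def m_def)
      qed
      ultimately have "w \<in> ?X" using wT i(1) by (auto simp: pull_def)
      then obtain t where t: "t \<in> G" "w \<in> Y t" using XY by blast
      have "x \<in> saturate a (Y t)" if "a \<le> ?d" for a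
        using t(2) xT wx that unfolding saturate_def by (auto intro!: bexI[of _ w])
      then have "t \<notin> low i" "t \<notin> mid i" using x xD ci(1) by (auto simp: C_def D_def H_def)
      then have "t \<in> high i" using t(1) by (simp add: mid_def)
      moreover have "z \<in> pull ?d x (saturate L (Y t))"
        using t(2) z(1) wT by (auto simp: pull_def saturate_def w_def)
      ultimately show False using z(2) by blast
    qed
  qed
  then have "phi ?C (E i \<inter> H) \<le> ennreal (4 / N)" using phiD phi_mono order_trans by blast
  moreover have "\<forall>x\<in>H. \<forall>j<cut 0. x j = y j" by (auto simp: H_def m_def)
  ultimately show ?thesis using i(1) HB hole by blast
qed

end

section \<open>The limit submeasures\<close>

locale talagrand = spread_norm +
  fixes U :: "nat filter"
  assumes U: "nonprincipal_ultrafilter U"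
begin

lemma U_not_bot: "U \<noteq> bot"
  using U by (simp add: nonprincipal_ultrafilter_def)

lemma eventually_U_ge: "eventually (\<lambda>p. k \<le> p) U"
proof -
  have "eventually (\<lambda>p. \<forall>n\<in>{..<k}. p \<noteq> n) U"
    using U by (intro eventually_ball_finite) (auto simp: nonprincipal_ultrafilter_def)
  then show ?thesis by (rule eventually_mono) (metis lessThan_iff not_le)
qed

lemma nu_tendsto: "((\<lambda>p. nu_fin nrm k p X) \<longlongrightarrow> nu U nrm k X) U"
  unfolding nu_def by (rule tendsto_Lim_ultrafilter[OF U])

lemma nu_mono: "X \<subseteq> Y \<Longrightarrow> nu U nrm k X \<le> nu U nrm k Y"
  by (rule tendsto_le[OF U_not_bot nu_tendsto nu_tendsto]) (simp add: nu_fin_def phi_mono)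

lemma nu_Un: "nu U nrm k (X \<union> Y) \<le> nu U nrm k X + nu U nrm k Y"
  by (rule tendsto_le[OF U_not_bot tendsto_add[OF nu_tendsto nu_tendsto] nu_tendsto])
     (simp add: nu_fin_def phi_Un)

lemma nu_empty: "nu U nrm k {} = 0"
  using nu_tendsto[of k "{}"] U_not_bot by (simp add: nu_fin_def phi_empty tendsto_const_iff)

lemma nu_le: "eventually (\<lambda>p. nu_fin nrm k p X \<le> c) U \<Longrightarrow> nu U nrm k X \<le> c"
  by (rule tendsto_upperbound[OF nu_tendsto _ U_not_bot])

lemma nu_ge: "eventually (\<lambda>p. c \<le> nu_fin nrm k p X) U \<Longrightarrow> c \<le> nu U nrm k X"
  by (rule tendsto_lowerbound[OF nu_tendsto _ U_not_bot])

text \<open>The bound \<open>8 \<le> c_low k\<close> is uniform in \<open>p\<close> and passes to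
  the limit.\<close>

lemma nu_cylinder_ge:
  assumes "D \<in> S" "u \<in> T_space"
  shows "1 \<le> nu U nrm k {x \<in> T_space. \<forall>i\<in>D. x i = u i}"
proof (rule nu_ge, rule always_eventually, rule allI)
  fix p
  have "ennreal 1 \<le> ennreal (c_low k)" using c_low_ge[of k] by (intro ennreal_leI) simp
  also have "\<dots> \<le> nu_fin nrm k p {x \<in> T_space. \<forall>i\<in>D. x i = u i}"
    unfolding nu_fin_def by (rule C_low_less_phi[OF assms])
  finally show "1 \<le> nu_fin nrm k p {x \<in> T_space. \<forall>i\<in>D. x i = u i}" by simp
qed

text \<open>
  If no hole exists, choose \<open>E 0, \<dots>, E (N - 1)\<close> successively, each meeting every candidate hole
  that was available before its choice; then the hole found in \<open>phi_hole\<close> gives a contradiction.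
\<close>

lemma hole_at_point:
  fixes \<delta> :: real
  assumes y: "y \<in> T_space" and "0 < \<delta>"
  shows "\<exists>N. \<forall>r V. V \<subseteq> Balg \<longrightarrow> rank_ge (\<omega> \<up> osucs N r) V \<longrightarrow>
    (\<exists>n\<ge>m. \<exists>H\<in>Balg_at n. (\<forall>x\<in>H. \<forall>j<m. x j = y j) \<and> 1 < nu U nrm k (pull m y H) \<and>
      (\<exists>V'\<subseteq>V. rank_ge (\<omega> \<up> r) V' \<and> (\<forall>E\<in>V'. nu U nrm k (E \<inter> H) \<le> ennreal \<delta>)))"
proof -
  let ?\<nu> = "nu U nrm k"
  obtain N :: nat where N: "4 / \<delta> < N" using reals_Archimedean2 by blast
  then have N0: "0 < N" using \<open>0 < \<delta>\<close> by (metis divide_pos_pos gr0I of_nat_0 order_less_asym zero_less_numeral)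
  have N4: "4 / N < \<delta>" using N N0 \<open>0 < \<delta>\<close> by (simp add: field_simps)
  define good where "good n H \<longleftrightarrow> H \<in> Balg_at n \<and> (\<forall>x\<in>H. \<forall>j<m. x j = y j) \<and> 1 < ?\<nu> (pull m y H)" for n H
  have "\<exists>n\<ge>m. \<exists>H. good n H \<and> (\<exists>V'\<subseteq>V. rank_ge (\<omega> \<up> r) V' \<and> (\<forall>E\<in>V'. ?\<nu> (E \<inter> H) \<le> ennreal \<delta>))"
    if V: "V \<subseteq> Balg" "rank_ge (\<omega> \<up> osucs N r) V" for r V
  proof (rule ccontr)
    assume none: "\<not> ?thesis"
    \<comment> \<open>After \<open>i\<close> choices, \<open>V'\<close> contains only sets disjoint
      from those chosen. Each choice costs one of the \<open>N\<close> successors in the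
      exponent.\<close>
    define chain where "chain i E cut V' \<longleftrightarrow> cut 0 = m \<and> mono cut \<and> V' \<subseteq> V \<and> rank_ge (\<omega> \<up> osucs (N - i) r) V' \<and>
        (\<forall>i'<i. E i' \<in> Balg_at (cut (Suc i')) \<and> (\<forall>H. good (cut i') H \<longrightarrow> ennreal \<delta> < ?\<nu> (E i' \<inter> H)) \<and>
          (\<forall>E'\<in>V'. E' \<inter> E i' = {}))"
      for i and E :: "nat \<Rightarrow> (nat \<Rightarrow> nat) set" and cut :: "nat \<Rightarrow> nat" and V'
    have "\<exists>E cut V'. chain i E cut V'" if "i \<le> N" for i
      using that
    proof (induction i)
      case 0
      have "chain 0 (\<lambda>_. {}) (\<lambda>_. m) V" using V by (simp add: chain_def mono_def)
      then show ?case by blast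
    next
      case (Suc i)
      then obtain E cut V' where ch: "chain i E cut V'" by auto
      then have c: "cut 0 = m" "mono cut" "V' \<subseteq> V" "rank_ge (\<omega> \<up> osucs (N - i) r) V'"
        "\<And>i'. i' < i \<Longrightarrow> E i' \<in> Balg_at (cut (Suc i'))"
        "\<And>i' H. i' < i \<Longrightarrow> good (cut i') H \<Longrightarrow> ennreal \<delta> < ?\<nu> (E i' \<inter> H)"
        "\<And>i' E'. i' < i \<Longrightarrow> E' \<in> V' \<Longrightarrow> E' \<inter> E i' = {}"
        unfolding chain_def by blast+
      define W where "W = {E\<in>V'. \<forall>H. good (cut i) H \<longrightarrow> ennreal \<delta> < ?\<nu> (E \<inter> H)}"
      have "m \<le> cut i" using monoD[OF c(2), of 0 i] c(1) by simp
      \<comment> \<open>There are finitely many candidate holes at level \<open>cut i\<close>, and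
        the sets almost disjoint from any one of them have too small a rank. The colouring principle
        keeps the full rank on \<open>W\<close>.\<close>
      have "rank_ge (\<omega> \<up> osucs (N - i) r) W"
      proof (rule rank_ge_opow_UN[OF _ c(4)])
        show "finite {H. good (cut i) H}"
          by (rule finite_subset[OF _ finite_Balg_at[of "cut i"]]) (auto simp: good_def)
        show "V' \<subseteq> W \<union> (\<Union>H\<in>{H. good (cut i) H}. {E\<in>V'. ?\<nu> (E \<inter> H) \<le> ennreal \<delta>})"
          by (auto simp: W_def not_less)
        show "\<not> rank_ge (\<omega> \<up> osucs (N - i) r) {E\<in>V'. ?\<nu> (E \<inter> H) \<le> ennreal \<delta>}" if "H \<in> {H. good (cut i) H}" for H
        proof
          assume "rank_ge (\<omega> \<up> osucs (N - i) r) {E\<in>V'. ?\<nu> (E \<inter> H) \<le> ennreal \<delta>}"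
          then have "rank_ge (\<omega> \<up> r) {E\<in>V'. ?\<nu> (E \<inter> H) \<le> ennreal \<delta>}"
            by (rule rank_ge_mono) (auto intro: opow_mono one_le_omega osucs_le)
          moreover have "{E\<in>V'. ?\<nu> (E \<inter> H) \<le> ennreal \<delta>} \<subseteq> V" using c(3) by blast
          ultimately have "\<exists>V'\<subseteq>V. rank_ge (\<omega> \<up> r) V' \<and> (\<forall>E\<in>V'. ?\<nu> (E \<inter> H) \<le> ennreal \<delta>)" by blast
          then show False using none \<open>m \<le> cut i\<close> that by blast
        qed
      qed
      moreover have "\<omega> \<up> osucs (N - Suc i) r < \<omega> \<up> osucs (N - i) r"
        using opow_less_osuc[of "osucs (N - Suc i) r"] Suc.prems
        by (metis Suc_diff_Suc Suc_le_lessD comp_apply funpow.simps(2))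
      ultimately obtain e where e: "e \<in> W" "rank_ge (\<omega> \<up> osucs (N - Suc i) r) (perp W e)"
        using rank_geD by blast
      have "e \<in> Balg" using e(1) c(3) V(1) by (auto simp: W_def)
      then obtain n where n: "e \<in> Balg_at n" by (auto simp: Balg_def)
      define q where "q = max n (cut i)"
      have eq: "e \<in> Balg_at q" using n Balg_at_mono[of n q] by (auto simp: q_def)
      let ?cut = "\<lambda>j. if j \<le> i then cut j else q"
      have "mono ?cut" using c(2) by (auto simp: mono_def q_def intro: le_max_iff_disj[THEN iffD2])
      moreover have "perp W e \<subseteq> V'" by (auto simp: perp_def W_def)
      ultimately have "chain (Suc i) (E(i := e)) ?cut (perp W e)"
        unfolding chain_def using c e eq
        by (auto simp: less_Suc_eq perp_def W_def)
      then show ?case by blast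
    qed
    then obtain E cut V' where "chain N E cut V'" by blast
    then have c: "cut 0 = m" "mono cut" "V' \<subseteq> V" "rank_ge (\<omega> \<up> r) V'"
        "\<And>i'. i' < N \<Longrightarrow> E i' \<in> Balg_at (cut (Suc i'))"
        "\<And>i' H. i' < N \<Longrightarrow> good (cut i') H \<Longrightarrow> ennreal \<delta> < ?\<nu> (E i' \<inter> H)"
        "\<And>i' E'. i' < N \<Longrightarrow> E' \<in> V' \<Longrightarrow> E' \<inter> E i' = {}"
      unfolding chain_def by (simp; blast)+
    have mN: "m \<le> cut N" using monoD[OF c(2), of 0 N] c(1) by simp
    define Z where "Z = (\<Union>i<N. E i)"
    have ZB: "Z \<in> Balg_at (cut N)" unfolding Z_def
    proof (rule Balg_at_Union, rule image_subsetI)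
      fix i assume "i \<in> {..<N}"
      then show "E i \<in> Balg_at (cut N)"
        using c(5)[of i] Balg_at_mono[OF monoD[OF c(2), of "Suc i" N]] by auto
    qed
    define H where "H = Z \<inter> {x \<in> T_space. \<forall>j<m. x j = y j}"
    have "pull m y H = pull m y Z"
      using glue_in_T_space[OF y] by (auto simp: pull_def H_def) (auto simp: glue_def)
    have HB: "H \<in> Balg_at (cut N)" unfolding H_def
      using cylinder_in_Balg_at[of m y] Balg_at_mono[OF mN] by (intro Balg_at_Int ZB) auto
    \<comment> \<open>Otherwise \<open>Z\<close> inside the atom of \<open>y\<close> is itself a
      hole, and every member of \<open>V'\<close> is disjoint from it.\<close>
    have "?\<nu> (pull m y Z) \<le> 1"
    proof (rule leI, rule notI)
      assume "1 < ?\<nu> (pull m y Z)"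
      then have "good (cut N) H" using HB \<open>pull m y H = pull m y Z\<close> by (auto simp: good_def H_def)
      moreover have "?\<nu> (E' \<inter> H) \<le> ennreal \<delta>" if "E' \<in> V'" for E'
      proof -
        have "E' \<inter> H = {}" using c(7)[OF _ that] by (auto simp: H_def Z_def)
        then show ?thesis by (simp add: nu_empty)
      qed
      ultimately show False using none mN c(3,4) by blast
    qed
    then have "?\<nu> (pull m y Z) < 2" by (rule order_le_less_trans) simp
    then have ev1: "eventually (\<lambda>p. nu_fin nrm k p (pull m y Z) < 2) U"
      using order_tendstoD(2)[OF nu_tendsto] by blast
    \<comment> \<open>\<open>Balg_at (cut N)\<close> is finite, so one \<open>p\<close> serves all
      its members at once. The margin between 1 and 2 leaves room for passing from the limit to
      \<open>p\<close>.\<close>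
    have ev2: "eventually (\<lambda>p. \<forall>H\<in>Balg_at (cut N). ?\<nu> H \<le> 1 \<longrightarrow> nu_fin nrm k p H < 2) U"
    proof (intro eventually_ball_finite finite_Balg_at ballI)
      fix H
      show "eventually (\<lambda>p. ?\<nu> H \<le> 1 \<longrightarrow> nu_fin nrm k p H < 2) U"
      proof (cases "?\<nu> H \<le> 1")
        case True
        then have "?\<nu> H < 2" by (rule order_le_less_trans) simp
        then show ?thesis using order_tendstoD(2)[OF nu_tendsto] True by (auto elim: eventually_mono)
      qed simp
    qed
    have ev3: "eventually (\<lambda>p. \<forall>H\<in>Balg_at (cut N). ennreal \<delta> < ?\<nu> H \<longrightarrow> ennreal \<delta> < nu_fin nrm k p H) U"
    proof (intro eventually_ball_finite finite_Balg_at ballI)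
      fix H
      show "eventually (\<lambda>p. ennreal \<delta> < ?\<nu> H \<longrightarrow> ennreal \<delta> < nu_fin nrm k p H) U"
      proof (cases "ennreal \<delta> < ?\<nu> H")
        case True
        then show ?thesis using order_tendstoD(1)[OF nu_tendsto] by (auto elim: eventually_mono)
      qed simp
    qed
    obtain p where p: "nu_fin nrm k p (pull m y Z) < 2"
      "\<forall>H\<in>Balg_at (cut N). ?\<nu> H \<le> 1 \<longrightarrow> nu_fin nrm k p H < 2"
      "\<forall>H\<in>Balg_at (cut N). ennreal \<delta> < ?\<nu> H \<longrightarrow> ennreal \<delta> < nu_fin nrm k p H"
      using eventually_happens'[OF U_not_bot eventually_conj[OF ev1 eventually_conj[OF ev2 ev3]]] by blast
    obtain i H' where iH: "i < N" "H' \<in> Balg_at (cut i)" "\<forall>x\<in>H'. \<forall>j<m. x j = y j"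
      "2 \<le> nu_fin nrm k p (pull m y H')" "nu_fin nrm k p (E i \<inter> H') \<le> ennreal (4 / N)"
      using phi_hole[OF y N0 c(2), of E k p] c(5) p(1) unfolding nu_fin_def Z_def c(1) by blast
    have cN: "Balg_at (cut j) \<subseteq> Balg_at (cut N)" if "j \<le> N" for j
      by (intro Balg_at_mono monoD[OF c(2)] that)
    have "H' \<in> Balg_at (cut N)" using iH cN[of i] by auto
    then have "\<not> ?\<nu> (pull m y H') \<le> 1" using p(2) pull_in_Balg_at[OF _ y] iH(4) by (meson leD)
    then have "good (cut i) H'" using iH by (simp add: good_def)
    then have "ennreal \<delta> < ?\<nu> (E i \<inter> H')" using c(6) iH(1) by blast
    moreover have "E i \<inter> H' \<in> Balg_at (cut N)"
      using c(5)[OF iH(1)] cN[of "Suc i"] iH(1) \<open>H' \<in> Balg_at (cut N)\<close> by (intro Balg_at_Int) auto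
    ultimately have "ennreal \<delta> < ennreal (4 / N)" using p(3) iH(5) by (meson order_less_le_trans)
    then show False using N4 \<open>0 < \<delta>\<close> by (simp add: ennreal_less_iff)
  qed
  note * = this
  show ?thesis
  proof (rule exI[of _ N], intro allI impI)
    fix r V assume "V \<subseteq> Balg" "rank_ge (\<omega> \<up> osucs N r) V"
    from *[OF this] obtain n H V' where "m \<le> n" "good n H" "V' \<subseteq> V" "rank_ge (\<omega> \<up> r) V'"
      "\<forall>E\<in>V'. ?\<nu> (E \<inter> H) \<le> ennreal \<delta>" by blast
    then show "\<exists>n\<ge>m. \<exists>H\<in>Balg_at n. (\<forall>x\<in>H. \<forall>j<m. x j = y j) \<and> 1 < ?\<nu> (pull m y H) \<and>
        (\<exists>V'\<subseteq>V. rank_ge (\<omega> \<up> r) V' \<and> (\<forall>E\<in>V'. ?\<nu> (E \<inter> H) \<le> ennreal \<delta>))"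
      unfolding good_def by blast
  qed
qed

lemma finite_stems: "finite (stems m)"
proof (rule finite_subset)
  have *: "2 ^ k \<le> (2::nat) ^ m" if "k < m" for k using that by (intro power_increasing) auto
  show "stems m \<subseteq> {u. dom u = {..<m} \<and> ran u \<subseteq> {..<2 ^ m}}"
  proof
    fix u assume u: "u \<in> stems m"
    have "v < 2 ^ m" if "u k = Some v" for k v
    proof -
      have "k \<in> dom u" using that by blast
      then have "k < m" "the (u k) < 2 ^ k" using u by (simp_all add: stems_def)
      then have "the (u k) < 2 ^ m" using *[of k] by linarith
      then show ?thesis using that by simp
    qed
    then show "u \<in> {u. dom u = {..<m} \<and> ran u \<subseteq> {..<2 ^ m}}" using u by (auto simp: stems_def ran_def)
  qed
qed (rule finite_set_of_finite_maps; simp)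

text \<open>The atoms of level \<open>m\<close> are treated one after another, each time in a
  subfamily. Holes are united, the allowed error is shared, and the numbers of successors add
  up.\<close>

lemma hole_layer:
  fixes \<delta> :: real
  assumes "0 < \<delta>"
  shows "\<exists>N. \<forall>r V. V \<subseteq> Balg \<longrightarrow> rank_ge (\<omega> \<up> osucs N r) V \<longrightarrow>
    (\<exists>n>m. \<exists>H\<in>Balg_at n. thin_at (nu U nrm k) m n (T_space - H) \<and>
      (\<exists>V'\<subseteq>V. rank_ge (\<omega> \<up> r) V' \<and> (\<forall>E\<in>V'. nu U nrm k (E \<inter> H) \<le> ennreal \<delta>)))"
proof -
  let ?\<nu> = "nu U nrm k"
  obtain Y where Y: "finite Y" "Y \<subseteq> T_space" "stems m = (\<lambda>y. stem y m) ` Y"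
    using finite_subset_image[OF finite_stems[of m], of "\<lambda>y. stem y m" T_space] stems_eq[of m] by auto
  define hole where "hole n H A \<longleftrightarrow> (\<forall>y\<in>A. \<exists>H'\<in>Balg_at n. H' \<subseteq> H \<and> (\<forall>x\<in>H'. \<forall>j<m. x j = y j) \<and> 1 < ?\<nu> (pull m y H'))"
    for n H and A :: "(nat \<Rightarrow> nat) set"
  have hole_mono: "hole n' H' A" if "hole n H A" "n \<le> n'" "H \<subseteq> H'" for n n' H H' A
    using that Balg_at_mono[OF that(2)] unfolding hole_def by (meson order_trans subsetD)
  have "\<exists>N. \<forall>r V. V \<subseteq> Balg \<longrightarrow> rank_ge (\<omega> \<up> osucs N r) V \<longrightarrow>
      (\<exists>n>m. \<exists>H\<in>Balg_at n. hole n H Y \<and> (\<exists>V'\<subseteq>V. rank_ge (\<omega> \<up> r) V' \<and> (\<forall>E\<in>V'. ?\<nu> (E \<inter> H) \<le> ennreal \<delta>)))"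
    using Y(1,2) assms
  proof (induction Y arbitrary: \<delta>)
    case empty
    show ?case
    proof (rule exI[of _ 0], intro allI impI)
      fix r and V :: "(nat \<Rightarrow> nat) set set"
      assume "rank_ge (\<omega> \<up> osucs 0 r) V"
      moreover have "{} \<in> Balg_at (Suc m)" "hole (Suc m) {} {}" by (simp_all add: hole_def Balg_at_def)
      moreover have "\<forall>E\<in>V. ?\<nu> (E \<inter> {}) \<le> ennreal \<delta>" by (simp add: nu_empty)
      ultimately show "\<exists>n>m. \<exists>H\<in>Balg_at n. hole n H {} \<and>
          (\<exists>V'\<subseteq>V. rank_ge (\<omega> \<up> r) V' \<and> (\<forall>E\<in>V'. ?\<nu> (E \<inter> H) \<le> ennreal \<delta>))"
        using lessI[of m] by (metis funpow_0 subset_refl)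
    qed
  next
    case (insert y Y)
    obtain N1 where N1: "\<And>r V. V \<subseteq> Balg \<Longrightarrow> rank_ge (\<omega> \<up> osucs N1 r) V \<Longrightarrow>
      \<exists>n>m. \<exists>H\<in>Balg_at n. hole n H Y \<and> (\<exists>V'\<subseteq>V. rank_ge (\<omega> \<up> r) V' \<and> (\<forall>E\<in>V'. ?\<nu> (E \<inter> H) \<le> ennreal (\<delta> / 2)))"
      using insert.IH[of "\<delta> / 2"] insert.prems by auto
    obtain N2 where N2: "\<And>r V. V \<subseteq> Balg \<Longrightarrow> rank_ge (\<omega> \<up> osucs N2 r) V \<Longrightarrow>
      \<exists>n\<ge>m. \<exists>H\<in>Balg_at n. (\<forall>x\<in>H. \<forall>j<m. x j = y j) \<and> 1 < ?\<nu> (pull m y H) \<and>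
      (\<exists>V'\<subseteq>V. rank_ge (\<omega> \<up> r) V' \<and> (\<forall>E\<in>V'. ?\<nu> (E \<inter> H) \<le> ennreal (\<delta> / 2)))"
      using hole_at_point[of y "\<delta> / 2" m k] insert.prems by auto
    show ?case
    proof (rule exI[of _ "N1 + N2"], intro allI impI)
      fix r V assume V: "V \<subseteq> Balg" "rank_ge (\<omega> \<up> osucs (N1 + N2) r) V"
      then have "rank_ge (\<omega> \<up> osucs N1 (osucs N2 r)) V" by (simp add: funpow_add)
      from N1[OF V(1) this] obtain n1 H1 V1 where 1: "m < n1" "H1 \<in> Balg_at n1" "hole n1 H1 Y" "V1 \<subseteq> V"
        "rank_ge (\<omega> \<up> osucs N2 r) V1" "\<forall>E\<in>V1. ?\<nu> (E \<inter> H1) \<le> ennreal (\<delta> / 2)" by blast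
      have "V1 \<subseteq> Balg" using 1(4) V(1) by blast
      from N2[OF this 1(5)] obtain n2 H2 V2 where 2: "m \<le> n2" "H2 \<in> Balg_at n2" "\<forall>x\<in>H2. \<forall>j<m. x j = y j"
        "1 < ?\<nu> (pull m y H2)" "V2 \<subseteq> V1" "rank_ge (\<omega> \<up> r) V2" "\<forall>E\<in>V2. ?\<nu> (E \<inter> H2) \<le> ennreal (\<delta> / 2)" by blast
      define n where "n = max n1 n2"
      have B: "H1 \<in> Balg_at n" "H2 \<in> Balg_at n"
        using 1(2) 2(2) Balg_at_mono[of n1 n] Balg_at_mono[of n2 n] by (auto simp: n_def)
      have "hole n (H1 \<union> H2) Y" by (rule hole_mono[OF 1(3)]) (auto simp: n_def)
      moreover have "hole n (H1 \<union> H2) {y}" unfolding hole_def using B 2 by blast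
      ultimately have "hole n (H1 \<union> H2) (insert y Y)" by (simp add: hole_def)
      moreover have "?\<nu> (E \<inter> (H1 \<union> H2)) \<le> ennreal \<delta>" if "E \<in> V2" for E
      proof -
        have "?\<nu> (E \<inter> (H1 \<union> H2)) \<le> ?\<nu> (E \<inter> H1) + ?\<nu> (E \<inter> H2)"
          unfolding Int_Un_distrib by (rule nu_Un)
        also have "\<dots> \<le> ennreal (\<delta> / 2) + ennreal (\<delta> / 2)" using 1(6) 2(5,7) that by (intro add_mono) auto
        also have "\<dots> = ennreal \<delta>" using insert.prems by (subst ennreal_plus[symmetric]) auto
        finally show ?thesis .
      qed
      moreover have "V2 \<subseteq> V" using 1(4) 2(5) by blast
      moreover have "m < n" using 1(1) by (simp add: n_def)
      ultimately show "\<exists>n>m. \<exists>H\<in>Balg_at n. hole n H (insert y Y) \<and>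
          (\<exists>V'\<subseteq>V. rank_ge (\<omega> \<up> r) V' \<and> (\<forall>E\<in>V'. ?\<nu> (E \<inter> H) \<le> ennreal \<delta>))"
        using B 2(6) Balg_at_Un by blast
    qed
  qed
  moreover have "thin_at ?\<nu> m n (T_space - H)" if h: "hole n H Y" for n H
    unfolding thin_at_iff
  proof
    fix y assume "y \<in> T_space"
    then obtain y0 where y0: "y0 \<in> Y" "stem y m = stem y0 m" using Y(3) stems_eq[of m] by (metis imageE imageI)
    have eq: "y j = y0 j" if "j < m" for j using fun_cong[OF y0(2), of j] that by (simp add: stem_def)
    then have "glue m y = glue m y0" by (auto simp: glue_def fun_eq_iff)
    then have "pull m y A = pull m y0 A" for A by (simp add: pull_def)
    then show "\<exists>H'\<in>Balg_at n. (\<forall>x\<in>H'. x \<notin> T_space - H \<and> (\<forall>i<m. x i = y i)) \<and> 1 < ?\<nu> (pull m y H')"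
      using h y0(1) eq unfolding hole_def by (metis Diff_iff subsetD)
  qed
  ultimately show ?thesis by metis
qed

end

section \<open>The upper bound\<close>

lemma thin_at_mono_right: "thin_at \<phi> m n X \<Longrightarrow> n \<le> n' \<Longrightarrow> X' \<subseteq> X \<Longrightarrow> thin_at \<phi> m n' X'"
  unfolding thin_at_iff using Balg_at_mono[of n n'] by (meson subsetD)

lemma thin_subset: "thin \<phi> I X \<Longrightarrow> J \<subseteq> I \<Longrightarrow> thin \<phi> J X"
  by (auto simp: thin_def)

context
  fixes lt :: "nat \<Rightarrow> omega1 \<Rightarrow> omega1 \<Rightarrow> bool" and \<alpha> :: omega1 and U :: "nat filter"
  assumes lt: "schreier_orderings lt" and \<alpha>: "0 < \<alpha>" and U: "nonprincipal_ultrafilter U"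
begin

interpretation talagrand "schreier lt \<alpha>" "schreier_norm lt \<alpha>" U
  using spread_norm_schreier[OF lt \<alpha>] U by (simp add: talagrand_def talagrand_axioms_def)

abbreviation "\<nu> \<equiv> nu U (schreier_norm lt \<alpha>)"

text \<open>\<open>ys\<close> lists the index set built so far, and \<gamma> bounds the ordinals of
  its witnesses. Each new index lowers the bound, and the drop in rank pays for the required hole.
  The recursion ends when the norm exceeds \<open>L\<close>; each step uses half of the remaining
  error.\<close>

lemma thin_of_large_norm:
  fixes \<delta> :: real
  assumes "ys \<noteq> []" "sorted_wrt (>) ys" "X \<in> Balg" "thin (\<nu> k) (set ys) X"
    and "V \<subseteq> Balg" "rank_ge (\<omega> \<up> (\<omega> * \<gamma>)) V"
    and "\<forall>v\<in>wits lt \<alpha> L ys. lexrank (osuc \<alpha>) L v < \<gamma>"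
    and "\<forall>E\<in>V. \<nu> k (E - X) \<le> \<eta>" "0 < \<delta>"
  shows "\<exists>I X' E. finite I \<and> thin (\<nu> k) I X' \<and> L < schreier_norm lt \<alpha> I \<and> X' \<in> Balg \<and> E \<in> V \<and>
    \<nu> k (E - X') \<le> \<eta> + ennreal \<delta>"
  using assms
proof (induction \<gamma> arbitrary: ys X V \<eta> \<delta> rule: less_induct)
  case (less \<gamma>)
  show ?case
  proof (cases "L < schreier_norm lt \<alpha> (set ys)")
    case True
    have "0 < \<omega> \<up> (\<omega> * \<gamma>)"
      using one_le_opow[of \<omega> "\<omega> * \<gamma>"] by (simp add: one_omega1_eq osuc_le_iff)
    then obtain E where "E \<in> V" using rank_geD[OF less.prems(6)] by blast
    moreover have "\<nu> k (E - X) \<le> \<eta> + ennreal \<delta>"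
      using less.prems(8) \<open>E \<in> V\<close> by (meson add_increasing2 zero_le)
    ultimately show ?thesis using True less.prems(3,4) by (meson List.finite_set)
  next
    case False
    define W where "W = lexrank (osuc \<alpha>) L ` wits lt \<alpha> L ys"
    have W: "finite W" "W \<noteq> {}"
      using finite_wits[OF lt] wits_nonempty_norm[OF lt \<alpha> less.prems(2), of L] False by (auto simp: W_def)
    \<comment> \<open>The next bound: every witness for a longer list extends a current one and has
      a strictly smaller ordinal.\<close>
    define \<mu> where "\<mu> = Max W"
    have "\<mu> \<in> W" unfolding \<mu>_def using W by simp
    then have \<mu>: "\<mu> < \<gamma>" using less.prems(7) by (auto simp: W_def)
    obtain m xs where ys: "ys = m # xs" using less.prems(1) by (cases ys) auto
    obtain N where N: "\<And>r V. V \<subseteq> Balg \<Longrightarrow> rank_ge (\<omega> \<up> osucs N r) V \<Longrightarrow>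
      \<exists>n>m. \<exists>H\<in>Balg_at n. thin_at (\<nu> k) m n (T_space - H) \<and>
        (\<exists>V'\<subseteq>V. rank_ge (\<omega> \<up> r) V' \<and> (\<forall>E\<in>V'. \<nu> k (E \<inter> H) \<le> ennreal (\<delta> / 2)))"
      using hole_layer[of "\<delta> / 2" m k] less.prems(9) by auto
    have "rank_ge (\<omega> \<up> osucs N (\<omega> * \<mu>)) V"
      by (rule rank_ge_mono[OF less.prems(6)])
         (auto intro: opow_mono one_le_omega less_imp_le osucs_times_omega_less \<mu>)
    from N[OF less.prems(5) this] obtain n H V' where n: "m < n" "H \<in> Balg_at n"
      "thin_at (\<nu> k) m n (T_space - H)" "V' \<subseteq> V" "rank_ge (\<omega> \<up> (\<omega> * \<mu>)) V'"
      "\<forall>E\<in>V'. \<nu> k (E \<inter> H) \<le> ennreal (\<delta> / 2)" by blast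
    define X' where "X' = X - H"
    obtain a where a: "X \<in> Balg_at a" using less.prems(3) by (auto simp: Balg_def)
    have "X' \<in> Balg_at (max a n)"
      unfolding X'_def using a n(2) Balg_at_mono[of a "max a n"] Balg_at_mono[of n "max a n"]
      by (intro Balg_at_Diff) auto
    then have X'B: "X' \<in> Balg" by (rule Balg_at_Balg)
    have X'T: "X' \<subseteq> T_space - H" using Balg_at_subset[OF a] by (auto simp: X'_def)
    have below: "i \<le> m" if "i \<in> set ys" for i using less.prems(2) that by (auto simp: ys)
    \<comment> \<open>Removing \<open>H\<close> makes the pair \<open>(m, n)\<close> thin; a pair
      \<open>(i, n)\<close> with \<open>i < m\<close> inherits its holes from
      \<open>(i, m)\<close>.\<close>
    have mn: "thin_at (\<nu> k) i n X'" if i: "i \<in> set ys" for i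
    proof (cases "i = m")
      case True
      then show ?thesis using n(3) X'T thin_at_mono_right by blast
    next
      case False
      then have "thin_at (\<nu> k) i m X" using less.prems(4) below[OF i] i by (auto simp: thin_def ys)
      then show ?thesis by (rule thin_at_mono_right) (use n(1) in \<open>auto simp: X'_def\<close>)
    qed
    have thin: "thin (\<nu> k) (set (n # ys)) X'"
      unfolding thin_def
    proof (intro ballI impI)
      fix i j assume ij: "i \<in> set (n # ys)" "j \<in> set (n # ys)" "i < j"
      have i: "i \<in> set ys" using ij below[of j] n(1) by auto
      show "thin_at (\<nu> k) i j X'"
      proof (cases "j = n")
        case True
        then show ?thesis using mn i by simp
      next
        case False
        then have "thin_at (\<nu> k) i j X" using ij i less.prems(4) by (auto simp: thin_def)
        then show ?thesis by (rule thin_at_mono_right) (auto simp: X'_def)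
      qed
    qed
    have "\<exists>I X'' E. finite I \<and> thin (\<nu> k) I X'' \<and> L < schreier_norm lt \<alpha> I \<and> X'' \<in> Balg \<and> E \<in> V' \<and>
        \<nu> k (E - X'') \<le> (\<eta> + ennreal (\<delta> / 2)) + ennreal (\<delta> / 2)"
    proof (rule less.IH[OF \<mu>, of "n # ys" X' V'])
      show "sorted_wrt (>) (n # ys)" using less.prems(2) below n(1) by (auto intro: order_le_less_trans)
      show "\<forall>v\<in>wits lt \<alpha> L (n # ys). lexrank (osuc \<alpha>) L v < \<mu>"
      proof
        fix v assume "v \<in> wits lt \<alpha> L (n # ys)"
        from wits_decreasing[OF lt this] obtain w where
          w: "w \<in> wits lt \<alpha> L ys" "lexrank (osuc \<alpha>) L v < lexrank (osuc \<alpha>) L w" by blast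
        have "lexrank (osuc \<alpha>) L w \<le> \<mu>" unfolding \<mu>_def using W w(1) by (intro Max_ge) (auto simp: W_def)
        then show "lexrank (osuc \<alpha>) L v < \<mu>" using w(2) by simp
      qed
      show "\<forall>E\<in>V'. \<nu> k (E - X') \<le> \<eta> + ennreal (\<delta> / 2)"
      proof
        fix E assume E: "E \<in> V'"
        have "\<nu> k (E - X') \<le> \<nu> k ((E - X) \<union> (E \<inter> H))" by (rule nu_mono) (auto simp: X'_def)
        also have "\<dots> \<le> \<nu> k (E - X) + \<nu> k (E \<inter> H)" by (rule nu_Un)
        also have "\<dots> \<le> \<eta> + ennreal (\<delta> / 2)" using less.prems(8) n(4,6) E by (intro add_mono) auto
        finally show "\<nu> k (E - X') \<le> \<eta> + ennreal (\<delta> / 2)" .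
      qed
    qed (use n X'B thin less.prems in auto)
    moreover have "(\<eta> + ennreal (\<delta> / 2)) + ennreal (\<delta> / 2) = \<eta> + ennreal \<delta>"
    proof -
      have "ennreal (\<delta> / 2) + ennreal (\<delta> / 2) = ennreal \<delta>"
        using less.prems(9) by (subst ennreal_plus[symmetric]) auto
      then show ?thesis by (simp add: add.assoc)
    qed
    ultimately show ?thesis using n(4) by (metis subsetD)
  qed
qed

text \<open>Finitely many strict inequalities are involved, so they all pass from the limit to
  \<open>U\<close>-almost all \<open>p\<close>.\<close>

lemma eventually_thin:
  assumes "finite I" "thin (\<nu> k) I X"
  shows "eventually (\<lambda>p. thin (nu_fin (schreier_norm lt \<alpha>) k p) I X) U"
  unfolding thin_def
proof (intro eventually_ball_finite assms(1) ballI)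
  fix m n assume mn: "m \<in> I" "n \<in> I"
  show "eventually (\<lambda>p. m < n \<longrightarrow> thin_at (nu_fin (schreier_norm lt \<alpha>) k p) m n X) U"
  proof (cases "m < n")
    case True
    then have at: "thin_at (\<nu> k) m n X" using assms(2) mn by (auto simp: thin_def)
    have "eventually (\<lambda>p. thin_at (nu_fin (schreier_norm lt \<alpha>) k p) m n X) U"
      unfolding thin_at_def
    proof (intro eventually_ball_finite finite_stems ballI)
      fix u assume "u \<in> stems m"
      then obtain H where H: "H \<in> Balg_at n" "H \<subseteq> cyl u - X" "1 < \<nu> k (T_space \<inter> proj u -` H)"
        using at unfolding thin_at_def by blast
      show "eventually (\<lambda>p. \<exists>H\<in>Balg_at n. H \<subseteq> cyl u - X \<and>
          1 < nu_fin (schreier_norm lt \<alpha>) k p (T_space \<inter> proj u -` H)) U"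
        using order_tendstoD(1)[OF nu_tendsto H(3)] by (rule eventually_mono) (use H in blast)
    qed
    then show ?thesis by (rule eventually_mono) simp
  qed simp
qed

lemma not_rank_ge:
  fixes e :: real
  assumes "0 < e"
  shows "\<not> rank_ge (\<omega> \<up> (\<omega> * ((\<alpha> + 1) \<up> \<omega>))) {a \<in> Balg. ennreal e \<le> nu_schreier U lt \<alpha> a}"
proof
  let ?n = "schreier_norm lt \<alpha>"
  assume rank_ge: "rank_ge (\<omega> \<up> (\<omega> * ((\<alpha> + 1) \<up> \<omega>))) {a \<in> Balg. ennreal e \<le> nu_schreier U lt \<alpha> a}"
    (is "rank_ge _ ?V")
  obtain k where k: "(1 / 2) ^ k < e / 2" using real_arch_pow_inv[of "e / 2" "1 / 2"] assms by auto
  \<comment> \<open>An index set of norm above \<open>L\<close> can be cut down to norm exactly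
    \<open>M_coeff k\<close>, where the least admissible weight is \<open>1 / 2 ^ k\<close>, below
    \<open>e / 2\<close>.\<close>
  define L where "L = M_coeff k - 1"
  have L: "Suc L = M_coeff k" by (simp add: L_def M_coeff_def)
  let ?\<gamma> = "osuc \<alpha> \<up> osucs L 0"
  have one: "1 \<le> osuc \<alpha>" by (simp add: one_omega1_eq)
  \<comment> \<open>The construction starts from the list \<open>[0]\<close> and the set
    \<open>T_space\<close>, with error 0. Initial witnesses have digits at most \<alpha>, hence
    ordinals below \<open>?\<gamma>\<close>.\<close>
  have "\<exists>I X' E. finite I \<and> thin (\<nu> (Suc k)) I X' \<and> L < ?n I \<and> X' \<in> Balg \<and> E \<in> ?V \<and>
      \<nu> (Suc k) (E - X') \<le> 0 + ennreal (e / 8)"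
  proof (rule thin_of_large_norm[of "[0]" T_space _ _ ?\<gamma>])
    show "rank_ge (\<omega> \<up> (\<omega> * ?\<gamma>)) ?V"
      by (rule rank_ge_mono[OF rank_ge])
         (auto simp: plus_omega1_one
           intro!: opow_mono one_le_omega times_omega1_mono one less_imp_le[OF osucs_less_omega])
    show "\<forall>v\<in>wits lt \<alpha> L [0]. lexrank (osuc \<alpha>) L v < ?\<gamma>"
    proof
      fix v assume v: "v \<in> wits lt \<alpha> L [0]"
      show "lexrank (osuc \<alpha>) L v < ?\<gamma>"
        by (rule lexrank_less) (simp add: less_osuc_iff wits_le[OF lt v])
    qed
    show "\<forall>E\<in>?V. \<nu> (Suc k) (E - T_space) \<le> 0"
    proof
      fix E assume "E \<in> ?V"
      then have "E - T_space = {}" using Balg_at_subset by (auto simp: Balg_def)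
      then show "\<nu> (Suc k) (E - T_space) \<le> 0" by (simp only: nu_empty order_refl)
    qed
  qed (use assms Balg_at_Balg[OF T_space_in_Balg_at] in \<open>auto simp: thin_def\<close>)
  then obtain I X E where I: "finite I" "thin (\<nu> (Suc k)) I X" "L < ?n I" "X \<in> Balg"
      "E \<in> ?V" "\<nu> (Suc k) (E - X) \<le> ennreal (e / 8)" by auto
  obtain J where J: "J \<subseteq> I" "?n J = M_coeff k"
    using subset_of_nrm[OF I(1), of "M_coeff k"] I(3) L by auto
  have finJ: "finite J" "J \<noteq> {}" using J I(1) L nrm_empty finite_subset by fastforce+
  have "\<nu> (Suc k) (E - X) < ennreal (e / 4)"
    using I(6) by (rule order_le_less_trans) (use assms in \<open>auto intro: ennreal_lessI\<close>)
  then have ev: "eventually (\<lambda>p. nu_fin ?n (Suc k) p (E - X) < ennreal (e / 4)) U"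
    by (rule order_tendstoD(2)[OF nu_tendsto])
  have "eventually (\<lambda>p. nu_fin ?n 0 p E \<le> ennreal ((1 / 2) ^ k + e / 4)) U"
    using ev eventually_thin[OF finJ(1) thin_subset[OF I(2) J(1)]] eventually_U_ge[of "Suc k"]
  proof eventually_elim
    case (elim p)
    have "(X, J, (1 / 2) ^ k) \<in> E_layer ?n k (phi (C_class ?n (Suc k) p))"
      using elim(2) finJ J(2) I(4) L unfolding E_layer_def nu_fin_def by (auto simp: power_divide)
    then have "(X, J, (1 / 2) ^ k) \<in> C_class ?n 0 p"
      unfolding C_class_iff using elim(3) by (auto intro!: exI[of _ k])
    then have "phi (C_class ?n 0 p) X \<le> ennreal ((1 / 2) ^ k)"
      using phi_le_sum[of "{()}" "\<lambda>_. X" "\<lambda>_. J" "\<lambda>_. (1 / 2) ^ k" "C_class ?n 0 p" X] by simp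
    \<comment> \<open>The error is measured at level \<open>Suc k\<close>; the class at level 0 is
      larger and its submeasure no greater.\<close>
    moreover have "phi (C_class ?n 0 p) (E - X) \<le> ennreal (e / 4)"
      using phi_antimono[OF C_class_antimono[of 0 "Suc k" ?n p], of "E - X"] elim(1)
      unfolding nu_fin_def by simp
    ultimately have "phi (C_class ?n 0 p) (X \<union> (E - X)) \<le> ennreal ((1 / 2) ^ k) + ennreal (e / 4)"
      using phi_Un[of "C_class ?n 0 p" X "E - X"] add_mono order_trans by blast
    moreover have "phi (C_class ?n 0 p) E \<le> phi (C_class ?n 0 p) (X \<union> (E - X))"
      by (rule phi_mono) auto
    moreover have "ennreal ((1 / 2) ^ k) + ennreal (e / 4) = ennreal ((1 / 2) ^ k + e / 4)"
      using assms by (subst ennreal_plus) auto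
    ultimately show ?case unfolding nu_fin_def by simp
  qed
  then have "\<nu> 0 E \<le> ennreal ((1 / 2) ^ k + e / 4)" by (rule nu_le)
  also have "\<dots> < ennreal e" using k assms by (intro ennreal_lessI) auto
  finally show False using I(5) by (auto simp: nu_schreier_def)
qed

text \<open>If the values did not tend to 0, the large members of every tail would have every rank,
  since any of them is followed by a tail disjoint from it. This contradicts
  \<open>not_rank_ge\<close>.\<close>

lemma exhaustive_nu_schreier: "exhaustive (nu_schreier U lt \<alpha>)"
  unfolding exhaustive_def
proof (intro allI impI)
  fix a :: "nat \<Rightarrow> (nat \<Rightarrow> nat) set"
  assume a: "range a \<subseteq> Balg \<and> disjoint_family a"
  let ?\<mu> = "nu_schreier U lt \<alpha>"
  show "(\<lambda>n. ?\<mu> (a n)) \<longlonglongrightarrow> 0"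
  proof (rule ccontr)
    assume "\<not> ?thesis"
    then obtain c where c: "0 < c" "\<not> eventually (\<lambda>n. ?\<mu> (a n) < c) sequentially"
      by (auto simp: order_tendsto_iff)
    obtain e where e: "0 < e" "ennreal e \<le> c"
    proof (cases c)
      case (real r)
      then show thesis using c(1) that[of r] by auto
    next
      case top
      then show thesis using that[of 1] by simp
    qed
    have inf: "\<exists>n\<ge>N. ennreal e \<le> ?\<mu> (a n)" for N
      using c(2) e(2) unfolding eventually_sequentially by (meson not_less order_trans)
    have "rank_ge b {a n |n. N \<le> n \<and> ennreal e \<le> ?\<mu> (a n)}" for b N
    proof (induction b arbitrary: N rule: less_induct)
      case (less b)
      show ?case
      proof (rule rank_geI)
        fix d assume "d < b"
        obtain n where n: "N \<le> n" "ennreal e \<le> ?\<mu> (a n)" using inf by blast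
        have "a n' \<inter> a n = {}" if "Suc n \<le> n'" for n'
          using a that by (auto simp: disjoint_family_on_def)
        then have "{a n' |n'. Suc n \<le> n' \<and> ennreal e \<le> ?\<mu> (a n')}
            \<subseteq> perp {a n |n. N \<le> n \<and> ennreal e \<le> ?\<mu> (a n)} (a n)"
          using n(1) unfolding perp_def by fastforce
        then have "rank_ge d (perp {a n |n. N \<le> n \<and> ennreal e \<le> ?\<mu> (a n)} (a n))"
          using less.IH[OF \<open>d < b\<close>, of "Suc n"] rank_ge_mono by blast
        then show "\<exists>E\<in>{a n |n. N \<le> n \<and> ennreal e \<le> ?\<mu> (a n)}.
            rank_ge d (perp {a n |n. N \<le> n \<and> ennreal e \<le> ?\<mu> (a n)} E)" using n by blast
      qed
    qed
    then have "rank_ge (\<omega> \<up> (\<omega> * ((\<alpha> + 1) \<up> \<omega>))) {a n |n. 0 \<le> n \<and> ennreal e \<le> ?\<mu> (a n)}" .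
    then have "rank_ge (\<omega> \<up> (\<omega> * ((\<alpha> + 1) \<up> \<omega>))) {a \<in> Balg. ennreal e \<le> ?\<mu> a}"
      by (rule rank_ge_mono) (use a in auto)
    then show False using not_rank_ge[OF e(1)] by blast
  qed
qed

section \<open>The lower bound\<close>

definition Ncyl :: "nat set \<Rightarrow> (nat \<Rightarrow> nat) \<Rightarrow> (nat \<Rightarrow> nat) set" where
  "Ncyl D u = {x \<in> T_space. \<forall>i\<in>D. x i = u i}"

definition subcylinders :: "nat set \<Rightarrow> (nat \<Rightarrow> nat) \<Rightarrow> (nat \<Rightarrow> nat) set set" where
  "subcylinders D u = {Ncyl D' u' |D' u'. D \<subseteq> D' \<and> D' \<in> schreier lt \<alpha> \<and> u' \<in> T_space \<and> (\<forall>i\<in>D. u' i = u i)}"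

text \<open>\<open>\<beta>\<close> is the last term of a descending sequence witnessing \<open>D \<in> schreier lt \<alpha>\<close>.\<close>

definition ends_at :: "nat set \<Rightarrow> omega1 \<Rightarrow> bool" where
  "ends_at D \<beta> \<longleftrightarrow> finite D \<and>
    (\<exists>b. (\<forall>n\<in>D. lt n (b n) \<alpha>) \<and> (\<forall>m\<in>D. \<forall>n\<in>D. m < n \<longrightarrow> lt n (b n) (b m)) \<and>
      (\<forall>n \<beta>'. (\<forall>x\<in>D. x < n) \<longrightarrow> lt n \<beta>' \<beta> \<longrightarrow> lt n \<beta>' \<alpha> \<and> (\<forall>x\<in>D. lt n \<beta>' (b x))))"

lemma ends_at_empty: "ends_at {} \<alpha>"
  by (simp add: ends_at_def)

lemma ends_at_schreier: "ends_at D \<beta> \<Longrightarrow> D \<in> schreier lt \<alpha>"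
  unfolding schreier_iff[OF lt] ends_at_def by blast

lemma ends_at_insert:
  assumes D: "ends_at D \<beta>" "\<forall>x\<in>D. x < n" "lt n \<beta>' \<beta>"
  shows "ends_at (insert n D) \<beta>'"
proof -
  have trans: "lt n x z" if "lt n x y" "lt n y z" for n x y z
    using lt that by (meson schreier_orderings_def tree_ordering_def transpE)
  have mono: "lt n x y" if "lt m x y" "m \<le> n" for n m x y
    using lt that unfolding schreier_orderings_def by (metis order_le_less)
  obtain b where b: "finite D" "\<forall>n\<in>D. lt n (b n) \<alpha>" "\<forall>m\<in>D. \<forall>n\<in>D. m < n \<longrightarrow> lt n (b n) (b m)"
      "\<And>n \<beta>'. (\<forall>x\<in>D. x < n) \<Longrightarrow> lt n \<beta>' \<beta> \<Longrightarrow> lt n \<beta>' \<alpha> \<and> (\<forall>x\<in>D. lt n \<beta>' (b x))"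
    using D(1) unfolding ends_at_def by blast
  have new: "lt n \<beta>' \<alpha>" "\<forall>x\<in>D. lt n \<beta>' (b x)" using b(4)[OF D(2,3)] by auto
  show ?thesis unfolding ends_at_def
  proof (intro conjI exI[of _ "b(n := \<beta>')"] ballI allI impI)
    fix n' \<beta>'' assume n': "\<forall>x\<in>insert n D. x < n'" "lt n' \<beta>'' \<beta>'"
    have up: "lt n' \<beta>' x" if "lt n \<beta>' x" for x using mono[OF that] n'(1) by (simp add: less_imp_le)
    show "lt n' \<beta>'' \<alpha>" using trans[OF n'(2) up] new by blast
    show "lt n' \<beta>'' ((b(n := \<beta>')) x)" if "x \<in> insert n D" for x
      using trans[OF n'(2) up] new that n'(2) by auto
  qed (use b(1-3) new D(2) in \<open>auto dest: order_less_asym\<close>)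
qed

lemma rank_ge_subcylinders: "ends_at D \<beta> \<Longrightarrow> u \<in> T_space \<Longrightarrow> rank_ge (\<omega> \<up> \<beta>) (subcylinders D u)"
proof (induction \<beta> arbitrary: D u rule: less_induct)
  case (less \<beta>)
  have D: "D \<in> schreier lt \<alpha>" "finite D" using ends_at_schreier less.prems(1) by (auto simp: ends_at_def)
  show ?case
  proof (rule rank_geI)
    fix g assume g: "g < \<omega> \<up> \<beta>"
    show "\<exists>E\<in>subcylinders D u. rank_ge g (perp (subcylinders D u) E)"
    proof (cases "g < 1")
      case True
      have "Ncyl D u \<in> subcylinders D u" using D less.prems by (auto simp: subcylinders_def)
      moreover have "rank_ge g X" for X :: "(nat \<Rightarrow> nat) set set"
        using True by (intro rank_geI) (simp add: omega1_less_one_iff)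
      ultimately show ?thesis by blast
    next
      case False
      then obtain c where c: "c < \<beta>" "g < (\<omega> \<up> c) * \<omega>" using less_opowD[OF g] by blast
      then obtain z where z: "z < \<omega>" "g < (\<omega> \<up> c) * z + (\<omega> \<up> c)" using less_times_omega1D by blast
      obtain s' where "z = osucs s' 0" using less_omegaD[OF z(1)] by blast
      then have gs: "g < (\<omega> \<up> c) * osucs (Suc s') 0" using z(2) by (simp add: times_omega1_osuc)
      define s where "s = Suc s'"
      obtain n0 where n0: "lt n0 c \<beta>" using lt c(1) unfolding schreier_orderings_def by blast
      obtain d where d: "D \<subseteq> {..<d}" using D(2) finite_nat_iff_bounded by blast
      \<comment> \<open>Beyond \<open>D\<close>, late enough for \<open>lt n c \<beta>\<close>, and
        with room for \<open>s\<close> values at coordinate \<open>n\<close>.\<close>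
      define n where "n = max n0 (max d s)"
      have ltn: "lt n c \<beta>"
        using lt n0 unfolding schreier_orderings_def n_def by (metis max.cobounded1 order_le_less)
      have nD: "\<forall>x\<in>D. x < n" using d by (auto simp: n_def)
      have sn: "s \<le> 2 ^ n"
      proof -
        have "s \<le> n" by (simp add: n_def)
        then show ?thesis using less_exp[of n] by linarith
      qed
      let ?P = "\<lambda>j. subcylinders (insert n D) (u(n := j))"
      have piece: "rank_ge (\<omega> \<up> c) (?P j)" if "j < s" for j
      proof (rule less.IH[OF c(1)])
        show "ends_at (insert n D) c" by (rule ends_at_insert[OF less.prems(1) nD ltn])
        show "u(n := j) \<in> T_space" using less.prems(2) that sn by (auto simp: T_space_def)
      qed
      have pieceE: "E \<subseteq> {x. x n = j}" if "E \<in> ?P j" for E j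
        using that by (auto simp: subcylinders_def Ncyl_def)
      \<comment> \<open>Cylinders with different values at \<open>n\<close> are disjoint, so the
        ranks of the pieces add.\<close>
      have "rank_ge ((\<omega> \<up> c) * osucs i 0) (\<Union>j<i. ?P j)" if "i \<le> s" for i
        using that
      proof (induction i)
        case 0
        then show ?case by (intro rank_geI) simp
      next
        case (Suc i)
        have "rank_ge ((\<omega> \<up> c) * osucs i 0 + (\<omega> \<up> c)) ((\<Union>j<i. ?P j) \<union> ?P i)"
        proof (rule rank_ge_plus[OF Suc.IH piece])
          fix A B assume "A \<in> (\<Union>j<i. ?P j)" "B \<in> ?P i"
          then obtain j where "j < i" "A \<in> ?P j" "B \<in> ?P i" by blast
          then show "A \<inter> B = {}" using pieceE[of A j] pieceE[of B i] by auto
        qed (use Suc.prems in auto)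
        moreover have "(\<Union>j<Suc i. ?P j) = (\<Union>j<i. ?P j) \<union> ?P i" by (auto simp: lessThan_Suc)
        ultimately show ?case by (simp only: times_omega1_osuc funpow.simps comp_apply)
      qed
      then have "rank_ge ((\<omega> \<up> c) * osucs s 0) (\<Union>j<s. ?P j)" by simp
      moreover have "(\<Union>j<s. ?P j) \<subseteq> subcylinders D u"
      proof
        fix E assume "E \<in> (\<Union>j<s. ?P j)"
        then obtain j D' u' where E: "E = Ncyl D' u'" "insert n D \<subseteq> D'" "D' \<in> schreier lt \<alpha>" "u' \<in> T_space"
            "\<forall>i\<in>insert n D. u' i = (u(n := j)) i" by (auto simp: subcylinders_def)
        then have "\<forall>i\<in>D. u' i = u i" using nD by auto
        then show "E \<in> subcylinders D u" using E unfolding subcylinders_def by blast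
      qed
      ultimately have "rank_ge ((\<omega> \<up> c) * osucs s 0) (subcylinders D u)" using rank_ge_mono by blast
      then show ?thesis using rank_geD gs unfolding s_def by blast
    qed
  qed
qed

lemma Ncyl_in_Balg: "finite D \<Longrightarrow> Ncyl D u \<in> Balg"
proof -
  assume "finite D"
  then obtain d where "D \<subseteq> {..<d}" using finite_nat_iff_bounded by blast
  then have "Ncyl D u \<in> Balg_at d" by (auto simp: Ncyl_def Balg_at_def subset_iff)
  then show ?thesis by (rule Balg_at_Balg)
qed

lemma rank_ge_omega_power:
  "rank_ge (\<omega> \<up> \<alpha>) {a \<in> Balg. ennreal 1 \<le> nu_schreier U lt \<alpha> a}"
proof (rule rank_ge_mono[OF rank_ge_subcylinders[OF ends_at_empty zero_in_T_space]])
  show "subcylinders {} (\<lambda>_. 0) \<subseteq> {a \<in> Balg. ennreal 1 \<le> nu_schreier U lt \<alpha> a}"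
  proof
    fix E assume "E \<in> subcylinders {} (\<lambda>_. 0)"
    then obtain D u where E: "E = Ncyl D u" "D \<in> schreier lt \<alpha>" "u \<in> T_space"
      by (auto simp: subcylinders_def)
    have "1 \<le> \<nu> 0 E" unfolding E(1) Ncyl_def by (rule nu_cylinder_ge[OF E(2,3)])
    moreover have "E \<in> Balg" unfolding E(1) by (rule Ncyl_in_Balg[OF S_finite[OF E(2)]])
    ultimately show "E \<in> {a \<in> Balg. ennreal 1 \<le> nu_schreier U lt \<alpha> a}" by (simp add: nu_schreier_def)
  qed
qed simp

lemma nu_schreier_empty: "nu_schreier U lt \<alpha> {} = 0"
  by (simp add: nu_schreier_def nu_empty)

end

section \<open>Exhaustivity ranks\<close>

lemma countable_Dfam: "countable (Dfam e \<mu>)"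
proof -
  have "countable Balg" unfolding Balg_def by (intro countable_UN) (auto intro: countable_finite finite_Balg_at)
  then have "countable {F. finite F \<and> F \<subseteq> Balg}" by (rule countable_Collect_finite_subset)
  then show ?thesis by (rule countable_subset[rotated]) (auto simp: Dfam_def)
qed

lemma rank_at_less:
  assumes "exhaustive \<mu>" "0 < e" "F \<in> Dfam e \<mu>" "G \<in> Dfam e \<mu>" "F \<subset> G"
  shows "rank_at e \<mu> G < rank_at e \<mu> F"
proof -
  have "countable {G \<in> Dfam e \<mu>. F \<subset> G}" by (rule countable_subset[OF _ countable_Dfam]) blast
  then have "osuc (rank_at e \<mu> G) \<le> rank_at e \<mu> F"
    unfolding rank_at_eq[OF assms(1-3)] using assms(4,5) by (intro omega1_Sup_upper) auto
  then show ?thesis by (simp add: osuc_le_iff)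
qed

text \<open>The sets by which \<open>F\<close> can be extended. They link families ordered by
  inclusion to \<open>rank_ge\<close>, which adds one set at a time.\<close>

definition free_members :: "real \<Rightarrow> ((nat \<Rightarrow> nat) set \<Rightarrow> ennreal) \<Rightarrow> (nat \<Rightarrow> nat) set set \<Rightarrow> (nat \<Rightarrow> nat) set set" where
  "free_members e \<mu> F = {a \<in> Balg. ennreal e \<le> \<mu> a \<and> (\<forall>b\<in>F. a \<inter> b = {})}"

lemma perp_free_members: "perp (free_members e \<mu> F) a = free_members e \<mu> (insert a F)"
  by (auto simp: perp_def free_members_def)

lemma insert_Dfam:
  assumes "F \<in> Dfam e \<mu>" "a \<in> free_members e \<mu> F"
  shows "insert a F \<in> Dfam e \<mu>"
  using assms by (auto simp: Dfam_def free_members_def pairwise_insert disjnt_def Int_commute)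

text \<open>A proper extension \<open>G\<close> of \<open>F\<close> has a new set \<open>a\<close>;
  then \<open>insert a F\<close> lies between \<open>F\<close> and \<open>G\<close>, and its rank is
  at least that of \<open>G\<close>.\<close>

lemma rank_ge_if_rank_at_ge:
  assumes "exhaustive \<mu>" "0 < e" "F \<in> Dfam e \<mu>" "b \<le> rank_at e \<mu> F"
  shows "rank_ge b (free_members e \<mu> F)"
  using assms(3,4)
proof (induction b arbitrary: F rule: less_induct)
  case (less b)
  show ?case
  proof (rule rank_geI)
    fix c assume c: "c < b"
    then have "c < rank_at e \<mu> F" using less.prems by simp
    then obtain G where G: "G \<in> Dfam e \<mu>" "F \<subset> G" "c < osuc (rank_at e \<mu> G)"
      unfolding rank_at_eq[OF assms(1,2) less.prems(1)] by (auto dest!: omega1_less_SupD)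
    then obtain a where a: "a \<in> G" "a \<notin> F" by blast
    have "disjoint G" using G(1) by (simp add: Dfam_def)
    then have "a \<inter> x = {}" if "x \<in> F" for x
      using pairwiseD[of disjnt G a x] G(2) a that by (auto simp: disjnt_def)
    then have free: "a \<in> free_members e \<mu> F" using G(1) a(1) by (auto simp: free_members_def Dfam_def)
    have D: "insert a F \<in> Dfam e \<mu>" by (rule insert_Dfam[OF less.prems(1) free])
    have "rank_at e \<mu> G \<le> rank_at e \<mu> (insert a F)"
      using rank_at_less[OF assms(1,2) D G(1)] G(2) a(1) by (cases "G = insert a F") (auto intro: less_imp_le)
    then have "c \<le> rank_at e \<mu> (insert a F)" using G(3) by (simp add: less_osuc_iff)
    then have "rank_ge c (free_members e \<mu> (insert a F))" by (rule less.IH[OF c D])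
    then show "\<exists>a\<in>free_members e \<mu> F. rank_ge c (perp (free_members e \<mu> F) a)"
      using free by (auto simp: perp_free_members)
  qed
qed

text \<open>Since \<open>\<mu> {} = 0\<close>, a set of positive value is nonempty. A set disjoint
  from all members of \<open>F\<close> is therefore new, and the extension is proper.\<close>

lemma rank_at_ge_if_rank_ge:
  assumes "exhaustive \<mu>" "0 < e" "\<mu> {} = 0" "F \<in> Dfam e \<mu>" "rank_ge b (free_members e \<mu> F)"
  shows "b \<le> rank_at e \<mu> F"
  using assms(4,5)
proof (induction b arbitrary: F rule: less_induct)
  case (less b)
  have "c < rank_at e \<mu> F" if c: "c < b" for c
  proof -
    obtain a where a: "a \<in> free_members e \<mu> F" "rank_ge c (free_members e \<mu> (insert a F))"
      using rank_geD[OF less.prems(2) c] by (auto simp: perp_free_members)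
    have D: "insert a F \<in> Dfam e \<mu>" by (rule insert_Dfam[OF less.prems(1) a(1)])
    have "a \<noteq> {}" using a(1) assms(2,3) by (auto simp: free_members_def)
    then have "a \<notin> F" using a(1) by (auto simp: free_members_def)
    then have "rank_at e \<mu> (insert a F) < rank_at e \<mu> F"
      by (intro rank_at_less[OF assms(1,2) less.prems(1) D]) auto
    moreover have "c \<le> rank_at e \<mu> (insert a F)" by (rule less.IH[OF c D a(2)])
    ultimately show ?thesis by simp
  qed
  then show ?case by (meson leI order_less_irrefl)
qed

theorem corollary5p9:
  fixes lt :: "nat \<Rightarrow> omega1 \<Rightarrow> omega1 \<Rightarrow> bool"
    and U :: "nat filter"
    and \<alpha> :: omega1
  assumes "schreier_orderings lt"
    and "nonprincipal_ultrafilter U"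
    and "0 < \<alpha>"
  shows "\<omega> \<up> \<alpha> \<le> exh_rank (nu_schreier U lt \<alpha>) \<and>
         exh_rank (nu_schreier U lt \<alpha>) \<le> \<omega> \<up> (\<omega> * ((\<alpha> + 1) \<up> \<omega>))"
proof -
  let ?\<mu> = "nu_schreier U lt \<alpha>"
  have exh: "exhaustive ?\<mu>" by (rule exhaustive_nu_schreier[OF assms(1,3,2)])
  have empty: "{} \<in> Dfam e ?\<mu>" for e by (simp add: Dfam_def)
  have free: "free_members e ?\<mu> {} = {a \<in> Balg. ennreal e \<le> ?\<mu> a}" for e
    by (simp add: free_members_def)
  have upper: "rank_eps e ?\<mu> \<le> \<omega> \<up> (\<omega> * ((\<alpha> + 1) \<up> \<omega>))" if "0 < e" for e
    using rank_ge_if_rank_at_ge[OF exh that empty] not_rank_ge[OF assms(1,3,2) that]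
    unfolding free rank_eps_def by (meson leI less_imp_le)
  \<comment> \<open>All cylinders over Schreier sets have value at least 1, so \<epsilon> = 1 gives
    the lower bound.\<close>
  have "\<omega> \<up> \<alpha> \<le> rank_eps 1 ?\<mu>"
    unfolding rank_eps_def
  proof (rule rank_at_ge_if_rank_ge[OF exh _ _ empty])
    show "?\<mu> {} = 0" by (rule nu_schreier_empty[OF assms(1,3,2)])
    show "rank_ge (\<omega> \<up> \<alpha>) (free_members 1 ?\<mu> {})"
      unfolding free by (rule rank_ge_omega_power[OF assms(1,3,2)])
  qed simp
  also have "\<dots> \<le> exh_rank ?\<mu>"
    unfolding exh_rank_def
  proof (rule cSUP_upper)
    \<comment> \<open>The upper bound, valid for every positive \<epsilon>, makes the supremum
      meaningful.\<close>
    show "bdd_above ((\<lambda>e. rank_eps e ?\<mu>) ` {0<..})" by (rule bdd_aboveI2) (rule upper, simp)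
  qed simp
  finally show ?thesis
    unfolding exh_rank_def using upper by (auto intro: omega1_Sup_least)
qed

end
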